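(* Let $\Lambda^\vee$ be a lattice, $I$ an even symmetric bilinear form on $\Lambda^\vee$, $J$ an integral bilinear form on $\Lambda^\vee$ with $I(m,n)=J(m,n)+J(n,m)$, and $\mathcal T$ the associated categorical torus. Put $\mathfrak t=\Lambda^\vee\otimes\mathbb R$, $T=\Lambda^\vee\otimes U(1)$, and $\exp:\mathfrak t\to T$, $\exp=\Lambda^\vee\otimes e^{2\pi i(-)}$. The inertia groupoid $\mathcal T/\!/\mathcal T^{conj}$ is equivalent to (i) the Lie groupoid with objects $T$ and arrows $(T\times\mathfrak t\times U(1))/\sim$, where $$(t,y+n,w)\sim(t,y,w\cdot e^{-2\pi iI(x,n)}),\qquad n\in\Lambda^\vee,$$ with $x\in\mathfrak t$ any element with $\exp(x)=t$; source and target of $[t,y,w]$ both equal $t$, and composition is $[t,y,w]\circ[t,y',w']=[t,y+y',w\cdot w']$; (ii) the Lie groupoid with objects $T$ and arrows $(\mathfrak t\times T\times U(1))/\sim$, where $$(x+m,s,z)\sim(x,s,z\cdot e^{2\pi iI(m,y)}),\qquad m\in\Lambda^\vee,$$ with $y\in\mathfrak t$ any element with $\exp(y)=s$; source and target of $[x,s,z]$ both equal $\exp(x)$, and composition is $[x,s,z]\circ[x,s',z']=[x,s\cdot s',z\cdot z']$.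
   Context: **Categorical torus.** $J$ and $I$ are extended bilinearly to $\mathfrak t$. $\mathcal T$ is the strict categorical group (strict monoidal groupoid) with objects $\mathfrak t$ and arrows $x\xrightarrow{[a]}x+m$ with $x\in\mathfrak t$, $m\in\Lambda^\vee$, label $[a]\in\mathbb R/\mathbb Z\cong U(1)$ (via $a\mapsto e^{2\pi ia}$). Composition adds labels. The monoidal structure is addition on objects and $$(x\xrightarrow{[a]}x+m)\bullet(y\xrightarrow{[b]}y+n)=(x+y\xrightarrow{[a+b+J(m,y)]}x+y+m+n),$$ with trivial associators and unit maps. **Inertia groupoid.** $\mathbb B\mathbb Z$ is the one-object category with automorphism group $\mathbb Z$ (viewed as a bicategory with only identity 2-arrows) and $\mathbb B\mathcal T$ the one-object bicategory with endomorphism category $\mathcal T$. The inertia 2-groupoid of $\mathcal T$ is the 2-groupoid $\mathbf{Bicat}(\mathbb B\mathbb Z,\mathbb B\mathcal T)$ of bifunctors (equivalently, strong monoidal functors $\mathbb Z\to\mathcal T$), pseudo-natural transformations and modifications; it is equivalent, via inclusion, to its full sub-2-groupoid on strict monoidal functors. The inertia groupoid $\mathcal T/\!/\mathcal T^{conj}$ is obtained from the inertia 2-groupoid by taking 2-isomorphism classes of 1-arrows. Equivalence is equivalence of Lie groupoids. *)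

theory Defs
  imports "HOL-Analysis.Analysis" "HOL-Algebra.Free_Abelian_Groups"
begin

section \<open>Groupoids\<close>

record ('o, 'f) gpd =
  Obj :: "'o set"
  Arr :: "'f set"
  src :: "'f \<Rightarrow> 'o"
  tgt :: "'f \<Rightarrow> 'o"
  iden :: "'o \<Rightarrow> 'f"
  cmp :: "'f \<Rightarrow> 'f \<Rightarrow> 'f" (infixl "\<cdot>\<index>" 70)

text \<open>Composition is written in the order of functions: \<open>g \<cdot> f\<close> is defined when
  \<open>src g = tgt f\<close>.\<close>

definition is_groupoid :: "('o, 'f, 'z) gpd_scheme \<Rightarrow> bool" where
  "is_groupoid G \<longleftrightarrow>
     (\<forall>f\<in>Arr G. src G f \<in> Obj G \<and> tgt G f \<in> Obj G) \<and>
     (\<forall>x\<in>Obj G. iden G x \<in> Arr G \<and> src G (iden G x) = x \<and> tgt G (iden G x) = x) \<and>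
     (\<forall>f\<in>Arr G. \<forall>g\<in>Arr G. src G g = tgt G f \<longrightarrow>
        g \<cdot>\<^bsub>G\<^esub> f \<in> Arr G \<and> src G (g \<cdot>\<^bsub>G\<^esub> f) = src G f \<and> tgt G (g \<cdot>\<^bsub>G\<^esub> f) = tgt G g) \<and>
     (\<forall>f\<in>Arr G. f \<cdot>\<^bsub>G\<^esub> iden G (src G f) = f \<and> iden G (tgt G f) \<cdot>\<^bsub>G\<^esub> f = f) \<and>
     (\<forall>f\<in>Arr G. \<forall>g\<in>Arr G. \<forall>h\<in>Arr G. src G g = tgt G f \<longrightarrow> src G h = tgt G g \<longrightarrow>
        (h \<cdot>\<^bsub>G\<^esub> g) \<cdot>\<^bsub>G\<^esub> f = h \<cdot>\<^bsub>G\<^esub> (g \<cdot>\<^bsub>G\<^esub> f)) \<and>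
     (\<forall>f\<in>Arr G. \<exists>g\<in>Arr G. src G g = tgt G f \<and> tgt G g = src G f \<and>
        g \<cdot>\<^bsub>G\<^esub> f = iden G (src G f) \<and> f \<cdot>\<^bsub>G\<^esub> g = iden G (tgt G f))"

definition arr_inv :: "('o, 'f, 'z) gpd_scheme \<Rightarrow> 'f \<Rightarrow> 'f" where
  "arr_inv G f = (THE g. g \<in> Arr G \<and> src G g = tgt G f \<and> tgt G g = src G f \<and>
     g \<cdot>\<^bsub>G\<^esub> f = iden G (src G f) \<and> f \<cdot>\<^bsub>G\<^esub> g = iden G (tgt G f))"

definition is_functor ::
  "('o, 'f, 'y) gpd_scheme \<Rightarrow> ('p, 'g, 'z) gpd_scheme \<Rightarrow> ('o \<Rightarrow> 'p) \<Rightarrow> ('f \<Rightarrow> 'g) \<Rightarrow> bool" where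
  "is_functor G H F0 F1 \<longleftrightarrow>
     (\<forall>x\<in>Obj G. F0 x \<in> Obj H \<and> F1 (iden G x) = iden H (F0 x)) \<and>
     (\<forall>f\<in>Arr G. F1 f \<in> Arr H \<and> src H (F1 f) = F0 (src G f) \<and> tgt H (F1 f) = F0 (tgt G f)) \<and>
     (\<forall>f\<in>Arr G. \<forall>g\<in>Arr G. src G g = tgt G f \<longrightarrow> F1 (g \<cdot>\<^bsub>G\<^esub> f) = F1 g \<cdot>\<^bsub>H\<^esub> F1 f)"

definition groupoid_equivalence ::
  "('o, 'f, 'y) gpd_scheme \<Rightarrow> ('p, 'g, 'z) gpd_scheme \<Rightarrow> ('o \<Rightarrow> 'p) \<Rightarrow> ('f \<Rightarrow> 'g) \<Rightarrow> bool" where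
  "groupoid_equivalence G H F0 F1 \<longleftrightarrow>
     is_groupoid G \<and> is_groupoid H \<and> is_functor G H F0 F1 \<and>
     (\<forall>z\<in>Obj H. \<exists>x\<in>Obj G. \<exists>g\<in>Arr H. src H g = F0 x \<and> tgt H g = z) \<and>
     (\<forall>x\<in>Obj G. \<forall>y\<in>Obj G.
        bij_betw F1 {f\<in>Arr G. src G f = x \<and> tgt G f = y}
                    {g\<in>Arr H. src H g = F0 x \<and> tgt H g = F0 y})"

section \<open>Smooth manifolds\<close>

text \<open>On an open subset of a finite-dimensional space, \<open>C\<^sup>k\<close> in the usual sense: all iterated
  directional derivatives up to order \<open>k\<close> exist and are continuous.\<close>

primrec Ck_on :: "nat \<Rightarrow> 'e::real_normed_vector set \<Rightarrow> ('e \<Rightarrow> 'd::real_normed_vector) \<Rightarrow> bool" where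
  "Ck_on 0 S f \<longleftrightarrow> continuous_on S f"
| "Ck_on (Suc k) S f \<longleftrightarrow> (\<forall>x\<in>S. f differentiable (at x)) \<and>
     (\<forall>v. Ck_on k S (\<lambda>x. frechet_derivative f (at x) v))"

definition smooth_on :: "'e::real_normed_vector set \<Rightarrow> ('e \<Rightarrow> 'd::real_normed_vector) \<Rightarrow> bool" where
  "smooth_on S f \<longleftrightarrow> (\<forall>k. Ck_on k S f)"

type_synonym ('m, 'e) atlas = "('m set \<times> ('m \<Rightarrow> 'e)) set"

definition atlas_topology :: "'m set \<Rightarrow> ('m, 'e::real_normed_vector) atlas \<Rightarrow> 'm topology" where
  "atlas_topology M A = topology (\<lambda>W. W \<subseteq> M \<and> (\<forall>(U, \<phi>)\<in>A. open (\<phi> ` (U \<inter> W))))"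

text \<open>The model space is a finite-dimensional normed space rather than a \<open>euclidean_space\<close> so that
  dimension \<open>0\<close> is included; its smooth structure does not depend on the norm.\<close>

definition smooth_manifold :: "'m set \<Rightarrow> ('m, 'e::real_normed_vector) atlas \<Rightarrow> bool" where
  "smooth_manifold M A \<longleftrightarrow>
     (\<exists>B::'e set. finite B \<and> span B = UNIV) \<and>
     (\<forall>(U, \<phi>)\<in>A. U \<subseteq> M \<and> inj_on \<phi> U \<and> open (\<phi> ` U)) \<and>
     (\<Union>(U, \<phi>)\<in>A. U) = M \<and>
     (\<forall>(U, \<phi>)\<in>A. \<forall>(V, \<psi>)\<in>A.
        open (\<phi> ` (U \<inter> V)) \<and> smooth_on (\<phi> ` (U \<inter> V)) (\<psi> \<circ> inv_into U \<phi>)) \<and>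
     Hausdorff_space (atlas_topology M A) \<and> second_countable (atlas_topology M A)"

definition prod_atlas :: "('m, 'e) atlas \<Rightarrow> ('n, 'd) atlas \<Rightarrow> ('m \<times> 'n, 'e \<times> 'd) atlas" where
  "prod_atlas A B = {(U \<times> V, map_prod \<phi> \<psi>) | U \<phi> V \<psi>. (U, \<phi>) \<in> A \<and> (V, \<psi>) \<in> B}"

text \<open>Smoothness of a map on an arbitrary subset \<open>S\<close> of a manifold: in charts, the map locally extends
  to a smooth map. For open \<open>S\<close> and for embedded submanifolds (such as fibre products along
  submersions) this is ordinary smoothness.\<close>

definition smooth_map_on ::
  "('m, 'e::real_normed_vector) atlas \<Rightarrow> ('n, 'd::real_normed_vector) atlas \<Rightarrow> 'm set \<Rightarrow> ('m \<Rightarrow> 'n) \<Rightarrow> bool" where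
  "smooth_map_on A B S f \<longleftrightarrow>
     (\<forall>p\<in>S. \<exists>(U, \<phi>)\<in>A. \<exists>(V, \<psi>)\<in>B. \<exists>W g.
        p \<in> U \<and> f p \<in> V \<and> open W \<and> \<phi> p \<in> W \<and> W \<subseteq> \<phi> ` U \<and> smooth_on W g \<and>
        (\<forall>q\<in>S \<inter> U. \<phi> q \<in> W \<longrightarrow> f q \<in> V \<and> \<psi> (f q) = g (\<phi> q)))"

text \<open>Surjectivity of the differential of \<open>f\<close> on an (embedded sub)manifold \<open>S\<close>, tangent vectors being
  velocities of smooth curves in \<open>S\<close>.\<close>

definition submersion_on ::
  "('m, 'e::real_normed_vector) atlas \<Rightarrow> ('n, 'd::real_normed_vector) atlas \<Rightarrow> 'm set \<Rightarrow> ('m \<Rightarrow> 'n) \<Rightarrow> bool" where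
  "submersion_on A B S f \<longleftrightarrow> smooth_map_on A B S f \<and>
     (\<forall>p\<in>S. \<forall>(V, \<psi>)\<in>B. f p \<in> V \<longrightarrow>
        (\<forall>v. \<exists>\<epsilon>>0. \<exists>\<gamma>::real \<Rightarrow> 'm. \<gamma> 0 = p \<and> \<gamma> ` {-\<epsilon><..<\<epsilon>} \<subseteq> S \<and>
           smooth_map_on {(UNIV, id)} A {-\<epsilon><..<\<epsilon>} \<gamma> \<and>
           ((\<psi> \<circ> f \<circ> \<gamma>) has_vector_derivative v) (at 0)))"

text \<open>The smooth structure for which every map in \<open>Q\<close> is a local diffeomorphism (when there is one):
  its charts are the local inverses of the maps in \<open>Q\<close>.\<close>

definition local_inverse_atlas :: "('e::real_normed_vector \<Rightarrow> 'm) set \<Rightarrow> ('m, 'e) atlas" where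
  "local_inverse_atlas Q = {(q ` V, inv_into V q) | q V. q \<in> Q \<and> open V \<and> inj_on q V}"

section \<open>Lie groupoids and their equivalences\<close>

record ('o, 'f, 'e, 'd) lie_gpd = "('o, 'f) gpd" +
  atlas_Obj :: "('o, 'e) atlas"
  atlas_Arr :: "('f, 'd) atlas"

definition is_lie_groupoid ::
  "('o, 'f, 'e::real_normed_vector, 'd::real_normed_vector) lie_gpd \<Rightarrow> bool" where
  "is_lie_groupoid G \<longleftrightarrow> is_groupoid G \<and>
     smooth_manifold (Obj G) (atlas_Obj G) \<and> smooth_manifold (Arr G) (atlas_Arr G) \<and>
     submersion_on (atlas_Arr G) (atlas_Obj G) (Arr G) (src G) \<and>
     submersion_on (atlas_Arr G) (atlas_Obj G) (Arr G) (tgt G) \<and>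
     smooth_map_on (atlas_Obj G) (atlas_Arr G) (Obj G) (iden G) \<and>
     smooth_map_on (prod_atlas (atlas_Arr G) (atlas_Arr G)) (atlas_Arr G)
       {(g, f). g \<in> Arr G \<and> f \<in> Arr G \<and> src G g = tgt G f} (\<lambda>(g, f). g \<cdot>\<^bsub>G\<^esub> f) \<and>
     smooth_map_on (atlas_Arr G) (atlas_Arr G) (Arr G) (arr_inv G)"

text \<open>A smooth functor \<open>G \<rightarrow> H\<close> is an equivalence of Lie groupoids (Moerdijk) if

  \<^item> the target map \<open>Obj G \<times>\<^bsub>Obj H\<^esub> Arr H \<rightarrow> Obj H\<close> is a surjective submersion, and

  \<^item> \<open>Arr G\<close> is, as a manifold, the fibre product of \<open>Obj G \<times> Obj G\<close> and \<open>Arr H\<close> over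
    \<open>Obj H \<times> Obj H\<close>.\<close>

definition lie_equivalence ::
  "('o, 'f, 'e::real_normed_vector, 'd::real_normed_vector) lie_gpd \<Rightarrow>
   ('p, 'g, 'e1::real_normed_vector, 'd1::real_normed_vector) lie_gpd \<Rightarrow>
   ('o \<Rightarrow> 'p) \<Rightarrow> ('f \<Rightarrow> 'g) \<Rightarrow> bool" where
  "lie_equivalence G H F0 F1 \<longleftrightarrow>
     is_lie_groupoid G \<and> is_lie_groupoid H \<and> is_functor G H F0 F1 \<and>
     smooth_map_on (atlas_Obj G) (atlas_Obj H) (Obj G) F0 \<and>
     smooth_map_on (atlas_Arr G) (atlas_Arr H) (Arr G) F1 \<and>
     (let S = {(x, g). x \<in> Obj G \<and> g \<in> Arr H \<and> src H g = F0 x}; \<tau> = (\<lambda>(x, g). tgt H g)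
      in \<tau> ` S = Obj H \<and>
         submersion_on (prod_atlas (atlas_Obj G) (atlas_Arr H)) (atlas_Obj H) S \<tau>) \<and>
     (let P = {(x, y, g). x \<in> Obj G \<and> y \<in> Obj G \<and> g \<in> Arr H \<and> src H g = F0 x \<and> tgt H g = F0 y};
          K = (\<lambda>f. (src G f, tgt G f, F1 f))
      in bij_betw K (Arr G) P \<and>
         smooth_map_on (prod_atlas (atlas_Obj G) (prod_atlas (atlas_Obj G) (atlas_Arr H)))
           (atlas_Arr G) P (inv_into (Arr G) K))"

section \<open>The inertia groupoid of a strict categorical group\<close>

record ('o, 'f) mon_gpd = "('o, 'f) gpd" +
  tenO :: "'o \<Rightarrow> 'o \<Rightarrow> 'o" (infixl "\<odot>\<index>" 70)
  tenA :: "'f \<Rightarrow> 'f \<Rightarrow> 'f" (infixl "\<star>\<index>" 70)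
  unitO :: 'o

text \<open>Bifunctors \<open>\<bbbB>\<int> \<rightarrow> \<bbbB>C\<close>, that is, strong monoidal functors \<open>\<int> \<rightarrow> C\<close> from the discrete monoidal category
  \<open>\<int>\<close> (whose only arrows are identities), for a strict monoidal groupoid \<open>C\<close>.\<close>

record ('o, 'f) zfun =
  fob :: "int \<Rightarrow> 'o"
  fmult :: "int \<Rightarrow> int \<Rightarrow> 'f"
  funit :: 'f

definition monoidal_funs :: "('o, 'f, 'z) mon_gpd_scheme \<Rightarrow> ('o, 'f) zfun set" where
  "monoidal_funs C = {F.
     (\<forall>a. fob F a \<in> Obj C) \<and>
     (\<forall>a b. fmult F a b \<in> Arr C \<and> src C (fmult F a b) = fob F a \<odot>\<^bsub>C\<^esub> fob F b \<and>
            tgt C (fmult F a b) = fob F (a + b)) \<and>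
     funit F \<in> Arr C \<and> src C (funit F) = unitO C \<and> tgt C (funit F) = fob F 0 \<and>
     (\<forall>a b c. fmult F (a + b) c \<cdot>\<^bsub>C\<^esub> (fmult F a b \<star>\<^bsub>C\<^esub> iden C (fob F c)) =
              fmult F a (b + c) \<cdot>\<^bsub>C\<^esub> (iden C (fob F a) \<star>\<^bsub>C\<^esub> fmult F b c)) \<and>
     (\<forall>a. fmult F 0 a \<cdot>\<^bsub>C\<^esub> (funit F \<star>\<^bsub>C\<^esub> iden C (fob F a)) = iden C (fob F a) \<and>
          fmult F a 0 \<cdot>\<^bsub>C\<^esub> (iden C (fob F a) \<star>\<^bsub>C\<^esub> funit F) = iden C (fob F a))}"

definition strict_monoidal_funs :: "('o, 'f, 'z) mon_gpd_scheme \<Rightarrow> ('o, 'f) zfun set" where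
  "strict_monoidal_funs C = {F \<in> monoidal_funs C.
     (\<forall>a b. fob F (a + b) = fob F a \<odot>\<^bsub>C\<^esub> fob F b \<and> fmult F a b = iden C (fob F (a + b))) \<and>
     fob F 0 = unitO C \<and> funit F = iden C (unitO C)}"

text \<open>Pseudo-natural transformations \<open>F \<Rightarrow> G\<close>: the component at the unique object of \<open>\<bbbB>\<int>\<close> is an object
  \<open>y\<close> of \<open>C\<close>, and naturality at \<open>a \<in> \<int>\<close> is witnessed by an arrow \<open>\<sigma> a: G a \<odot> y \<rightarrow> y \<odot> F a\<close>.\<close>

type_synonym ('o, 'f) transf = "'o \<times> (int \<Rightarrow> 'f)"

definition transfs ::
  "('o, 'f, 'z) mon_gpd_scheme \<Rightarrow> ('o, 'f) zfun \<Rightarrow> ('o, 'f) zfun \<Rightarrow> ('o, 'f) transf set" where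
  "transfs C F G = {(y, \<sigma>).
     y \<in> Obj C \<and>
     (\<forall>a. \<sigma> a \<in> Arr C \<and> src C (\<sigma> a) = fob G a \<odot>\<^bsub>C\<^esub> y \<and> tgt C (\<sigma> a) = y \<odot>\<^bsub>C\<^esub> fob F a) \<and>
     (\<forall>a b. \<sigma> (a + b) \<cdot>\<^bsub>C\<^esub> (fmult G a b \<star>\<^bsub>C\<^esub> iden C y) =
        (iden C y \<star>\<^bsub>C\<^esub> fmult F a b) \<cdot>\<^bsub>C\<^esub>
          ((\<sigma> a \<star>\<^bsub>C\<^esub> iden C (fob F b)) \<cdot>\<^bsub>C\<^esub> (iden C (fob G a) \<star>\<^bsub>C\<^esub> \<sigma> b))) \<and>
     \<sigma> 0 \<cdot>\<^bsub>C\<^esub> (funit G \<star>\<^bsub>C\<^esub> iden C y) = iden C y \<star>\<^bsub>C\<^esub> funit F}"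

definition transf_id :: "('o, 'f, 'z) mon_gpd_scheme \<Rightarrow> ('o, 'f) zfun \<Rightarrow> ('o, 'f) transf" where
  "transf_id C F = (unitO C, \<lambda>a. iden C (fob F a))"

text \<open>The composite of \<open>s: F \<Rightarrow> G\<close> and \<open>t: G \<Rightarrow> H\<close>.\<close>

definition transf_comp ::
  "('o, 'f, 'z) mon_gpd_scheme \<Rightarrow> ('o, 'f) transf \<Rightarrow> ('o, 'f) transf \<Rightarrow> ('o, 'f) transf" where
  "transf_comp C t s =
     (fst t \<odot>\<^bsub>C\<^esub> fst s,
      \<lambda>a. (iden C (fst t) \<star>\<^bsub>C\<^esub> snd s a) \<cdot>\<^bsub>C\<^esub> (snd t a \<star>\<^bsub>C\<^esub> iden C (fst s)))"

definition modifications ::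
  "('o, 'f, 'z) mon_gpd_scheme \<Rightarrow> ('o, 'f) zfun \<Rightarrow> ('o, 'f) zfun \<Rightarrow>
   ('o, 'f) transf \<Rightarrow> ('o, 'f) transf \<Rightarrow> 'f set" where
  "modifications C F G s t = {\<mu>\<in>Arr C. src C \<mu> = fst s \<and> tgt C \<mu> = fst t \<and>
     (\<forall>a. snd t a \<cdot>\<^bsub>C\<^esub> (iden C (fob G a) \<star>\<^bsub>C\<^esub> \<mu>) = (\<mu> \<star>\<^bsub>C\<^esub> iden C (fob F a)) \<cdot>\<^bsub>C\<^esub> snd s a)}"

text \<open>Since \<open>C\<close> is a groupoid, all modifications are invertible, so two 1-arrows are 2-isomorphic iff
  there is a modification between them. Arrows of the inertia groupoid carry their source and target
  together with a 2-isomorphism class of transformations.\<close>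

definition transf_iso ::
  "('o, 'f, 'z) mon_gpd_scheme \<Rightarrow> ('o, 'f) zfun \<Rightarrow> ('o, 'f) zfun \<Rightarrow>
   (('o, 'f) transf \<times> ('o, 'f) transf) set" where
  "transf_iso C F G =
     {(s, t). s \<in> transfs C F G \<and> t \<in> transfs C F G \<and> modifications C F G s t \<noteq> {}}"

type_synonym ('o, 'f) inertia_arr = "('o, 'f) zfun \<times> ('o, 'f) zfun \<times> ('o, 'f) transf set"

definition inertia ::
  "('o, 'f, 'z) mon_gpd_scheme \<Rightarrow> (('o, 'f) zfun, ('o, 'f) inertia_arr) gpd" where
  "inertia C = \<lparr>
     Obj = monoidal_funs C,
     Arr = {(F, G, K). F \<in> monoidal_funs C \<and> G \<in> monoidal_funs C \<and>
                       K \<in> transfs C F G // transf_iso C F G},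
     src = (\<lambda>(F, G, K). F),
     tgt = (\<lambda>(F, G, K). G),
     iden = (\<lambda>F. (F, F, transf_iso C F F `` {transf_id C F})),
     cmp = (\<lambda>(G', H, L) (F, G, K).
              (F, H, transf_iso C F H `` {transf_comp C t s | s t. s \<in> K \<and> t \<in> L}))\<rparr>"

section \<open>Lattices, the torus and the categorical torus\<close>

text \<open>A lattice \<open>\<Lambda>\<close> together with \<open>\<tt> = \<Lambda> \<otimes> \<real>\<close> is given as the \<open>\<int>\<close>-span of a basis of a
  finite-dimensional real vector space \<open>'a\<close>. A bilinear form on \<open>\<Lambda>\<close> and its bilinear extension to
  \<open>\<tt>\<close> determine each other, so forms on \<open>\<Lambda>\<close> are given by their extensions.\<close>

definition full_lattice :: "'a::real_normed_vector set \<Rightarrow> bool" where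
  "full_lattice \<Lambda> \<longleftrightarrow> (\<exists>B. finite B \<and> independent B \<and> span B = UNIV \<and>
     \<Lambda> = {\<Sum>b\<in>B. of_int (c b) *\<^sub>R b | c :: 'a \<Rightarrow> int. True})"

definition integral_form :: "'a::real_normed_vector set \<Rightarrow> ('a \<Rightarrow> 'a \<Rightarrow> real) \<Rightarrow> bool" where
  "integral_form \<Lambda> J \<longleftrightarrow> bilinear J \<and> (\<forall>m\<in>\<Lambda>. \<forall>n\<in>\<Lambda>. J m n \<in> \<int>)"

definition even_symmetric_form :: "'a::real_normed_vector set \<Rightarrow> ('a \<Rightarrow> 'a \<Rightarrow> real) \<Rightarrow> bool" where
  "even_symmetric_form \<Lambda> I \<longleftrightarrow> integral_form \<Lambda> I \<and>
     (\<forall>m\<in>\<Lambda>. \<forall>n\<in>\<Lambda>. I m n = I n m) \<and> (\<forall>m\<in>\<Lambda>. \<exists>k::int. I m m = 2 * of_int k)"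

definition e2pi :: "real \<Rightarrow> complex" where
  "e2pi a = cis (2 * pi * a)"

definition circle_group :: "complex monoid" where
  "circle_group = \<lparr>carrier = {z. cmod z = 1}, monoid.mult = (*), one = 1\<rparr>"

definition additive_group :: "'a::ab_group_add set \<Rightarrow> 'a monoid" where
  "additive_group S = \<lparr>carrier = S, monoid.mult = (+), one = 0\<rparr>"

text \<open>The tensor product over \<open>\<int>\<close> of abelian groups: the free abelian group on pairs modulo the
  bilinearity relations.\<close>

definition tensor_rels ::
  "('a, 'y) monoid_scheme \<Rightarrow> ('b, 'z) monoid_scheme \<Rightarrow> ('a \<times> 'b \<Rightarrow>\<^sub>0 int) set" where
  "tensor_rels G H = generate (free_Abelian_group (carrier G \<times> carrier H))
     ({frag_of (g \<otimes>\<^bsub>G\<^esub> g', h) - frag_of (g, h) - frag_of (g', h) | g g' h.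
         g \<in> carrier G \<and> g' \<in> carrier G \<and> h \<in> carrier H} \<union>
      {frag_of (g, h \<otimes>\<^bsub>H\<^esub> h') - frag_of (g, h) - frag_of (g, h') | g h h'.
         g \<in> carrier G \<and> h \<in> carrier H \<and> h' \<in> carrier H})"

definition tensor_group ::
  "('a, 'y) monoid_scheme \<Rightarrow> ('b, 'z) monoid_scheme \<Rightarrow> ('a \<times> 'b \<Rightarrow>\<^sub>0 int) set monoid" where
  "tensor_group G H = free_Abelian_group (carrier G \<times> carrier H) Mod tensor_rels G H"

definition pure_tensor ::
  "('a, 'y) monoid_scheme \<Rightarrow> ('b, 'z) monoid_scheme \<Rightarrow> 'a \<Rightarrow> 'b \<Rightarrow> ('a \<times> 'b \<Rightarrow>\<^sub>0 int) set" where
  "pure_tensor G H g h =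
     tensor_rels G H #>\<^bsub>free_Abelian_group (carrier G \<times> carrier H)\<^esub> frag_of (g, h)"

type_synonym 'a torus_elt = "('a \<times> complex \<Rightarrow>\<^sub>0 int) set"

definition torus :: "'a::real_normed_vector set \<Rightarrow> 'a torus_elt monoid" where
  "torus \<Lambda> = tensor_group (additive_group \<Lambda>) circle_group"

text \<open>\<open>\<Lambda> \<otimes> e2pi\<close>, where \<open>m \<otimes> r \<in> \<Lambda> \<otimes> \<real>\<close> is the vector \<open>r *\<^sub>R m\<close>.\<close>

definition torus_exp :: "'a::real_normed_vector set \<Rightarrow> 'a \<Rightarrow> 'a torus_elt" where
  "torus_exp \<Lambda> = (THE f. f \<in> hom (additive_group UNIV) (torus \<Lambda>) \<and>
     (\<forall>r. \<forall>m\<in>\<Lambda>. f (r *\<^sub>R m) = pure_tensor (additive_group \<Lambda>) circle_group m (e2pi r)))"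

text \<open>The triple \<open>(x, m, w)\<close> is the arrow \<open>x \<rightarrow> x + m\<close> with label \<open>w \<in> U(1)\<close>.\<close>

definition categorical_torus ::
  "'a::real_normed_vector set \<Rightarrow> ('a \<Rightarrow> 'a \<Rightarrow> real) \<Rightarrow> ('a, 'a \<times> 'a \<times> complex) mon_gpd" where
  "categorical_torus \<Lambda> J = \<lparr>
     Obj = UNIV,
     Arr = UNIV \<times> \<Lambda> \<times> carrier circle_group,
     src = (\<lambda>(x, m, w). x),
     tgt = (\<lambda>(x, m, w). x + m),
     iden = (\<lambda>x. (x, 0, 1)),
     cmp = (\<lambda>(x', m', w') (x, m, w). (x, m + m', w * w')),
     tenO = (+),
     tenA = (\<lambda>(x, m, w) (y, n, z). (x + y, m + n, w * z * e2pi (J m y))),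
     unitO = 0\<rparr>"

section \<open>The inertia groupoid of the categorical torus as a Lie groupoid\<close>

type_synonym 'a ct_fun = "('a, 'a \<times> 'a \<times> complex) zfun"
type_synonym 'a ct_inertia_arr = "('a, 'a \<times> 'a \<times> complex) inertia_arr"

text \<open>The strict monoidal functor with value \<open>x\<close> at \<open>1\<close>; all strict monoidal functors are of this form.\<close>

definition strict_fun :: "'a::real_normed_vector \<Rightarrow> 'a ct_fun" where
  "strict_fun x = \<lparr>fob = (\<lambda>a. of_int a *\<^sub>R x),
                   fmult = (\<lambda>a b. (of_int (a + b) *\<^sub>R x, 0, 1)),
                   funit = (0, 0, 1)\<rparr>"

text \<open>A transformation between strict functors is determined by its object \<open>y\<close> and its component at \<open>1\<close>,
  which for \<open>strict_fun x \<Rightarrow> strict_fun (x - m)\<close> is an arrow from \<open>x - m + y\<close> to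
  \<open>y + x\<close>, hence given by its label. So before passing to 2-isomorphism classes the arrows form
  the manifold \<open>\<Lambda> \<times> \<tt> \<times> \<tt> \<times> U(1)\<close>; the following map sends \<open>(x, y, c)\<close> to the class of
  the transformation out of \<open>strict_fun x\<close> with object \<open>y\<close> and label \<open>e2pi c\<close>.\<close>

definition strict_arr ::
  "'a::real_normed_vector set \<Rightarrow> ('a \<Rightarrow> 'a \<Rightarrow> real) \<Rightarrow> 'a \<Rightarrow> 'a \<times> 'a \<times> real \<Rightarrow> 'a ct_inertia_arr" where
  "strict_arr \<Lambda> J m = (\<lambda>(x, y, c).
     let C = categorical_torus \<Lambda> J; F = strict_fun x; G = strict_fun (x - m)
     in (F, G, transf_iso C F G ``
           {s \<in> transfs C F G. fst s = y \<and> snd s 1 = (x - m + y, m, e2pi c)}))"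

text \<open>The full subgroupoid of the inertia groupoid on strict monoidal functors. Its objects are the
  manifold \<open>\<tt>\<close>, and its arrows are the quotient manifold of \<open>\<Lambda> \<times> \<tt> \<times> \<tt> \<times> U(1)\<close>.\<close>

definition strict_inertia ::
  "'a::real_normed_vector set \<Rightarrow> ('a \<Rightarrow> 'a \<Rightarrow> real) \<Rightarrow>
   ('a ct_fun, 'a ct_inertia_arr, 'a, 'a \<times> 'a \<times> real) lie_gpd" where
  "strict_inertia \<Lambda> J = (let C = categorical_torus \<Lambda> J; X = inertia C in \<lparr>
     Obj = strict_monoidal_funs C,
     Arr = {f \<in> Arr X. src X f \<in> strict_monoidal_funs C \<and> tgt X f \<in> strict_monoidal_funs C},
     src = src X, tgt = tgt X, iden = iden X, cmp = cmp X,
     atlas_Obj = local_inverse_atlas {strict_fun},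
     atlas_Arr = local_inverse_atlas (strict_arr \<Lambda> J ` \<Lambda>)\<rparr>)"

text \<open>The inertia groupoid is equivalent to a Lie groupoid \<open>H\<close>: there is a functor from it to \<open>H\<close> that
  is an equivalence of groupoids, and an equivalence of Lie groupoids on the full subgroupoid of
  strict monoidal functors, the model that carries the smooth structure.\<close>

definition inertia_equivalent_to ::
  "'a::real_normed_vector set \<Rightarrow> ('a \<Rightarrow> 'a \<Rightarrow> real) \<Rightarrow>
   ('p, 'g, 'e::real_normed_vector, 'd::real_normed_vector) lie_gpd \<Rightarrow> bool" where
  "inertia_equivalent_to \<Lambda> J H \<longleftrightarrow>
     (\<exists>F0 F1. groupoid_equivalence (inertia (categorical_torus \<Lambda> J)) H F0 F1 \<and>
              lie_equivalence (strict_inertia \<Lambda> J) H F0 F1)"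

section \<open>The two models\<close>

text \<open>In both cases the smooth structure on the arrows is that of the quotient manifold.\<close>

definition rel_i ::
  "'a::real_normed_vector set \<Rightarrow> ('a \<Rightarrow> 'a \<Rightarrow> real) \<Rightarrow>
   (('a torus_elt \<times> 'a \<times> complex) \<times> ('a torus_elt \<times> 'a \<times> complex)) set" where
  "rel_i \<Lambda> I = {((t, y + n, w), (t, y, w * e2pi (- I x n))) | t y n w x.
     n \<in> \<Lambda> \<and> w \<in> carrier circle_group \<and> torus_exp \<Lambda> x = t}"

definition groupoid_i ::
  "'a::real_normed_vector set \<Rightarrow> ('a \<Rightarrow> 'a \<Rightarrow> real) \<Rightarrow>
   ('a torus_elt, ('a torus_elt \<times> 'a \<times> complex) set, 'a, 'a \<times> 'a \<times> real) lie_gpd" where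
  "groupoid_i \<Lambda> I = \<lparr>
     Obj = carrier (torus \<Lambda>),
     Arr = (carrier (torus \<Lambda>) \<times> UNIV \<times> carrier circle_group) // rel_i \<Lambda> I,
     src = (\<lambda>K. the_elem ((\<lambda>(t, y, w). t) ` K)),
     tgt = (\<lambda>K. the_elem ((\<lambda>(t, y, w). t) ` K)),
     iden = (\<lambda>t. rel_i \<Lambda> I `` {(t, 0, 1)}),
     cmp = (\<lambda>K K'. rel_i \<Lambda> I ``
              {(t, y + y', w * w') | t y w y' w'. (t, y, w) \<in> K \<and> (t, y', w') \<in> K'}),
     atlas_Obj = local_inverse_atlas {torus_exp \<Lambda>},
     atlas_Arr = local_inverse_atlas {\<lambda>(x, y, c). rel_i \<Lambda> I `` {(torus_exp \<Lambda> x, y, e2pi c)}}\<rparr>"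

definition rel_ii ::
  "'a::real_normed_vector set \<Rightarrow> ('a \<Rightarrow> 'a \<Rightarrow> real) \<Rightarrow>
   (('a \<times> 'a torus_elt \<times> complex) \<times> ('a \<times> 'a torus_elt \<times> complex)) set" where
  "rel_ii \<Lambda> I = {((x + m, s, z), (x, s, z * e2pi (I m y))) | x m s z y.
     m \<in> \<Lambda> \<and> z \<in> carrier circle_group \<and> torus_exp \<Lambda> y = s}"

definition groupoid_ii ::
  "'a::real_normed_vector set \<Rightarrow> ('a \<Rightarrow> 'a \<Rightarrow> real) \<Rightarrow>
   ('a torus_elt, ('a \<times> 'a torus_elt \<times> complex) set, 'a, 'a \<times> 'a \<times> real) lie_gpd" where
  "groupoid_ii \<Lambda> I = \<lparr>
     Obj = carrier (torus \<Lambda>),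
     Arr = (UNIV \<times> carrier (torus \<Lambda>) \<times> carrier circle_group) // rel_ii \<Lambda> I,
     src = (\<lambda>K. the_elem ((\<lambda>(x, s, z). torus_exp \<Lambda> x) ` K)),
     tgt = (\<lambda>K. the_elem ((\<lambda>(x, s, z). torus_exp \<Lambda> x) ` K)),
     iden = (\<lambda>t. rel_ii \<Lambda> I `` {(x, \<one>\<^bsub>torus \<Lambda>\<^esub>, 1) | x. torus_exp \<Lambda> x = t}),
     cmp = (\<lambda>K K'. rel_ii \<Lambda> I ``
              {(x, s \<otimes>\<^bsub>torus \<Lambda>\<^esub> s', z * z') | x s z s' z'. (x, s, z) \<in> K \<and> (x, s', z') \<in> K'}),
     atlas_Obj = local_inverse_atlas {torus_exp \<Lambda>},
     atlas_Arr = local_inverse_atlas {\<lambda>(x, y, c). rel_ii \<Lambda> I `` {(x, torus_exp \<Lambda> y, e2pi c)}}\<rparr>"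

end

theory Submission
  imports Defs
begin

text \<open>Since \<open>H\<^sup>2(\<int>, U(1)) = 0\<close>, a transformation \<open>F \<Rightarrow> G\<close> of monoidal functors from \<open>\<int>\<close> to the
  categorical torus can be prescribed freely by its object \<open>y\<close> and its label \<open>w\<close> at \<open>1\<close>; one exists iff
  \<open>F 1 - G 1 \<in> \<Lambda>\<close>. The modifications identify
  \<open>(y, w)\<close> with \<open>(y + n, w e\<^bsup>2\<pi>iJ(n, F 1)\<^esup>)\<close>, and composing \<open>(y, w)\<close> with \<open>(y', w'): G \<Rightarrow> H\<close> gives
  \<open>(y' + y, w w' e\<^bsup>2\<pi>iJ(G 1 - H 1, y)\<^esup>)\<close>. The corrected label \<open>w e\<^bsup>2\<pi>iJ(G 1, y)\<^esup>\<close> is multiplicative, and because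
  \<open>J(n, x) + J(x, n) = I(x, n)\<close> it obeys the relation of model (i), with \<open>t = exp (F 1)\<close>. A further factor
  \<open>e\<^bsup>-2\<pi>iI(F 1, y)\<^esup>\<close> leads to model (ii).

  All manifolds involved are quotients of vector spaces by properly discontinuous group actions, and
  all structure maps lift to polynomial maps between these vector spaces.\<close>

section \<open>Finite-dimensional normed spaces\<close>

text \<open>Let x, z, u be the values at 1 of F, G, H. The correction \<open>J z y\<close> is
  attached to the target of an arrow because it then telescopes: J(z - u, y) + J(u, y' + y) = J(z,
  y) + J(u, y'). A modification by n changes the label by J(n, x) and the correction by J(z, n), and
  J(z, n) differs from J(x, n) by the integer J(x - z, n). Most label identities have this shape:
  they hold modulo the pairing of two lattice vectors, which has to be isolated each time.

  The labels of a monoidal functor satisfy only a cocycle rule twisted by J. For two functors with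
  an arrow between them, the quotient of the labels, multiplied by the pairings that come from
  whiskering, is an honest cocycle. So transformations can be analysed without making the functors
  strict, and one functor to the model is defined on the whole inertia groupoid and then restricted
  to the part that carries the smooth structure.

  The torus is a genuine tensor product, so the kernel and range of exp have to be computed from
  generators and relations before any chart is available.\<close>

lemma not_in_closure_span:
  fixes B :: "'a::real_normed_vector set"
  assumes fin: "finite B" and C: "C > 0"
    and bound: "\<And>c. C * (\<Sum>b\<in>B. \<bar>c b\<bar>) \<le> norm (\<Sum>b\<in>B. c b *\<^sub>R b)"
    and x: "x \<notin> span B"
  shows "x \<notin> closure (span B)"
proof
  assume "x \<in> closure (span B)"
  then obtain v where v: "\<And>k. v k \<in> span B" and lim: "v \<longlonglongrightarrow> x"
    by (auto simp: closure_sequential)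
  have "\<exists>c. v k = (\<Sum>b\<in>B. c b *\<^sub>R b)" for k
    using v[of k] fin by (auto simp: span_finite)
  then obtain c where c: "\<And>k. v k = (\<Sum>b\<in>B. c k b *\<^sub>R b)" by metis
  \<comment> \<open>Applied to differences of coefficients, the bound turns convergence in norm into
    the Cauchy property of every coordinate; the limits of the coordinates then express
    \<open>x\<close> in the span.\<close>
  have coord: "C * \<bar>c k b - c l b\<bar> \<le> norm (v k - v l)" if "b \<in> B" for b k l
  proof -
    have "C * \<bar>c k b - c l b\<bar> \<le> C * (\<Sum>b\<in>B. \<bar>c k b - c l b\<bar>)"
      using that fin C by (intro mult_left_mono member_le_sum) auto
    also have "\<dots> \<le> norm (\<Sum>b\<in>B. (c k b - c l b) *\<^sub>R b)" by (rule bound)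
    also have "(\<Sum>b\<in>B. (c k b - c l b) *\<^sub>R b) = v k - v l"
      by (simp add: c scaleR_left_diff_distrib sum_subtractf)
    finally show ?thesis .
  qed
  have "convergent (\<lambda>k. c k b)" if "b \<in> B" for b
  proof -
    have "Cauchy (\<lambda>k. c k b)"
    proof (rule CauchyI)
      fix e :: real assume "e > 0"
      then obtain M where M: "\<And>k l. k \<ge> M \<Longrightarrow> l \<ge> M \<Longrightarrow> norm (v k - v l) < C * e"
        using CauchyD[OF LIMSEQ_imp_Cauchy[OF lim], of "C * e"] C by auto
      have "norm (c k b - c l b) < e" if "k \<ge> M" "l \<ge> M" for k l
        using le_less_trans[OF coord[OF \<open>b \<in> B\<close>] M[OF that]] C by simp
      then show "\<exists>M. \<forall>m\<ge>M. \<forall>n\<ge>M. norm (c m b - c n b) < e" by blast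
    qed
    then show ?thesis by (simp add: Cauchy_convergent)
  qed
  then have "v \<longlonglongrightarrow> (\<Sum>b\<in>B. lim (\<lambda>k. c k b) *\<^sub>R b)"
    unfolding c by (intro tendsto_sum tendsto_scaleR tendsto_const) (auto simp: convergent_LIMSEQ_iff)
  then have "x = (\<Sum>b\<in>B. lim (\<lambda>k. c k b) *\<^sub>R b)"
    using LIMSEQ_unique lim by blast
  with x show False by (auto intro: span_sum span_scale span_base)
qed

text \<open>Equivalence of the norm with the sum of absolute coordinates. By the induction
  hypothesis the span of the smaller set is closed, so the new vector \<open>b\<close> has a
  positive distance \<open>e\<close> from it. This controls the coefficient of \<open>b\<close>, and
  subtracting that term controls the others.\<close>

lemma independent_coord_bound:
  fixes B :: "'a::real_normed_vector set"
  assumes "finite B" "independent B"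
  shows "\<exists>C>0. \<forall>c. C * (\<Sum>b\<in>B. \<bar>c b\<bar>) \<le> norm (\<Sum>b\<in>B. c b *\<^sub>R b)"
  using assms
proof (induction B rule: finite_induct)
  case empty
  show ?case by (auto intro: exI[of _ 1])
next
  case (insert b B)
  then have ind: "independent B" and b: "b \<notin> span B"
    by (auto simp: independent_insert)
  obtain C where C: "C > 0" and bound: "\<And>c. C * (\<Sum>b\<in>B. \<bar>c b\<bar>) \<le> norm (\<Sum>b\<in>B. c b *\<^sub>R b)"
    using insert.IH[OF ind] by blast
  obtain e where e: "e > 0" and dist: "\<And>y. y \<in> span B \<Longrightarrow> e \<le> dist y b"
    using not_in_closure_span[OF insert.hyps(1) C bound b] unfolding closure_approachable
    by (meson linorder_not_le)
  \<comment> \<open>The summand \<open>1 / e\<close> pays for the coefficient of \<open>b\<close>,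
    the summand \<open>(1 + norm b / e) / C\<close> for the remaining ones after the term at
    \<open>b\<close> has been moved to the other side.\<close>
  define K where "K = 1 / e + (1 + norm b / e) / C"
  have K: "K > 0" unfolding K_def using e C by (intro add_pos_pos) (auto intro!: divide_pos_pos add_pos_nonneg)
  have "(\<Sum>b\<in>insert b B. \<bar>c b\<bar>) \<le> K * norm (\<Sum>b\<in>insert b B. c b *\<^sub>R b)" for c
  proof -
    define v where "v = (\<Sum>b\<in>B. c b *\<^sub>R b)"
    define x where "x = c b *\<^sub>R b + v"
    have v: "v \<in> span B" by (auto simp: v_def intro: span_sum span_scale span_base)
    have 1: "\<bar>c b\<bar> * e \<le> norm x"
    proof (cases "c b = 0")
      case False
      have "e \<le> dist (- (1 / c b) *\<^sub>R v) b" using v by (intro dist span_scale)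
      also have "\<dots> = norm ((1 / c b) *\<^sub>R x)"
        using False by (simp add: dist_norm x_def scaleR_right_distrib norm_minus_commute add.commute)
      also have "\<dots> = norm x / \<bar>c b\<bar>" by simp
      finally show ?thesis using False by (simp add: field_simps)
    qed simp
    then have cb: "\<bar>c b\<bar> \<le> norm x / e" using e by (simp add: field_simps)
    have "norm v \<le> norm x + norm (c b *\<^sub>R b)"
      using norm_triangle_ineq4[of x "c b *\<^sub>R b"] by (simp add: x_def)
    also have "\<dots> \<le> norm x + norm x / e * norm b"
      using mult_right_mono[OF cb norm_ge_zero[of b]] by simp
    finally have "C * (\<Sum>b\<in>B. \<bar>c b\<bar>) \<le> norm x * (1 + norm b / e)"
      using bound[of c] by (simp add: v_def field_simps)
    then have "(\<Sum>b\<in>B. \<bar>c b\<bar>) \<le> norm x * (1 + norm b / e) / C"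
      using C by (simp add: pos_le_divide_eq mult.commute)
    then have "\<bar>c b\<bar> + (\<Sum>b\<in>B. \<bar>c b\<bar>) \<le> K * norm x"
      using cb by (simp add: K_def distrib_left distrib_right field_simps)
    then show ?thesis using insert.hyps by (simp add: x_def v_def)
  qed
  then have "1 / K * (\<Sum>b\<in>insert b B. \<bar>c b\<bar>) \<le> norm (\<Sum>b\<in>insert b B. c b *\<^sub>R b)" for c
    using K by (simp add: pos_divide_le_eq mult.commute)
  then show ?case using K by (intro exI[of _ "1 / K"]) auto
qed

text \<open>Finite dimension enters through a fixed basis instead of a type class, so that dimension
  0 is covered. The same basis later gives coordinates on the lattice.\<close>

locale finite_dim_basis =
  fixes B :: "'a::real_normed_vector set"
  assumes finite_B: "finite B" and independent_B: "independent B" and span_B: "span B = UNIV"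
begin

abbreviation "coord \<equiv> representation B"

lemma basis_expansion: "x = (\<Sum>b\<in>B. coord x b *\<^sub>R b)"
  using sum_representation_eq[OF independent_B, of x B] finite_B span_B by auto

lemma representation_basis_sum:
  assumes "b \<in> B"
  shows "coord (\<Sum>b\<in>B. c b *\<^sub>R b) b = c b"
proof -
  have "coord (\<Sum>b\<in>B. c b *\<^sub>R b) b = (\<Sum>b'\<in>B. c b' * coord b' b)"
    using independent_B span_B by (simp add: representation_sum representation_scale)
  also have "\<dots> = (\<Sum>b'\<in>B. if b' = b then c b' else 0)"
    by (intro sum.cong refl) (simp add: representation_basis[OF independent_B])
  finally show ?thesis using assms finite_B by simp
qed

lemma bounded_linear_of_linear:
  fixes f :: "'a \<Rightarrow> 'c::real_normed_vector"
  assumes f: "linear f"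
  shows "bounded_linear f"
proof -
  obtain C where C: "C > 0" and bound: "\<And>c. C * (\<Sum>b\<in>B. \<bar>c b\<bar>) \<le> norm (\<Sum>b\<in>B. c b *\<^sub>R b)"
    using independent_coord_bound[OF finite_B independent_B] by blast
  have "norm (f x) \<le> norm x * ((\<Sum>b\<in>B. norm (f b)) / C)" for x
  proof -
    let ?c = "coord x"
    have "f x = (\<Sum>b\<in>B. ?c b *\<^sub>R f b)"
      by (subst basis_expansion) (simp add: linear_sum[OF f] linear_scale[OF f])
    then have "norm (f x) \<le> (\<Sum>b\<in>B. \<bar>?c b\<bar> * norm (f b))"
      by (metis (mono_tags, lifting) norm_scaleR norm_sum sum.cong)
    also have "\<dots> \<le> (\<Sum>b\<in>B. \<bar>?c b\<bar> * (\<Sum>b\<in>B. norm (f b)))"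
      using finite_B by (intro sum_mono mult_left_mono member_le_sum) auto
    also have "\<dots> = (\<Sum>b\<in>B. \<bar>?c b\<bar>) * (\<Sum>b\<in>B. norm (f b))" by (simp add: sum_distrib_right)
    also have "\<dots> \<le> norm x / C * (\<Sum>b\<in>B. norm (f b))"
      using bound[of ?c] C basis_expansion[of x]
      by (intro mult_right_mono sum_nonneg) (auto simp: field_simps)
    finally show ?thesis by simp
  qed
  with f show ?thesis
    by (intro bounded_linear_intro) (assumption | simp add: linear_add linear_scale)+
qed

text \<open>Only the first argument is expanded. Each linear map \<open>f b\<close> is already
  bounded, and finitely many of these bounds are added up.\<close>

lemma bounded_bilinear_of_bilinear:
  fixes f :: "'a \<Rightarrow> 'a \<Rightarrow> 'c::real_normed_vector"
  assumes f: "bilinear f"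
  shows "bounded_bilinear f"
proof -
  obtain C where C: "C > 0" and bound: "\<And>c. C * (\<Sum>b\<in>B. \<bar>c b\<bar>) \<le> norm (\<Sum>b\<in>B. c b *\<^sub>R b)"
    using independent_coord_bound[OF finite_B independent_B] by blast
  have "bounded_linear (f b)" for b
    using f by (intro bounded_linear_of_linear) (simp add: bilinear_def)
  then have "\<exists>K\<ge>0. \<forall>y. norm (f b y) \<le> norm y * K" for b
    using bounded_linear.nonneg_bounded by blast
  then obtain K where K: "\<And>b. K b \<ge> 0" "\<And>b y. norm (f b y) \<le> norm y * K b" by metis
  have "norm (f x y) \<le> norm x * norm y * ((\<Sum>b\<in>B. K b) / C)" for x y
  proof -
    let ?c = "coord x"
    have lin: "linear (\<lambda>x. f x y)" using f by (simp add: bilinear_def)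
    have "f x y = (\<Sum>b\<in>B. ?c b *\<^sub>R f b y)"
      by (subst basis_expansion[of x]) (simp add: linear_sum[OF lin] linear_scale[OF lin])
    then have "norm (f x y) \<le> (\<Sum>b\<in>B. \<bar>?c b\<bar> * norm (f b y))"
      by (metis (mono_tags, lifting) norm_scaleR norm_sum sum.cong)
    also have "\<dots> \<le> (\<Sum>b\<in>B. \<bar>?c b\<bar> * (norm y * (\<Sum>b\<in>B. K b)))"
    proof (intro sum_mono mult_left_mono)
      fix b assume "b \<in> B"
      then have "K b \<le> (\<Sum>b\<in>B. K b)" using finite_B K by (intro member_le_sum) auto
      then show "norm (f b y) \<le> norm y * (\<Sum>b\<in>B. K b)"
        using K(2)[where b=b and y=y] by (meson dual_order.trans mult_left_mono norm_ge_zero)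
    qed auto
    also have "\<dots> = (\<Sum>b\<in>B. \<bar>?c b\<bar>) * (norm y * (\<Sum>b\<in>B. K b))" by (simp add: sum_distrib_right)
    also have "\<dots> \<le> norm x / C * (norm y * (\<Sum>b\<in>B. K b))"
      using bound[of ?c] C K(1) basis_expansion[of x]
      by (intro mult_right_mono mult_nonneg_nonneg sum_nonneg) (auto simp: field_simps)
    finally show ?thesis by simp
  qed
  then have "\<exists>K. \<forall>x y. norm (f x y) \<le> norm x * norm y * K" by blast
  with f show ?thesis
    by unfold_locales (simp_all add: bilinear_ladd bilinear_radd bilinear_lmul bilinear_rmul)
qed

lemma bounded_linear_representation: "bounded_linear (\<lambda>x. coord x b)"
  using independent_B span_B
  by (intro bounded_linear_of_linear linearI) (auto simp: representation_add representation_scale)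

text \<open>The countable basis consists of balls of rational radius around rational combinations of
  basis vectors; density of these centres is the point to prove.\<close>

lemma countable_topological_basis: "\<exists>D :: 'a set set. countable D \<and> topological_basis D"
proof -
  define Q where "Q = (\<lambda>c. \<Sum>b\<in>B. c b *\<^sub>R b) ` (B \<rightarrow>\<^sub>E \<rat>)"
  define D where "D = (\<lambda>(x, r). ball x r) ` (Q \<times> \<rat>)"
  have "countable D"
    unfolding D_def Q_def using finite_B by (intro countable_image countable_SIGMA countable_PiE countable_rat) auto
  have dense: "\<exists>y\<in>Q. dist x y < e" if "e > 0" for x e
  proof -
    \<comment> \<open>The summand 1 keeps \<open>S\<close> positive when the basis is empty and
      makes the final estimate \<open>e / S * (S - 1) < e\<close> strict.\<close>
    define S where "S = (\<Sum>b\<in>B. norm b) + 1"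
    have S: "S > 0" unfolding S_def by (intro add_nonneg_pos sum_nonneg) auto
    have "\<exists>r\<in>\<rat>. \<bar>coord x b - r\<bar> < e / S" for b
    proof -
      have "coord x b - e / S < coord x b" using S that by simp
      then obtain r where "r \<in> \<rat>" "coord x b - e / S < r" "r < coord x b"
        using Rats_dense_in_real by blast
      then show ?thesis by (intro bexI[of _ r]) auto
    qed
    then obtain r where r: "\<And>b. r b \<in> \<rat>" "\<And>b. \<bar>coord x b - r b\<bar> < e / S" by metis
    define y where "y = (\<Sum>b\<in>B. restrict r B b *\<^sub>R b)"
    have "x - y = (\<Sum>b\<in>B. (coord x b - r b) *\<^sub>R b)"
      by (subst basis_expansion[of x]) (simp add: y_def scaleR_left_diff_distrib sum_subtractf)
    then have "norm (x - y) \<le> (\<Sum>b\<in>B. \<bar>coord x b - r b\<bar> * norm b)"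
      by (metis (mono_tags, lifting) norm_scaleR norm_sum sum.cong)
    also have "\<dots> \<le> (\<Sum>b\<in>B. e / S * norm b)"
      using r(2) by (intro sum_mono mult_right_mono) (auto intro: less_imp_le)
    also have "\<dots> = e / S * (S - 1)" by (simp add: S_def sum_distrib_left)
    also have "\<dots> < e" using S that by (simp add: field_simps)
    finally have "dist x y < e" by (simp add: dist_norm)
    moreover have "y \<in> Q" unfolding Q_def y_def using r(1) by (intro imageI) auto
    ultimately show ?thesis by blast
  qed
  have "topological_basis D"
  proof (rule topological_basisI)
    show "open B'" if "B' \<in> D" for B' using that by (auto simp: D_def)
  next
    fix O' :: "'a set" and x assume "open O'" "x \<in> O'"
    then obtain e where e: "e > 0" "ball x e \<subseteq> O'" by (auto simp: open_contains_ball)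
    obtain r where r: "r \<in> \<rat>" "0 < r" "r < e / 2" using Rats_dense_in_real[of 0 "e / 2"] e by auto
    obtain y where y: "y \<in> Q" "dist x y < r" using dense[OF r(2)] by blast
    have "ball y r \<subseteq> ball x e"
    proof
      fix z assume "z \<in> ball y r"
      then show "z \<in> ball x e" using y(2) r(3) dist_triangle[of x z y] by simp
    qed
    then show "\<exists>B'\<in>D. x \<in> B' \<and> B' \<subseteq> O'"
      using y r(1) e by (intro bexI[of _ "ball y r"]) (auto simp: D_def dist_commute)
  qed
  with \<open>countable D\<close> show ?thesis by blast
qed

end

section \<open>Smooth maps between normed spaces\<close>

text \<open>The recursion states continuity only at its last level, so the lower orders are
  recovered from differentiability.\<close>

lemma Ck_on_Suc_imp: "Ck_on (Suc k) S f \<Longrightarrow> Ck_on k S f"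
proof (induction k arbitrary: f)
  case 0
  then have "isCont f x" if "x \<in> S" for x
    using that differentiable_imp_continuous_within by auto
  then show ?case by (simp add: continuous_at_imp_continuous_on)
next
  case (Suc k)
  from Suc.prems have "\<forall>x\<in>S. f differentiable at x"
    and "Ck_on (Suc k) S (\<lambda>x. frechet_derivative f (at x) v)" for v
    unfolding Ck_on.simps(2)[of "Suc k"] by blast+
  with Suc.IH show ?case unfolding Ck_on.simps(2)[of k] by blast
qed

lemma Ck_on_subset: "Ck_on k S f \<Longrightarrow> T \<subseteq> S \<Longrightarrow> Ck_on k T f"
  by (induction k arbitrary: f) (auto intro: continuous_on_subset)

lemma smooth_on_subset: "smooth_on S f \<Longrightarrow> T \<subseteq> S \<Longrightarrow> smooth_on T f"
  by (auto simp: smooth_on_def intro: Ck_on_subset)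

lemma smooth_on_imp_continuous_on: "smooth_on S f \<Longrightarrow> continuous_on S f"
  unfolding smooth_on_def by (metis Ck_on.simps(1))

text \<open>Needed for transition maps, which coincide with a deck transformation only near each
  point, and with a different one from point to point. On the open set \<open>N \<inter> S\<close>
  the two functions agree near every point, hence so do their derivatives, and the induction applies
  to these.\<close>

lemma Ck_on_local_cong:
  assumes "open S"
    and "\<And>x. x \<in> S \<Longrightarrow> \<exists>N g. open N \<and> x \<in> N \<and> Ck_on k N g \<and> (\<forall>y\<in>N \<inter> S. f y = g y)"
  shows "Ck_on k S f"
  using assms(2)
proof (induction k arbitrary: f)
  case 0
  have "isCont f x" if x: "x \<in> S" for x
  proof -
    obtain N g where N: "open N" "x \<in> N" "continuous_on N g" "\<forall>y\<in>N \<inter> S. f y = g y"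
      using 0[OF x] by auto
    then have "isCont g x" using continuous_on_eq_continuous_at by blast
    moreover have "\<forall>\<^sub>F y in nhds x. f y = g y"
      using N x assms(1) unfolding eventually_nhds by (intro exI[of _ "N \<inter> S"]) auto
    ultimately show ?thesis by (simp add: isCont_cong)
  qed
  then show ?case by (auto intro: continuous_at_imp_continuous_on)
next
  case (Suc k)
  have local: "\<exists>N g. open N \<and> N \<subseteq> S \<and> x \<in> N \<and> Ck_on (Suc k) N g \<and>
      (\<forall>y\<in>N. (f has_derivative frechet_derivative g (at y)) (at y))" if x: "x \<in> S" for x
  proof -
    obtain N g where N: "open N" "x \<in> N" "Ck_on (Suc k) N g" "\<forall>y\<in>N \<inter> S. f y = g y"
      using Suc.prems[OF x] by blast
    have "(f has_derivative frechet_derivative g (at y)) (at y)" if "y \<in> N \<inter> S" for y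
    proof -
      have "(g has_derivative frechet_derivative g (at y)) (at y)"
        using N(3) that by (simp add: frechet_derivative_works[symmetric])
      then show ?thesis
        by (rule has_derivative_transform_within_open[OF _ open_Int[OF N(1) assms(1)] that]) (use N(4) in auto)
    qed
    moreover have "Ck_on (Suc k) (N \<inter> S) g" using N(3) Ck_on_subset[of _ N _ "N \<inter> S"] by blast
    ultimately show ?thesis
      using N(1,2) x assms(1) by (intro exI[of _ "N \<inter> S"] exI[of _ g]) (simp add: open_Int)
  qed
  show ?case unfolding Ck_on.simps
  proof (intro conjI ballI allI)
    fix x assume "x \<in> S"
    with local show "f differentiable at x" unfolding differentiable_def by blast
  next
    fix v
    show "Ck_on k S (\<lambda>x. frechet_derivative f (at x) v)"
    proof (rule Suc.IH)
      fix x assume x: "x \<in> S"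
      obtain N g where N: "open N" "N \<subseteq> S" "x \<in> N" "Ck_on (Suc k) N g"
        "\<And>y. y \<in> N \<Longrightarrow> (f has_derivative frechet_derivative g (at y)) (at y)"
        using local[OF x] by (elim exE conjE) (rule that, auto simp del: Ck_on.simps)
      have "frechet_derivative f (at y) v = frechet_derivative g (at y) v" if "y \<in> N" for y
        using frechet_derivative_at[OF N(5)[OF that]] by simp
      moreover have "Ck_on k N (\<lambda>y. frechet_derivative g (at y) v)" using N(4) by simp
      ultimately show "\<exists>N g. open N \<and> x \<in> N \<and> Ck_on k N g \<and> (\<forall>y\<in>N \<inter> S. frechet_derivative f (at y) v = g y)"
        using N(1,3) by blast
    qed
  qed
qed

lemma smooth_on_local_cong:
  assumes "open S"
    and "\<And>x. x \<in> S \<Longrightarrow> \<exists>N g. open N \<and> x \<in> N \<and> smooth_on N g \<and> (\<forall>y\<in>N \<inter> S. f y = g y)"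
  shows "smooth_on S f"
  unfolding smooth_on_def
proof
  fix k
  show "Ck_on k S f"
  proof (rule Ck_on_local_cong[OF assms(1)])
    fix x assume "x \<in> S"
    from assms(2)[OF this] show "\<exists>N g. open N \<and> x \<in> N \<and> Ck_on k N g \<and> (\<forall>y\<in>N \<inter> S. f y = g y)"
      by (auto simp: smooth_on_def)
  qed
qed

lemma Ck_on_const: "Ck_on k UNIV (\<lambda>x. c)"
  by (induction k arbitrary: c) (auto simp: frechet_derivative_const)

lemma smooth_const: "smooth_on UNIV (\<lambda>x. c)"
  by (simp add: smooth_on_def Ck_on_const)

text \<open>Replaces the derivative selected by \<open>frechet_derivative\<close> by one given
  explicitly; the two agree by uniqueness of the derivative.\<close>

lemma Ck_on_SucI:
  assumes "\<And>x. (f has_derivative f' x) (at x)" and "\<And>v. Ck_on k UNIV (\<lambda>x. f' x v)"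
  shows "Ck_on (Suc k) UNIV f"
proof -
  have "frechet_derivative f (at x) = f' x" for x
    using frechet_derivative_at[OF assms(1)[of x]] by simp
  with assms show ?thesis by (auto simp: differentiable_def)
qed

lemma smooth_bounded_linear:
  assumes "bounded_linear f"
  shows "smooth_on UNIV f"
proof -
  have "Ck_on k UNIV f" for k
  proof (cases k)
    case 0
    show ?thesis unfolding 0 Ck_on.simps by (rule linear_continuous_on[OF assms])
  next
    case (Suc j)
    show ?thesis unfolding Suc
      by (rule Ck_on_SucI[where f' = "\<lambda>_. f"])
        (rule bounded_linear_imp_has_derivative[OF assms] Ck_on_const)+
  qed
  then show ?thesis by (simp add: smooth_on_def)
qed

lemma Ck_on_bounded_linear_compose:
  assumes L: "bounded_linear L"
  shows "Ck_on k UNIV f \<Longrightarrow> Ck_on k UNIV (\<lambda>x. L (f x))"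
proof (induction k arbitrary: f)
  case 0
  then show ?case using L bounded_linear.continuous_on by auto
next
  case (Suc k)
  have "(f has_derivative frechet_derivative f (at x)) (at x)" for x
    using Suc.prems by (simp_all add: frechet_derivative_works[symmetric])
  then have "((\<lambda>x. L (f x)) has_derivative (\<lambda>v. L (frechet_derivative f (at x) v))) (at x)" for x
    by (rule bounded_linear.has_derivative[OF L])
  then show ?case
    by (rule Ck_on_SucI) (use Suc in simp)
qed

lemma smooth_bounded_linear_compose:
  "bounded_linear L \<Longrightarrow> smooth_on UNIV f \<Longrightarrow> smooth_on UNIV (\<lambda>x. L (f x))"
  by (simp add: smooth_on_def Ck_on_bounded_linear_compose)

lemma Ck_on_add:
  "Ck_on k UNIV f \<Longrightarrow> Ck_on k UNIV g \<Longrightarrow> Ck_on k UNIV (\<lambda>x. f x + g x)"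
proof (induction k arbitrary: f g)
  case 0
  then show ?case by (simp add: continuous_on_add)
next
  case (Suc k)
  have "(f has_derivative frechet_derivative f (at x)) (at x)"
    "(g has_derivative frechet_derivative g (at x)) (at x)" for x
    using Suc.prems by (simp_all add: frechet_derivative_works[symmetric])
  then have "((\<lambda>x. f x + g x) has_derivative
      (\<lambda>v. frechet_derivative f (at x) v + frechet_derivative g (at x) v)) (at x)" for x
    by (rule has_derivative_add)
  then show ?case
    by (rule Ck_on_SucI) (use Suc in simp)
qed

lemma smooth_add:
  "smooth_on UNIV f \<Longrightarrow> smooth_on UNIV g \<Longrightarrow> smooth_on UNIV (\<lambda>x. f x + g x)"
  by (simp add: smooth_on_def Ck_on_add)

lemma smooth_minus: "smooth_on UNIV f \<Longrightarrow> smooth_on UNIV (\<lambda>x. - f x)"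
  by (rule smooth_bounded_linear_compose[OF bounded_linear_minus[OF bounded_linear_ident]])

lemma smooth_diff:
  "smooth_on UNIV f \<Longrightarrow> smooth_on UNIV g \<Longrightarrow> smooth_on UNIV (\<lambda>x. f x - g x)"
  using smooth_add[OF _ smooth_minus, of f g] by simp

lemma smooth_Pair:
  assumes "smooth_on UNIV f" "smooth_on UNIV g"
  shows "smooth_on UNIV (\<lambda>x. (f x, g x))"
proof -
  have "smooth_on UNIV (\<lambda>x. (f x, 0) + (0, g x))"
    using assms
    by (intro smooth_add smooth_bounded_linear_compose[where f = f and L = "\<lambda>x. (x, 0)"]
        smooth_bounded_linear_compose[where f = g and L = "\<lambda>x. (0, x)"]
        bounded_linear_Pair bounded_linear_ident bounded_linear_zero)
  then show ?thesis by simp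
qed

text \<open>Leibniz rule: both summands of the derivative are again products under \<open>P\<close>,
  with one factor differentiated and the other merely demoted from order \<open>Suc k\<close> to
  \<open>k\<close>. Together with linear maps this yields all the polynomial lifts.\<close>

lemma Ck_on_bounded_bilinear:
  assumes "bounded_bilinear P"
  shows "Ck_on k UNIV f \<Longrightarrow> Ck_on k UNIV g \<Longrightarrow> Ck_on k UNIV (\<lambda>x. P (f x) (g x))"
proof (induction k arbitrary: f g)
  case 0
  then show ?case by (auto intro: bounded_bilinear.continuous_on[OF assms])
next
  case (Suc k)
  have "(f has_derivative frechet_derivative f (at x)) (at x)"
    "(g has_derivative frechet_derivative g (at x)) (at x)" for x
    using Suc.prems by (simp_all add: frechet_derivative_works[symmetric])
  then have der: "((\<lambda>x. P (f x) (g x)) has_derivative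
      (\<lambda>v. P (f x) (frechet_derivative g (at x) v) + P (frechet_derivative f (at x) v) (g x))) (at x)" for x
    by (rule bounded_bilinear.FDERIV[OF assms])
  have "Ck_on k UNIV f" "Ck_on k UNIV g" using Suc.prems by (blast intro: Ck_on_Suc_imp)+
  with Suc have "Ck_on k UNIV (\<lambda>x. P (f x) (frechet_derivative g (at x) v) + P (frechet_derivative f (at x) v) (g x))" for v
    by (intro Ck_on_add Suc.IH) auto
  with der show ?case by (rule Ck_on_SucI)
qed

lemma smooth_bounded_bilinear:
  "bounded_bilinear P \<Longrightarrow> smooth_on UNIV f \<Longrightarrow> smooth_on UNIV g \<Longrightarrow> smooth_on UNIV (\<lambda>x. P (f x) (g x))"
  by (simp add: smooth_on_def Ck_on_bounded_bilinear)

lemma smooth_ident: "smooth_on UNIV (\<lambda>x. x)"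
  by (rule smooth_bounded_linear[OF bounded_linear_ident])

lemma smooth_fst: "smooth_on UNIV f \<Longrightarrow> smooth_on UNIV (\<lambda>x. fst (f x))"
  by (rule smooth_bounded_linear_compose[OF bounded_linear_fst])

lemma smooth_snd: "smooth_on UNIV f \<Longrightarrow> smooth_on UNIV (\<lambda>x. snd (f x))"
  by (rule smooth_bounded_linear_compose[OF bounded_linear_snd])

lemma smooth_scaleR_const: "smooth_on UNIV f \<Longrightarrow> smooth_on UNIV (\<lambda>x. f x *\<^sub>R v)"
  by (rule smooth_bounded_linear_compose[OF bounded_linear_scaleR_left])

lemmas smooth_intros =
  smooth_const smooth_ident smooth_add smooth_diff smooth_minus smooth_Pair smooth_fst smooth_snd
  smooth_scaleR_const

section \<open>Manifolds presented by local diffeomorphisms\<close>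

text \<open>Through every point of a model space passes a chart of \<open>A\<close> that inverts
  \<open>q\<close> near it. Mere existence is asked for, which suffices because smoothness of a map
  is a statement about some pair of charts at each point.\<close>

definition presents :: "('m, 'e::real_normed_vector) atlas \<Rightarrow> ('e \<Rightarrow> 'm) set \<Rightarrow> bool" where
  "presents A Q \<longleftrightarrow>
     (\<forall>q\<in>Q. \<forall>e. \<exists>(U, \<phi>)\<in>A. \<exists>V. open V \<and> e \<in> V \<and> U = q ` V \<and> (\<forall>v\<in>V. \<phi> (q v) = v))"

text \<open>The quotient map of a properly discontinuous action, with the group left implicit: the
  maps \<open>\<gamma>\<close> play the role of deck transformations. The clauses provide, in turn,
  charts, smooth transition maps, and separation of points.\<close>

definition smooth_quotient :: "('e::real_normed_vector \<Rightarrow> 'm) \<Rightarrow> bool" where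
  "smooth_quotient q \<longleftrightarrow>
     (\<forall>e. \<exists>V. open V \<and> e \<in> V \<and> inj_on q V) \<and>
     (\<forall>e e'. q e = q e' \<longrightarrow> (\<exists>\<gamma>. smooth_on UNIV \<gamma> \<and> \<gamma> e = e' \<and> (\<forall>x. q (\<gamma> x) = q x))) \<and>
     (\<forall>e e'. q e \<noteq> q e' \<longrightarrow> (\<exists>N N'. open N \<and> open N' \<and> e \<in> N \<and> e' \<in> N' \<and> q ` N \<inter> q ` N' = {}))"

lemma presentsD:
  assumes "presents A Q" "q \<in> Q"
  obtains U \<phi> V where "(U, \<phi>) \<in> A" "open V" "e \<in> V" "U = q ` V" "\<And>v. v \<in> V \<Longrightarrow> \<phi> (q v) = v"
proof -
  have "\<exists>(U, \<phi>)\<in>A. \<exists>V. open V \<and> e \<in> V \<and> U = q ` V \<and> (\<forall>v\<in>V. \<phi> (q v) = v)"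
    using assms unfolding presents_def by simp
  then show ?thesis using that by (elim bexE) (simp add: case_prod_unfold, metis prod.collapse)
qed

lemma presents_local_inverse_atlas:
  assumes "\<And>q. q \<in> Q \<Longrightarrow> smooth_quotient q"
  shows "presents (local_inverse_atlas Q) Q"
  unfolding presents_def
proof (intro ballI allI)
  fix q e assume q: "q \<in> Q"
  then obtain V where V: "open V" "e \<in> V" "inj_on q V"
    using assms unfolding smooth_quotient_def by metis
  then have "(q ` V, inv_into V q) \<in> local_inverse_atlas Q"
    using q unfolding local_inverse_atlas_def by blast
  with V show "\<exists>(U, \<phi>)\<in>local_inverse_atlas Q. \<exists>V. open V \<and> e \<in> V \<and> U = q ` V \<and> (\<forall>v\<in>V. \<phi> (q v) = v)"
    by (intro bexI[of _ "(q ` V, inv_into V q)"]) (auto intro: inv_into_f_f)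
qed

lemma presents_prod_atlas:
  fixes A :: "('m, 'e::real_normed_vector) atlas" and B :: "('n, 'd::real_normed_vector) atlas"
  assumes A: "presents A Q" and B: "presents B R"
  shows "presents (prod_atlas A B) {map_prod q r | q r. q \<in> Q \<and> r \<in> R}"
  unfolding presents_def
proof (intro ballI allI)
  fix s and e :: "'e \<times> 'd" assume "s \<in> {map_prod q r | q r. q \<in> Q \<and> r \<in> R}"
  then obtain q r where s: "s = map_prod q r" "q \<in> Q" "r \<in> R" by blast
  obtain U \<phi> V where 1: "(U, \<phi>) \<in> A" "open V" "fst e \<in> V" "U = q ` V" "\<And>v. v \<in> V \<Longrightarrow> \<phi> (q v) = v"
    using presentsD[OF A s(2)] by metis
  obtain U' \<psi> V' where 2: "(U', \<psi>) \<in> B" "open V'" "snd e \<in> V'" "U' = r ` V'" "\<And>v. v \<in> V' \<Longrightarrow> \<psi> (r v) = v"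
    using presentsD[OF B s(3)] by metis
  have "(U \<times> U', map_prod \<phi> \<psi>) \<in> prod_atlas A B"
    using 1(1) 2(1) unfolding prod_atlas_def by blast
  moreover have "open (V \<times> V')" "e \<in> V \<times> V'" "U \<times> U' = s ` (V \<times> V')" "\<forall>v\<in>V \<times> V'. map_prod \<phi> \<psi> (s v) = v"
    using 1 2 by (auto simp: s map_prod_surj_on open_Times mem_Times_iff)
  ultimately show "\<exists>(W, \<eta>)\<in>prod_atlas A B. \<exists>V. open V \<and> e \<in> V \<and> W = s ` V \<and> (\<forall>v\<in>V. \<eta> (s v) = v)"
    by blast
qed

text \<open>The lift \<open>g\<close> is smooth on the whole model space, as polynomial maps are,
  but has to represent \<open>f\<close> only near \<open>e\<close> and only over \<open>S\<close>.
  So a map on a fibre product may be lifted by a formula that is meaningless off the fibre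
  product.\<close>

definition lifts_at ::
  "('e::real_normed_vector \<Rightarrow> 'm) set \<Rightarrow> ('d::real_normed_vector \<Rightarrow> 'n) set \<Rightarrow> 'm set \<Rightarrow> ('m \<Rightarrow> 'n) \<Rightarrow> 'm \<Rightarrow> bool" where
  "lifts_at Q R S f p \<longleftrightarrow> (\<exists>q\<in>Q. \<exists>r\<in>R. \<exists>e N g. q e = p \<and> open N \<and> e \<in> N \<and> smooth_on UNIV g \<and>
     (\<forall>e'\<in>N. q e' \<in> S \<longrightarrow> f (q e') = r (g e')))"

lemma lifts_atI:
  assumes "q \<in> Q" "r \<in> R" "q e = p" "open N" "e \<in> N" "smooth_on UNIV g"
    and "\<And>e'. e' \<in> N \<Longrightarrow> q e' \<in> S \<Longrightarrow> f (q e') = r (g e')"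
  shows "lifts_at Q R S f p"
  unfolding lifts_at_def using assms by blast

lemmas lifts_at_globalI = lifts_atI[OF _ _ _ open_UNIV UNIV_I]

text \<open>In the charts inverting \<open>q\<close> and \<open>r\<close> near \<open>e\<close> and
  \<open>g e\<close>, the map \<open>f\<close> becomes \<open>g\<close> itself, so \<open>g\<close>
  is the local smooth extension required.\<close>

lemma smooth_map_onI:
  assumes A: "presents A Q" and B: "presents B R" and lift: "\<And>p. p \<in> S \<Longrightarrow> lifts_at Q R S f p"
  shows "smooth_map_on A B S f"
  unfolding smooth_map_on_def
proof
  fix p assume p: "p \<in> S"
  obtain q r e N g where *: "q \<in> Q" "r \<in> R" "q e = p" "open N" "e \<in> N" "smooth_on UNIV g"
    and f: "\<And>e'. e' \<in> N \<Longrightarrow> q e' \<in> S \<Longrightarrow> f (q e') = r (g e')"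
    using lift[OF p, unfolded lifts_at_def] by (elim bexE exE conjE) (rule that; assumption?; blast)
  obtain V \<psi> V0 where V: "(V, \<psi>) \<in> B" "open V0" "g e \<in> V0" "V = r ` V0" "\<And>v. v \<in> V0 \<Longrightarrow> \<psi> (r v) = v"
    using presentsD[OF B *(2)] by metis
  obtain U \<phi> U0 where U: "(U, \<phi>) \<in> A" "open U0" "e \<in> U0" "U = q ` U0" "\<And>v. v \<in> U0 \<Longrightarrow> \<phi> (q v) = v"
    using presentsD[OF A *(1)] by metis
  define W where "W = U0 \<inter> N \<inter> g -` V0"
  have "open (g -` V0)"
    using smooth_on_imp_continuous_on[OF *(6)] V(2) by (simp add: open_vimage)
  then have "open W" unfolding W_def using U(2) *(4) by (intro open_Int)
  have fp: "f p = r (g e)" using f[OF *(5)] p *(3) by simp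
  have "W \<subseteq> \<phi> ` U" using U(4,5) unfolding W_def by force
  have "p \<in> U" "f p \<in> V" "\<phi> p \<in> W" using *(3,5) U(3-5) V(3,4) fp by (auto simp: W_def)
  moreover have "f s \<in> V \<and> \<psi> (f s) = g (\<phi> s)" if "s \<in> S \<inter> U" "\<phi> s \<in> W" for s
  proof -
    obtain u where u: "u \<in> U0" "s = q u" using \<open>s \<in> S \<inter> U\<close> U(4) by blast
    then have "u \<in> W" using that(2) U(5) by simp
    then have "f s = r (g u)" "g u \<in> V0" using f[of u] that(1) u(2) by (auto simp: W_def)
    then show ?thesis using V(4,5) U(5) u by simp
  qed
  moreover have "smooth_on W g" by (rule smooth_on_subset[OF *(6) subset_UNIV])
  ultimately have main: "p \<in> U \<and> f p \<in> V \<and> open W \<and> \<phi> p \<in> W \<and> W \<subseteq> \<phi> ` U \<and> smooth_on W g \<and>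
      (\<forall>q\<in>S \<inter> U. \<phi> q \<in> W \<longrightarrow> f q \<in> V \<and> \<psi> (f q) = g (\<phi> q))"
    using \<open>open W\<close> \<open>W \<subseteq> \<phi> ` U\<close> by simp
  show "\<exists>(U, \<phi>)\<in>A. \<exists>(V, \<psi>)\<in>B. \<exists>W g. p \<in> U \<and> f p \<in> V \<and> open W \<and> \<phi> p \<in> W \<and>
      W \<subseteq> \<phi> ` U \<and> smooth_on W g \<and> (\<forall>q\<in>S \<inter> U. \<phi> q \<in> W \<longrightarrow> f q \<in> V \<and> \<psi> (f q) = g (\<phi> q))"
    by (rule bexI[OF _ U(1)], rule case_prodI, rule bexI[OF _ V(1)], rule case_prodI, rule exI, rule exI, rule main)
qed

text \<open>It suffices to lift straight lines of the model space of the base to smooth curves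
  through \<open>p\<close>. The target atlas is fixed as \<open>local_inverse_atlas R\<close>
  because a submersion is tested in every chart of the target, so their form must be known.\<close>

lemma submersion_onI:
  assumes A: "presents A Q" and f: "smooth_map_on A (local_inverse_atlas R) S f"
    and lift: "\<And>p r e v. p \<in> S \<Longrightarrow> r \<in> R \<Longrightarrow> r e = f p \<Longrightarrow>
      \<exists>q\<in>Q. \<exists>\<delta>. smooth_on UNIV \<delta> \<and> q (\<delta> 0) = p \<and> (\<forall>t::real. q (\<delta> t) \<in> S \<and> f (q (\<delta> t)) = r (e + t *\<^sub>R v))"
  shows "submersion_on A (local_inverse_atlas R) S f"
  unfolding submersion_on_def
proof (intro conjI f ballI)
  fix p c assume p: "p \<in> S" and c: "c \<in> local_inverse_atlas R"
  then obtain r V0 where V0: "c = (r ` V0, inv_into V0 r)" "r \<in> R" "open V0" "inj_on r V0"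
    unfolding local_inverse_atlas_def by blast
  have "\<exists>\<epsilon>>0. \<exists>\<gamma>. \<gamma> 0 = p \<and> \<gamma> ` {- \<epsilon><..<\<epsilon>} \<subseteq> S \<and>
      smooth_map_on {(UNIV, id)} A {- \<epsilon><..<\<epsilon>} \<gamma> \<and>
      ((inv_into V0 r \<circ> f \<circ> \<gamma>) has_vector_derivative v) (at (0::real))" if fp: "f p \<in> r ` V0" for v
  proof -
    obtain e where e: "e \<in> V0" "r e = f p" using fp by auto
    obtain q \<delta> where q: "q \<in> Q" "smooth_on UNIV \<delta>" "q (\<delta> 0) = p"
      "\<And>t::real. q (\<delta> t) \<in> S" "\<And>t. f (q (\<delta> t)) = r (e + t *\<^sub>R v)"
      using lift[OF p V0(2) e(2), of v] by (elim bexE exE conjE) (rule that; assumption?; blast)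
    have "presents {(UNIV, id)} {id :: real \<Rightarrow> real}" by (auto simp: presents_def)
    then have smooth: "smooth_map_on {(UNIV, id)} A {- 1<..<1} (q \<circ> \<delta>)"
      by (rule smooth_map_onI[OF _ A]) (use q(1,2) in \<open>auto intro!: lifts_at_globalI[where q = id and r = q and g = \<delta>]\<close>)
    \<comment> \<open>For \<open>t\<close> in this neighbourhood of 0 the line stays in
      \<open>V0\<close>, where the chart undoes \<open>r\<close>; there the curve seen in the chart
      is the line, with velocity \<open>v\<close>.\<close>
    let ?T = "(\<lambda>t. e + t *\<^sub>R v) -` V0"
    have "open ?T" using V0(3) by (intro open_vimage) (auto intro!: continuous_intros)
    have "((\<lambda>t. e + t *\<^sub>R v) has_vector_derivative v) (at 0)"
      by (auto intro!: derivative_eq_intros simp: has_vector_derivative_def)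
    then have "((inv_into V0 r \<circ> f \<circ> (q \<circ> \<delta>)) has_vector_derivative v) (at 0)"
      by (rule has_vector_derivative_transform_within_open[OF _ \<open>open ?T\<close>])
        (use e(1) q(5) V0(4) in \<open>auto simp: inv_into_f_f\<close>)
    with smooth q(3,4) show ?thesis
      by (intro exI[of _ 1] conjI exI[of _ "q \<circ> \<delta>"]) auto
  qed
  then show "case c of (V, \<psi>) \<Rightarrow> f p \<in> V \<longrightarrow> (\<forall>v. \<exists>\<epsilon>>0. \<exists>\<gamma>. \<gamma> 0 = p \<and> \<gamma> ` {- \<epsilon><..<\<epsilon>} \<subseteq> S \<and>
      smooth_map_on {(UNIV, id)} A {- \<epsilon><..<\<epsilon>} \<gamma> \<and> ((\<psi> \<circ> f \<circ> \<gamma>) has_vector_derivative v) (at 0))"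
    by (simp add: V0(1))
qed

text \<open>Intended for subgroups, where isolating 0 isolates every point. Isolation of 0 will give
  local injectivity of the quotient map, closedness the separation of distinct fibres.\<close>

definition closed_discrete :: "'e::real_normed_vector set \<Rightarrow> bool" where
  "closed_discrete L \<longleftrightarrow> closed L \<and> (\<exists>O'. open O' \<and> 0 \<in> O' \<and> O' \<inter> L \<subseteq> {0})"

lemma closed_discrete_Times:
  assumes "closed_discrete L" "closed_discrete L'"
  shows "closed_discrete (L \<times> L')"
proof -
  obtain O1 O2 where O: "open O1" "0 \<in> O1" "O1 \<inter> L \<subseteq> {0}" "open O2" "0 \<in> O2" "O2 \<inter> L' \<subseteq> {0}"
    using assms unfolding closed_discrete_def by blast
  then have "open (O1 \<times> O2)" "0 \<in> O1 \<times> O2" "(O1 \<times> O2) \<inter> (L \<times> L') \<subseteq> {0}"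
    by (auto simp: open_Times zero_prod_def)
  moreover have "closed (L \<times> L')" using assms by (simp add: closed_discrete_def closed_Times)
  ultimately show ?thesis unfolding closed_discrete_def by (intro conjI exI[of _ "O1 \<times> O2"])
qed

lemma closed_discrete_zero: "closed_discrete {0}"
  unfolding closed_discrete_def by (intro conjI exI[of _ UNIV]) auto

lemma closed_discrete_Ints: "closed_discrete (\<int> :: real set)"
  unfolding closed_discrete_def
proof (intro conjI exI[of _ "{-1<..<1::real}"])
  show "{-1<..<1::real} \<inter> \<int> \<subseteq> {0}" by (auto elim!: Ints_cases)
qed (auto intro: closed_Ints)

text \<open>Here \<open>D\<close> measures the difference of two points of a fibre; the fibres are the orbits of a group
  acting properly discontinuously because the set \<open>L\<close> of admissible differences is closed and
  discrete.\<close>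

lemma smooth_quotientI:
  fixes q :: "'e::real_normed_vector \<Rightarrow> 'm" and D :: "'e \<times> 'e \<Rightarrow> 'd::real_normed_vector"
  assumes cont: "continuous_on UNIV D" and L: "closed_discrete L"
    and fibre: "\<And>e e'. q e = q e' \<longleftrightarrow> D (e, e') \<in> L"
    and D0: "\<And>e e'. D (e, e') = 0 \<longleftrightarrow> e = e'"
    and deck: "\<And>e e'. q e = q e' \<Longrightarrow> \<exists>\<gamma>. smooth_on UNIV \<gamma> \<and> \<gamma> e = e' \<and> (\<forall>x. q (\<gamma> x) = q x)"
  shows "smooth_quotient q"
proof -
  obtain O' where "open O'" "0 \<in> O'" "O' \<inter> L \<subseteq> {0}" "closed L"
    using L unfolding closed_discrete_def by blast
  show ?thesis unfolding smooth_quotient_def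
  proof (intro conjI allI impI)
    fix e
    have "open (D -` O')" using cont \<open>open O'\<close> by (simp add: open_vimage)
    moreover have "(e, e) \<in> D -` O'" using D0[of e e] \<open>0 \<in> O'\<close> by simp
    ultimately obtain V V' where V: "open V" "open V'" "(e, e) \<in> V \<times> V'" "V \<times> V' \<subseteq> D -` O'"
      by (rule open_prod_elim)
    have "inj_on q (V \<inter> V')"
    proof (rule inj_onI)
      fix x y assume *: "x \<in> V \<inter> V'" "y \<in> V \<inter> V'" "q x = q y"
      then have "D (x, y) \<in> O' \<inter> L" using V(4) fibre[of x y] by auto
      then show "x = y" using \<open>O' \<inter> L \<subseteq> {0}\<close> D0[of x y] by auto
    qed
    then show "\<exists>V. open V \<and> e \<in> V \<and> inj_on q V" using V by (intro exI[of _ "V \<inter> V'"]) auto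
  next
    fix e e' assume "q e \<noteq> q e'"
    then have "(e, e') \<in> D -` (- L)" using fibre by simp
    moreover have "open (D -` (- L))" using cont \<open>closed L\<close> by (intro open_vimage) auto
    ultimately obtain N N' where N: "open N" "open N'" "(e, e') \<in> N \<times> N'" "N \<times> N' \<subseteq> D -` (- L)"
      by (metis open_prod_elim)
    have "q ` N \<inter> q ` N' = {}"
    proof (rule ccontr)
      assume "q ` N \<inter> q ` N' \<noteq> {}"
      then obtain x y where "x \<in> N" "y \<in> N'" "q x = q y" by auto
      then show False using N(4) fibre[of x y] by auto
    qed
    then show "\<exists>N N'. open N \<and> open N' \<and> e \<in> N \<and> e' \<in> N' \<and> q ` N \<inter> q ` N' = {}" using N by blast
  qed (rule deck)
qed

section \<open>Manifolds whose charts are local inverses of quotient maps with disjoint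
  ranges\<close>

context
  fixes Q :: "('e::real_normed_vector \<Rightarrow> 'm) set"
  assumes quotients: "\<And>q. q \<in> Q \<Longrightarrow> smooth_quotient q"
    and disjoint: "\<And>q q' e e'. q \<in> Q \<Longrightarrow> q' \<in> Q \<Longrightarrow> q e = q' e' \<Longrightarrow> q = q'"
begin

lemma open_preimage_image:
  assumes "q \<in> Q" "q' \<in> Q" "open N"
  shows "open (q -` (q' ` N))"
proof (subst open_subopen, intro ballI)
  fix e assume "e \<in> q -` (q' ` N)"
  then obtain e' where e': "e' \<in> N" "q e = q' e'" by auto
  have [simp]: "q' = q" using disjoint[OF assms(1,2) e'(2)] by (rule sym)
  obtain \<gamma> where g: "smooth_on UNIV \<gamma>" "\<gamma> e = e'" "\<And>x. q (\<gamma> x) = q x"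
    using quotients[OF assms(1)] e'(2) unfolding smooth_quotient_def by force
  have "open (\<gamma> -` N)" using smooth_on_imp_continuous_on[OF g(1)] \<open>open N\<close> by (simp add: open_vimage)
  moreover have "\<gamma> -` N \<subseteq> q -` (q' ` N)" using g(3) by (metis \<open>q' = q\<close> imageI subsetI vimage_eq)
  ultimately show "\<exists>T. open T \<and> e \<in> T \<and> T \<subseteq> q -` (q' ` N)" using g(2) e'(1) by blast
qed

lemma chart_image: "inj_on q V \<Longrightarrow> inv_into V q ` (q ` V \<inter> W) = V \<inter> q -` W"
  by (force simp: inv_into_f_f)

text \<open>The atlas topology is the final topology for the maps in \<open>Q\<close>. This replaces
  the quantification over charts by a condition on preimages.\<close>

lemma openin_local_inverse_atlas:
  "openin (atlas_topology M (local_inverse_atlas Q)) W \<longleftrightarrow> W \<subseteq> M \<and> (\<forall>q\<in>Q. open (q -` W))"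
proof -
  have "(\<forall>(U, \<phi>)\<in>local_inverse_atlas Q. open (\<phi> ` (U \<inter> W))) \<longleftrightarrow> (\<forall>q\<in>Q. open (q -` W))" for W
  proof
    assume *: "\<forall>(U, \<phi>)\<in>local_inverse_atlas Q. open (\<phi> ` (U \<inter> W))"
    show "\<forall>q\<in>Q. open (q -` W)"
    proof
      fix q assume q: "q \<in> Q"
      show "open (q -` W)"
      proof (subst open_subopen, intro ballI)
        fix e assume e: "e \<in> q -` W"
        obtain V where V: "open V" "e \<in> V" "inj_on q V"
          using quotients[OF q] unfolding smooth_quotient_def by metis
        then have "(q ` V, inv_into V q) \<in> local_inverse_atlas Q"
          using q unfolding local_inverse_atlas_def by blast
        with * have "open (inv_into V q ` (q ` V \<inter> W))" by blast
        then have "open (V \<inter> q -` W)" by (simp add: chart_image[OF V(3)])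
        with V(2) e show "\<exists>T. open T \<and> e \<in> T \<and> T \<subseteq> q -` W" by blast
      qed
    qed
  next
    assume "\<forall>q\<in>Q. open (q -` W)"
    then show "\<forall>(U, \<phi>)\<in>local_inverse_atlas Q. open (\<phi> ` (U \<inter> W))"
      by (auto simp: local_inverse_atlas_def chart_image open_Int)
  qed
  moreover have "istopology (\<lambda>W. W \<subseteq> M \<and> (\<forall>q\<in>Q. open (q -` W)))"
    unfolding istopology_def by (auto simp: vimage_Union open_Int)
  ultimately show ?thesis by (simp add: atlas_topology_def topology_inverse')
qed

lemma openin_local_inverse_image:
  "q \<in> Q \<Longrightarrow> open N \<Longrightarrow> openin (atlas_topology (\<Union>q\<in>Q. range q) (local_inverse_atlas Q)) (q ` N)"
  unfolding openin_local_inverse_atlas using open_preimage_image by auto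

lemma topspace_local_inverse_atlas:
  "topspace (atlas_topology (\<Union>q\<in>Q. range q) (local_inverse_atlas Q)) = (\<Union>q\<in>Q. range q)" (is "topspace ?X = ?M")
proof
  show "topspace ?X \<subseteq> ?M"
    using openin_topspace[of ?X] unfolding openin_local_inverse_atlas by (rule conjunct1)
  have "openin ?X (range q)" if "q \<in> Q" for q
    using openin_local_inverse_image[OF that open_UNIV] .
  then show "?M \<subseteq> topspace ?X" by (intro UN_least openin_subset)
qed

text \<open>Two points in the range of one \<open>q\<close> are separated by the last clause of
  \<open>smooth_quotient\<close>; points in the ranges of different maps are separated by these
  ranges, which are open and disjoint.\<close>

lemma Hausdorff_local_inverse_atlas:
  "Hausdorff_space (atlas_topology (\<Union>q\<in>Q. range q) (local_inverse_atlas Q))" (is "Hausdorff_space ?X")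
  unfolding Hausdorff_space_def topspace_local_inverse_atlas
proof (intro allI impI)
  fix x y assume xy: "x \<in> (\<Union>q\<in>Q. range q) \<and> y \<in> (\<Union>q\<in>Q. range q) \<and> x \<noteq> y"
  then obtain q e q' e' where *: "q \<in> Q" "q' \<in> Q" "x = q e" "y = q' e'" by (elim conjE UN_E rangeE)
  show "\<exists>U V. openin ?X U \<and> openin ?X V \<and> x \<in> U \<and> y \<in> V \<and> disjnt U V"
  proof (cases "q = q'")
    case True
    then have "q e \<noteq> q e'" using * xy by simp
    then obtain N N' where N: "open N" "open N'" "e \<in> N" "e' \<in> N'" "q ` N \<inter> q ` N' = {}"
      using quotients[OF *(1)] unfolding smooth_quotient_def by metis
    show ?thesis
      using openin_local_inverse_image[OF *(1) N(1)] openin_local_inverse_image[OF *(1) N(2)] N(3-5)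
      by (intro exI[of _ "q ` N"] exI[of _ "q ` N'"]) (simp add: disjnt_def * True)
  next
    case False
    then have "range q \<inter> range q' = {}" using disjoint[OF *(1,2)] by fast
    then show ?thesis
      using openin_local_inverse_image[OF *(1) open_UNIV] openin_local_inverse_image[OF *(2) open_UNIV]
      by (intro exI[of _ "range q"] exI[of _ "range q'"]) (simp add: disjnt_def *)
  qed
qed

lemma second_countable_local_inverse_atlas:
  assumes "countable Q" and "countable D" and D: "topological_basis (D :: 'e set set)"
  shows "second_countable (atlas_topology (\<Union>q\<in>Q. range q) (local_inverse_atlas Q))" (is "second_countable ?X")
  unfolding second_countable_def
proof (intro exI conjI ballI allI impI)
  show "countable ((\<lambda>(q, N). q ` N) ` (Q \<times> D))" using assms by simp
  show "openin ?X V" if "V \<in> (\<lambda>(q, N). q ` N) ` (Q \<times> D)" for V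
    using that openin_local_inverse_image topological_basis_open[OF D] by auto
  fix W x assume W: "openin ?X W \<and> x \<in> W"
  then have W': "W \<subseteq> (\<Union>q\<in>Q. range q)" "\<And>q. q \<in> Q \<Longrightarrow> open (q -` W)"
    unfolding openin_local_inverse_atlas by simp_all
  then obtain q e where q: "q \<in> Q" "x = q e" using W by blast
  then obtain N where "N \<in> D" "e \<in> N" "N \<subseteq> q -` W"
    using topological_basisE[OF D W'(2)[OF q(1)], of e] W by auto
  then show "\<exists>V\<in>(\<lambda>(q, N). q ` N) ` (Q \<times> D). x \<in> V \<and> V \<subseteq> W"
    using q by (intro bexI[of _ "q ` N"]) auto
qed

lemma Union_local_inverse_atlas: "(\<Union>(U, \<phi>)\<in>local_inverse_atlas Q. U) = (\<Union>q\<in>Q. range q)"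
proof
  show "(\<Union>(U, \<phi>)\<in>local_inverse_atlas Q. U) \<subseteq> (\<Union>q\<in>Q. range q)"
    by (auto simp: local_inverse_atlas_def)
  show "(\<Union>q\<in>Q. range q) \<subseteq> (\<Union>(U, \<phi>)\<in>local_inverse_atlas Q. U)"
  proof clarify
    fix q e assume q: "q \<in> Q"
    obtain V where V: "open V" "e \<in> V" "inj_on q V"
      using quotients[OF q] unfolding smooth_quotient_def by metis
    then have "(q ` V, inv_into V q) \<in> local_inverse_atlas Q"
      using q unfolding local_inverse_atlas_def by blast
    then show "q e \<in> (\<Union>(U, \<phi>)\<in>local_inverse_atlas Q. U)"
      using V(2) by (intro UN_I[of "(q ` V, inv_into V q)"]) auto
  qed
qed

text \<open>Near \<open>e\<close> the change of charts is the deck transformation that moves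
  \<open>e\<close> to the corresponding point \<open>e'\<close> of the second chart domain.\<close>

lemma smooth_transition:
  assumes "(U, \<phi>) \<in> local_inverse_atlas Q" "(U', \<psi>) \<in> local_inverse_atlas Q"
  shows "open (\<phi> ` (U \<inter> U')) \<and> smooth_on (\<phi> ` (U \<inter> U')) (\<psi> \<circ> inv_into U \<phi>)"
proof -
  obtain q V where q: "U = q ` V" "\<phi> = inv_into V q" "q \<in> Q" "open V" "inj_on q V"
    using assms(1) unfolding local_inverse_atlas_def by blast
  obtain q' V' where q': "U' = q' ` V'" "\<psi> = inv_into V' q'" "q' \<in> Q" "open V'" "inj_on q' V'"
    using assms(2) unfolding local_inverse_atlas_def by blast
  have eq: "\<phi> ` (U \<inter> U') = V \<inter> q -` (q' ` V')"
    unfolding q(1,2) q'(1) by (rule chart_image[OF q(5)])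
  have opn: "open (V \<inter> q -` (q' ` V'))"
    by (rule open_Int[OF q(4) open_preimage_image[OF q(3) q'(3,4)]])
  have "smooth_on (V \<inter> q -` (q' ` V')) (\<psi> \<circ> inv_into U \<phi>)"
  proof (rule smooth_on_local_cong[OF opn])
    fix e assume "e \<in> V \<inter> q -` (q' ` V')"
    then obtain e' where e: "e \<in> V" "e' \<in> V'" "q e = q' e'" by auto
    have qq: "q' = q" using disjoint[OF q(3) q'(3) e(3)] by (rule sym)
    then have "q e = q e'" using e(3) by simp
    then obtain \<gamma> where g: "smooth_on UNIV \<gamma>" "\<gamma> e = e'" "\<And>x. q (\<gamma> x) = q x"
      using quotients[OF q(3)] unfolding smooth_quotient_def by metis
    have 1: "open (\<gamma> -` V')"
      using smooth_on_imp_continuous_on[OF g(1)] q'(4) by (simp add: open_vimage)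
    have 2: "(\<psi> \<circ> inv_into U \<phi>) y = \<gamma> y" if y: "y \<in> \<gamma> -` V'" "y \<in> V" for y
    proof -
      have "inj_on \<phi> U" unfolding q(1,2) by (rule inj_on_inv_into) simp
      moreover have "\<phi> (q y) = y" "q y \<in> U" using y(2) q by (simp_all add: inv_into_f_f)
      ultimately have "inv_into U \<phi> y = q y" by (metis inv_into_f_f)
      moreover have "\<psi> (q' (\<gamma> y)) = \<gamma> y" using y(1) q' by (simp add: inv_into_f_f)
      ultimately show ?thesis using g(3) qq by simp
    qed
    show "\<exists>N g. open N \<and> e \<in> N \<and> smooth_on N g \<and>
        (\<forall>y\<in>N \<inter> (V \<inter> q -` (q' ` V')). (\<psi> \<circ> inv_into U \<phi>) y = g y)"
      by (intro exI[of _ "\<gamma> -` V'"] exI[of _ \<gamma>] conjI ballI 1 2 smooth_on_subset[OF g(1) subset_UNIV])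
        (use g(2) e(2) in simp_all)
  qed
  with eq opn show ?thesis by simp
qed

lemma smooth_manifold_local_inverse_atlas:
  assumes "countable Q" and span: "\<exists>B::'e set. finite B \<and> span B = UNIV"
    and basis: "\<exists>D::'e set set. countable D \<and> topological_basis D"
    and M: "M = (\<Union>q\<in>Q. range q)"
  shows "smooth_manifold M (local_inverse_atlas Q)"
  unfolding smooth_manifold_def M
proof (intro conjI span Hausdorff_local_inverse_atlas Union_local_inverse_atlas)
  show "second_countable (atlas_topology (\<Union>q\<in>Q. range q) (local_inverse_atlas Q))"
    using basis second_countable_local_inverse_atlas[OF assms(1)] by blast
  show "\<forall>(U, \<phi>)\<in>local_inverse_atlas Q. U \<subseteq> (\<Union>q\<in>Q. range q) \<and> inj_on \<phi> U \<and> open (\<phi> ` U)"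
  proof clarify
    fix U \<phi> assume "(U, \<phi>) \<in> local_inverse_atlas Q"
    then obtain q V where q: "U = q ` V" "\<phi> = inv_into V q" "q \<in> Q" "open V" "inj_on q V"
      unfolding local_inverse_atlas_def by blast
    have "inv_into V q ` q ` V = V" using q(5) by simp
    then show "U \<subseteq> (\<Union>q\<in>Q. range q) \<and> inj_on \<phi> U \<and> open (\<phi> ` U)"
      using q(3,4) unfolding q(1,2) by (auto intro: inj_on_inv_into)
  qed
  show "\<forall>(U, \<phi>)\<in>local_inverse_atlas Q. \<forall>(V, \<psi>)\<in>local_inverse_atlas Q.
      open (\<phi> ` (U \<inter> V)) \<and> smooth_on (\<phi> ` (U \<inter> V)) (\<psi> \<circ> inv_into U \<phi>)"
    using smooth_transition by blast
qed

end

lemma finite_spanning_prod: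
  assumes "\<exists>B::'e::real_normed_vector set. finite B \<and> span B = UNIV"
    and "\<exists>B::'d::real_normed_vector set. finite B \<and> span B = UNIV"
  shows "\<exists>B::('e \<times> 'd) set. finite B \<and> span B = UNIV"
proof -
  obtain B :: "'e set" and C :: "'d set" where BC: "finite B" "span B = UNIV" "finite C" "span C = UNIV"
    using assms by blast
  define S where "S = (\<lambda>x. (x, 0::'d)) ` B \<union> (\<lambda>y. (0::'e, y)) ` C"
  have "linear (\<lambda>x::'e. (x, 0::'d))" "linear (\<lambda>y::'d. (0::'e, y))"
    by (auto intro!: linearI)
  then have "(\<lambda>x. (x, 0)) ` span B \<subseteq> span S" "(\<lambda>y. (0, y)) ` span C \<subseteq> span S"
    unfolding S_def by (simp_all only: linear_span_image[symmetric]) (intro span_mono Un_upper1 Un_upper2)+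
  then have "(x, 0) + (0, y) \<in> span S" for x y
    using BC by (intro span_add) auto
  then have "span S = UNIV" by auto
  moreover have "finite S" using BC by (simp add: S_def)
  ultimately show ?thesis by blast
qed

lemma countable_basis_prod:
  assumes "\<exists>D::'e::topological_space set set. countable D \<and> topological_basis D"
    and "\<exists>D::'d::topological_space set set. countable D \<and> topological_basis D"
  shows "\<exists>D::('e \<times> 'd) set set. countable D \<and> topological_basis D"
proof -
  obtain B :: "'e set set" and C :: "'d set set"
    where "countable B" "topological_basis B" "countable C" "topological_basis C"
    using assms by blast
  then show ?thesis
    using topological_basis_prod[of B C] by (intro exI[of _ "(\<lambda>(a, b). a \<times> b) ` (B \<times> C)"]) auto
qed

section \<open>Groupoids\<close>

lemma is_groupoidI:
  assumes "\<And>f. f \<in> Arr G \<Longrightarrow> src G f \<in> Obj G" "\<And>f. f \<in> Arr G \<Longrightarrow> tgt G f \<in> Obj G"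
    and "\<And>x. x \<in> Obj G \<Longrightarrow> iden G x \<in> Arr G \<and> src G (iden G x) = x \<and> tgt G (iden G x) = x"
    and "\<And>f g. f \<in> Arr G \<Longrightarrow> g \<in> Arr G \<Longrightarrow> src G g = tgt G f \<Longrightarrow>
        cmp G g f \<in> Arr G \<and> src G (cmp G g f) = src G f \<and> tgt G (cmp G g f) = tgt G g"
    and "\<And>f. f \<in> Arr G \<Longrightarrow> cmp G f (iden G (src G f)) = f \<and> cmp G (iden G (tgt G f)) f = f"
    and "\<And>f g h. f \<in> Arr G \<Longrightarrow> g \<in> Arr G \<Longrightarrow> h \<in> Arr G \<Longrightarrow> src G g = tgt G f \<Longrightarrow>
        src G h = tgt G g \<Longrightarrow> cmp G (cmp G h g) f = cmp G h (cmp G g f)"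
    and "\<And>f. f \<in> Arr G \<Longrightarrow> \<exists>g\<in>Arr G. src G g = tgt G f \<and> tgt G g = src G f \<and>
        cmp G g f = iden G (src G f) \<and> cmp G f g = iden G (tgt G f)"
  shows "is_groupoid G"
  unfolding is_groupoid_def by (intro conjI ballI impI) (use assms in blast)+

text \<open>The definite description in \<open>arr_inv\<close> requires uniqueness of inverses: h =
  h(fg) = (hf)g = g.\<close>

lemma arr_inv_eqI:
  assumes G: "is_groupoid G" and f: "f \<in> Arr G" and g: "g \<in> Arr G" "src G g = tgt G f" "tgt G g = src G f"
    and inv: "cmp G g f = iden G (src G f)" "cmp G f g = iden G (tgt G f)"
  shows "arr_inv G f = g"
  unfolding arr_inv_def
proof (rule the_equality)
  show "g \<in> Arr G \<and> src G g = tgt G f \<and> tgt G g = src G f \<and>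
      cmp G g f = iden G (src G f) \<and> cmp G f g = iden G (tgt G f)" using g inv by simp
next
  fix h assume h: "h \<in> Arr G \<and> src G h = tgt G f \<and> tgt G h = src G f \<and>
      cmp G h f = iden G (src G f) \<and> cmp G f h = iden G (tgt G f)"
  have unit: "\<And>f. f \<in> Arr G \<Longrightarrow> cmp G f (iden G (src G f)) = f \<and> cmp G (iden G (tgt G f)) f = f"
    and assoc: "\<And>f g h. f \<in> Arr G \<Longrightarrow> g \<in> Arr G \<Longrightarrow> h \<in> Arr G \<Longrightarrow> src G g = tgt G f \<Longrightarrow>
        src G h = tgt G g \<Longrightarrow> cmp G (cmp G h g) f = cmp G h (cmp G g f)"
    using G unfolding is_groupoid_def by blast+
  have "h = cmp G h (cmp G f g)" using unit[of h] h inv by simp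
  also have "\<dots> = cmp G (cmp G h f) g" using assoc[of g f h] h g f by simp
  also have "\<dots> = g" using unit[of g] g h by simp
  finally show "h = g" .
qed

lemma groupoid_inverse:
  "is_groupoid G \<Longrightarrow> f \<in> Arr G \<Longrightarrow> \<exists>g\<in>Arr G. src G g = tgt G f \<and> tgt G g = src G f \<and>
     cmp G g f = iden G (src G f) \<and> cmp G f g = iden G (tgt G f)"
  unfolding is_groupoid_def by (elim conjE) (erule bspec)

section \<open>Lattices\<close>

lemma e2pi_add: "e2pi (a + b) = e2pi a * e2pi b"
  by (simp add: e2pi_def cis_mult distrib_left)

lemma e2pi_0 [simp]: "e2pi 0 = 1"
  by (simp add: e2pi_def)

lemma e2pi_eq_1_iff: "e2pi a = 1 \<longleftrightarrow> a \<in> \<int>"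
proof
  assume "e2pi a = 1"
  then have "cos (2 * pi * a) = 1" by (metis e2pi_def cis.simps(1) one_complex.simps(1))
  then obtain n :: int where "2 * pi * a = of_int n * 2 * pi" by (auto simp: cos_one_2pi_int)
  then have "a = of_int n" by simp
  then show "a \<in> \<int>" by simp
next
  assume "a \<in> \<int>"
  then show "e2pi a = 1" using cis_multiple_2pi by (simp add: e2pi_def)
qed

lemma norm_e2pi [simp]: "cmod (e2pi a) = 1"
  by (simp add: e2pi_def)

lemma e2pi_nonzero [simp]: "e2pi a \<noteq> 0"
  using norm_e2pi[of a] by force

lemma e2pi_minus: "e2pi (- a) = inverse (e2pi a)"
  using e2pi_add[of a "- a"] by (simp add: inverse_eq_divide nonzero_eq_divide_eq mult.commute)

lemma e2pi_diff: "e2pi (a - b) = e2pi a / e2pi b"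
  using e2pi_add[of a "- b"] by (simp add: e2pi_minus field_simps)

lemma e2pi_eq_iff: "e2pi a = e2pi b \<longleftrightarrow> b - a \<in> \<int>"
  using e2pi_eq_1_iff[of "b - a"] by (auto simp: e2pi_diff)

lemma e2pi_surj:
  assumes "cmod w = 1"
  shows "\<exists>c. w = e2pi c"
proof -
  have "w \<noteq> 0" using assms by auto
  then have "w = e2pi (Arg w / (2 * pi))"
    using cis_Arg[of w] assms by (simp add: e2pi_def sgn_div_norm)
  then show ?thesis ..
qed

lemma carrier_circle_group [simp]: "w \<in> carrier circle_group \<longleftrightarrow> cmod w = 1"
  by (simp add: circle_group_def)

lemma comm_group_circle: "comm_group circle_group"
proof (rule comm_groupI)
  fix x assume x: "x \<in> carrier circle_group"
  then have "inverse x * x = 1" by (intro left_inverse) auto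
  with x show "\<exists>y\<in>carrier circle_group. y \<otimes>\<^bsub>circle_group\<^esub> x = \<one>\<^bsub>circle_group\<^esub>"
    by (intro bexI[of _ "inverse x"]) (simp_all add: circle_group_def norm_inverse)
qed (auto simp: circle_group_def norm_mult)

locale lattice_basis = finite_dim_basis B for B :: "'a::real_normed_vector set" +
  fixes \<Lambda> :: "'a set"
  assumes lattice_eq: "\<Lambda> = {\<Sum>b\<in>B. of_int (c b) *\<^sub>R b | c :: 'a \<Rightarrow> int. True}"
begin

text \<open>Membership becomes integrality of finitely many continuous linear functionals, from
  which the group laws, closedness and discreteness of the lattice are read off.\<close>

lemma lattice_iff: "x \<in> \<Lambda> \<longleftrightarrow> (\<forall>b\<in>B. coord x b \<in> \<int>)"
proof
  assume "x \<in> \<Lambda>"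
  then show "\<forall>b\<in>B. coord x b \<in> \<int>"
    unfolding lattice_eq by (auto simp: representation_basis_sum)
next
  assume *: "\<forall>b\<in>B. coord x b \<in> \<int>"
  have "x = (\<Sum>b\<in>B. of_int \<lfloor>coord x b\<rfloor> *\<^sub>R b)"
    by (subst basis_expansion[of x]) (use * in \<open>auto intro!: sum.cong elim: Ints_cases\<close>)
  then show "x \<in> \<Lambda>" unfolding lattice_eq by (intro CollectI exI[of _ "\<lambda>b. \<lfloor>coord x b\<rfloor>"]) simp
qed

lemma representation_linear:
  "coord (x + y) b = coord x b + coord y b"
  "coord (x - y) b = coord x b - coord y b"
  "coord (r *\<^sub>R x) b = r * coord x b"
  using independent_B span_B by (simp_all add: representation_add representation_diff representation_scale)

lemma lattice_0: "0 \<in> \<Lambda>"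
  by (simp add: lattice_iff representation_zero)

lemma lattice_add: "x \<in> \<Lambda> \<Longrightarrow> y \<in> \<Lambda> \<Longrightarrow> x + y \<in> \<Lambda>"
  by (simp add: lattice_iff representation_linear)

lemma lattice_diff: "x \<in> \<Lambda> \<Longrightarrow> y \<in> \<Lambda> \<Longrightarrow> x - y \<in> \<Lambda>"
  by (simp add: lattice_iff representation_linear)

lemma lattice_minus: "- x \<in> \<Lambda> \<longleftrightarrow> x \<in> \<Lambda>"
  using lattice_diff[OF lattice_0, of x] lattice_diff[OF lattice_0, of "- x"] by auto

lemma lattice_basis: "b \<in> B \<Longrightarrow> b \<in> \<Lambda>"
  using independent_B by (simp add: lattice_iff representation_basis)

lemma countable_lattice: "countable \<Lambda>"
proof -
  have "\<Lambda> \<subseteq> (\<lambda>c. \<Sum>b\<in>B. of_int (c b) *\<^sub>R b) ` (B \<rightarrow>\<^sub>E (UNIV :: int set))"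
  proof
    fix x assume "x \<in> \<Lambda>"
    then obtain c :: "'a \<Rightarrow> int" where "x = (\<Sum>b\<in>B. of_int (c b) *\<^sub>R b)" unfolding lattice_eq by blast
    then show "x \<in> (\<lambda>c. \<Sum>b\<in>B. of_int (c b) *\<^sub>R b) ` (B \<rightarrow>\<^sub>E (UNIV :: int set))"
      by (intro image_eqI[of _ _ "restrict c B"]) auto
  qed
  then show ?thesis
    using finite_B by (meson countable_PiE countable_image countable_subset uncountable_def countableI_type)
qed

lemma closed_lattice: "closed \<Lambda>"
proof -
  have "\<Lambda> = (\<Inter>b\<in>B. (\<lambda>x. coord x b) -` \<int>)" by (auto simp: lattice_iff)
  moreover have "closed ((\<lambda>x. coord x b) -` \<int>)" for b
    by (intro closed_vimage closed_Ints linear_continuous_on bounded_linear_representation)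
  ultimately show ?thesis by auto
qed

lemma discrete_lattice: "\<exists>O'. open O' \<and> 0 \<in> O' \<and> O' \<inter> \<Lambda> \<subseteq> {0}"
proof -
  define O' where "O' = (\<Inter>b\<in>B. (\<lambda>x. coord x b) -` {-1<..<1})"
  have "open ((\<lambda>x. coord x b) -` {-1<..<1})" for b
    by (intro open_vimage open_greaterThanLessThan linear_continuous_on bounded_linear_representation)
  then have "open O'" unfolding O'_def using finite_B by (intro open_INT) auto
  moreover have "x = 0" if "x \<in> O'" "x \<in> \<Lambda>" for x
  proof -
    have "coord x b = 0" if "b \<in> B" for b
    proof -
      have "coord x b \<in> \<int>" "\<bar>coord x b\<bar> < 1"
        using \<open>x \<in> O'\<close> \<open>x \<in> \<Lambda>\<close> that by (auto simp: O'_def lattice_iff)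
      then show ?thesis by (auto elim!: Ints_cases)
    qed
    then show "x = 0" by (subst basis_expansion) simp
  qed
  ultimately show ?thesis by (intro exI[of _ O']) (auto simp: O'_def representation_zero)
qed

lemma additive_subset_contains_multiples:
  assumes "0 \<in> A" "\<And>x y. x \<in> A \<Longrightarrow> y \<in> A \<Longrightarrow> x + y \<in> A" "\<And>x y. x \<in> A \<Longrightarrow> y \<in> A \<Longrightarrow> x - y \<in> A"
    and "b \<in> A"
  shows "of_int k *\<^sub>R (b :: 'a) \<in> A"
proof (induction k rule: int_induct[of _ 0])
  case (step1 i)
  then show ?case using assms(2)[of "of_int i *\<^sub>R b" b] assms(4) by (simp add: scaleR_left_distrib)
next
  case (step2 i)
  then show ?case using assms(3)[of "of_int i *\<^sub>R b" b] assms(4) by (simp add: scaleR_left_diff_distrib)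
qed (use assms in simp)

text \<open>An induction principle for \<Lambda>: a subgroup containing the basis contains the
  lattice. It will be applied to the set where two homomorphisms agree.\<close>

lemma additive_subset_contains_lattice:
  assumes "0 \<in> A" "\<And>x y. x \<in> A \<Longrightarrow> y \<in> A \<Longrightarrow> x + y \<in> A" "\<And>x y. x \<in> A \<Longrightarrow> y \<in> A \<Longrightarrow> x - y \<in> A"
    and "B \<subseteq> A"
  shows "\<Lambda> \<subseteq> A"
proof
  fix x assume "x \<in> \<Lambda>"
  then obtain c :: "'a \<Rightarrow> int" where x: "x = (\<Sum>b\<in>B. of_int (c b) *\<^sub>R b)" unfolding lattice_eq by blast
  have "(\<Sum>b\<in>B'. of_int (c b) *\<^sub>R b) \<in> A" if "B' \<subseteq> B" for B'
    using finite_subset[OF that finite_B] that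
  proof (induction B' rule: finite_induct)
    case (insert b B')
    then show ?case
      using assms additive_subset_contains_multiples[OF assms(1-3), of b "c b"] by auto
  qed (use assms in simp)
  then show "x \<in> A" unfolding x by blast
qed

text \<open>The analogue for the ambient vector space, generated as a group by all real multiples of
  basis vectors.\<close>

lemma additive_subset_eq_UNIV:
  assumes "0 \<in> A" "\<And>x y. x \<in> A \<Longrightarrow> y \<in> A \<Longrightarrow> x + y \<in> A"
    and "\<And>r b. b \<in> B \<Longrightarrow> r *\<^sub>R b \<in> A"
  shows "x \<in> A"
proof -
  have "(\<Sum>b\<in>B'. coord x b *\<^sub>R b) \<in> A" if "B' \<subseteq> B" for B'
    using finite_subset[OF that finite_B] that
    by (induction B' rule: finite_induct) (use assms in auto)
  then show ?thesis using basis_expansion[of x] by (metis subset_refl)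
qed

text \<open>The relation between I and J is assumed on the lattice only; this carries it to the
  whole vector space, one argument at a time.\<close>

lemma bilinear_eq_on_lattice:
  fixes f g :: "'a \<Rightarrow> 'a \<Rightarrow> real"
  assumes f: "bilinear f" and g: "bilinear g" and eq: "\<And>m n. m \<in> \<Lambda> \<Longrightarrow> n \<in> \<Lambda> \<Longrightarrow> f m n = g m n"
  shows "f x y = g x y"
proof -
  have 1: "f x b = g x b" if "b \<in> \<Lambda>" for x b
  proof -
    have "x \<in> {x. f x b = g x b}"
      by (rule additive_subset_eq_UNIV)
        (use f g eq that lattice_basis in \<open>auto simp: bilinear_ladd bilinear_lmul bilinear_lzero\<close>)
    then show ?thesis by simp
  qed
  have "y \<in> {y. f x y = g x y}"
    by (rule additive_subset_eq_UNIV)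
      (use f g 1 lattice_basis in \<open>auto simp: bilinear_radd bilinear_rmul bilinear_rzero\<close>)
  then show ?thesis by simp
qed

section \<open>The torus\<close>

abbreviation "\<T> \<equiv> torus \<Lambda>"
abbreviation "Exp \<equiv> torus_exp \<Lambda>"

section \<open>The tensor product by generators and relations\<close>

abbreviation "frags \<equiv> free_Abelian_group (\<Lambda> \<times> carrier circle_group)"
abbreviation "rels \<equiv> tensor_rels (additive_group \<Lambda>) circle_group"
abbreviation "pure \<equiv> pure_tensor (additive_group \<Lambda>) circle_group"

definition cls :: "('a \<times> complex \<Rightarrow>\<^sub>0 int) \<Rightarrow> 'a torus_elt" where
  "cls c = rels #>\<^bsub>frags\<^esub> c"

lemma carrier_additive_group [simp]: "carrier (additive_group S) = S"
  by (simp add: additive_group_def)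

lemma generators_subset:
  "{frag_of (g \<otimes>\<^bsub>additive_group \<Lambda>\<^esub> g', h) - frag_of (g, h) - frag_of (g', h) | g g' h.
         g \<in> carrier (additive_group \<Lambda>) \<and> g' \<in> carrier (additive_group \<Lambda>) \<and> h \<in> carrier circle_group} \<union>
      {frag_of (g, h \<otimes>\<^bsub>circle_group\<^esub> h') - frag_of (g, h) - frag_of (g, h') | g h h'.
         g \<in> carrier (additive_group \<Lambda>) \<and> h \<in> carrier circle_group \<and> h' \<in> carrier circle_group}
   \<subseteq> carrier frags"
proof -
  have "Poly_Mapping.keys (frag_of a - frag_of b - frag_of c) \<subseteq> S" if "a \<in> S" "b \<in> S" "c \<in> S"
    for a b c :: "'a \<times> complex" and S
    using keys_diff[of "frag_of a - frag_of b" "frag_of c"] keys_diff[of "frag_of a" "frag_of b"] that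
    by (auto simp: keys_frag_of)
  then show ?thesis
    by (auto simp: lattice_add additive_group_def circle_group_def norm_mult)
qed

lemma subgroup_rels: "subgroup rels frags"
  unfolding tensor_rels_def carrier_additive_group
  by (rule group.generate_is_subgroup) (use generators_subset in simp_all)

lemma normal_rels: "rels \<lhd> frags"
  by (rule comm_group.subgroup_imp_normal[OF abelian_free_Abelian_group subgroup_rels])

lemma rels_closed: "0 \<in> rels" "c \<in> rels \<Longrightarrow> d \<in> rels \<Longrightarrow> c + d \<in> rels" "c \<in> rels \<Longrightarrow> - c \<in> rels"
  using subgroup.one_closed[OF subgroup_rels] subgroup.m_closed[OF subgroup_rels, of c d]
    subgroup.m_inv_closed[OF subgroup_rels, of c] subgroup.mem_carrier[OF subgroup_rels, of c]
  by simp_all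

lemma rels_add_left: "m \<in> \<Lambda> \<Longrightarrow> m' \<in> \<Lambda> \<Longrightarrow> cmod z = 1 \<Longrightarrow>
    frag_of (m + m', z) - frag_of (m, z) - frag_of (m', z) \<in> rels"
  unfolding tensor_rels_def
  by (rule generate.incl, rule UnI1) (fastforce simp: additive_group_def)

lemma rels_mult_right: "m \<in> \<Lambda> \<Longrightarrow> cmod z = 1 \<Longrightarrow> cmod z' = 1 \<Longrightarrow>
    frag_of (m, z * z') - frag_of (m, z) - frag_of (m, z') \<in> rels"
  unfolding tensor_rels_def
  by (rule generate.incl, rule UnI2) (fastforce simp: additive_group_def circle_group_def)

lemma torus_eq: "\<T> = frags Mod rels"
  by (simp add: torus_def tensor_group_def)

lemma group_torus: "group \<T>"
  unfolding torus_eq by (rule normal.factorgroup_is_group[OF normal_rels])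

lemma carrier_torus: "carrier \<T> = cls ` carrier frags"
  unfolding torus_eq cls_def by (auto simp: FactGroup_def RCOSETS_def)

lemma cls_in_torus: "c \<in> carrier frags \<Longrightarrow> cls c \<in> carrier \<T>"
  unfolding carrier_torus by (rule imageI)

lemma cls_add:
  "c \<in> carrier frags \<Longrightarrow> d \<in> carrier frags \<Longrightarrow> cls c \<otimes>\<^bsub>\<T>\<^esub> cls d = cls (c + d)"
  unfolding torus_eq cls_def using normal.rcos_sum[OF normal_rels, of c d] by (simp add: FactGroup_def)

lemma cls_eq_iff:
  assumes "c \<in> carrier frags" "d \<in> carrier frags"
  shows "cls c = cls d \<longleftrightarrow> d - c \<in> rels"
proof
  assume "cls c = cls d"
  then have "d \<in> cls c"
    using group.rcos_self[OF group_free_Abelian_group assms(2) subgroup_rels] by (simp add: cls_def)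
  then show "d - c \<in> rels" by (auto simp: cls_def r_coset_def)
next
  assume "d - c \<in> rels"
  then have "d \<in> rels #>\<^bsub>frags\<^esub> c" by (force simp: r_coset_def)
  then show "cls c = cls d"
    unfolding cls_def using group.repr_independence[OF group_free_Abelian_group _ assms(1) subgroup_rels] by blast
qed

lemma one_torus: "\<one>\<^bsub>\<T>\<^esub> = cls 0"
proof -
  have "cls 0 \<otimes>\<^bsub>\<T>\<^esub> cls 0 = cls 0" "cls 0 \<in> carrier \<T>"
    using cls_add[of 0 0] by (auto simp: carrier_torus)
  then show ?thesis using group.r_cancel_one[OF group_torus, of "cls 0" "cls 0"] by simp
qed

lemma pure_eq_cls: "pure m z = cls (frag_of (m, z))"
  by (simp add: pure_tensor_def cls_def)

lemma frag_of_in_frags: "m \<in> \<Lambda> \<Longrightarrow> cmod z = 1 \<Longrightarrow> frag_of (m, z) \<in> carrier frags"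
  by simp

lemma zero_in_frags: "0 \<in> carrier frags"
  by simp

lemma add_in_frags: "c \<in> carrier frags \<Longrightarrow> d \<in> carrier frags \<Longrightarrow> c + d \<in> carrier frags"
  using keys_add[of c d] by auto

lemma pure_in_torus: "m \<in> \<Lambda> \<Longrightarrow> cmod z = 1 \<Longrightarrow> pure m z \<in> carrier \<T>"
  unfolding pure_eq_cls carrier_torus using frag_of_in_frags by blast

lemma pure_add:
  assumes "m \<in> \<Lambda>" "m' \<in> \<Lambda>" "cmod z = 1"
  shows "pure (m + m') z = pure m z \<otimes>\<^bsub>\<T>\<^esub> pure m' z"
proof -
  have 1: "frag_of (m, z) \<in> carrier frags" "frag_of (m', z) \<in> carrier frags"
    "frag_of (m + m', z) \<in> carrier frags"
    using assms by (auto intro: frag_of_in_frags lattice_add simp del: carrier_free_Abelian_group_iff)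
  have "cls (frag_of (m, z) + frag_of (m', z)) = cls (frag_of (m + m', z))"
    using rels_add_left[OF assms] by (simp add: cls_eq_iff[OF add_in_frags[OF 1(1,2)] 1(3)] algebra_simps)
  then show ?thesis by (simp only: pure_eq_cls cls_add[OF 1(1,2)])
qed

lemma pure_mult:
  assumes "m \<in> \<Lambda>" "cmod z = 1" "cmod z' = 1"
  shows "pure m (z * z') = pure m z \<otimes>\<^bsub>\<T>\<^esub> pure m z'"
proof -
  have 1: "frag_of (m, z) \<in> carrier frags" "frag_of (m, z') \<in> carrier frags"
    "frag_of (m, z * z') \<in> carrier frags"
    using assms by (auto intro: frag_of_in_frags simp: norm_mult simp del: carrier_free_Abelian_group_iff)
  have "cls (frag_of (m, z) + frag_of (m, z')) = cls (frag_of (m, z * z'))"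
    using rels_mult_right[OF assms] by (simp add: cls_eq_iff[OF add_in_frags[OF 1(1,2)] 1(3)] algebra_simps)
  then show ?thesis by (simp only: pure_eq_cls cls_add[OF 1(1,2)])
qed

lemma idempotent_torus: "s \<in> carrier \<T> \<Longrightarrow> s = s \<otimes>\<^bsub>\<T>\<^esub> s \<Longrightarrow> s = \<one>\<^bsub>\<T>\<^esub>"
  using group.r_cancel_one'[OF group_torus, of s s] by simp

lemma pure_1: "m \<in> \<Lambda> \<Longrightarrow> pure m 1 = \<one>\<^bsub>\<T>\<^esub>"
  using pure_mult[of m 1 1] by (intro idempotent_torus pure_in_torus) auto

text \<open>A representative of exp x in the free abelian group, obtained by writing x in the basis.
  Working with representatives turns equations in the torus into membership of explicit differences
  in \<open>rels\<close>.\<close>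

definition exp_cycle :: "'a \<Rightarrow> ('a \<times> complex \<Rightarrow>\<^sub>0 int)" where
  "exp_cycle x = (\<Sum>b\<in>B. frag_of (b, e2pi (coord x b)))"

lemma sum_in_frags: "(\<And>b. b \<in> B' \<Longrightarrow> f b \<in> carrier frags) \<Longrightarrow> sum f B' \<in> carrier frags"
  by (induction B' rule: infinite_finite_induct)
    (auto intro: add_in_frags zero_in_frags simp del: carrier_free_Abelian_group_iff)

lemma sum_in_rels: "(\<And>b. b \<in> B' \<Longrightarrow> f b \<in> rels) \<Longrightarrow> sum f B' \<in> rels"
  by (induction B' rule: infinite_finite_induct) (auto intro: rels_closed)

lemma exp_cycle_in_frags: "exp_cycle x \<in> carrier frags"
  unfolding exp_cycle_def by (intro sum_in_frags frag_of_in_frags lattice_basis) simp_all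

lemma exp_cycle_add: "cls (exp_cycle (x + y)) = cls (exp_cycle x) \<otimes>\<^bsub>\<T>\<^esub> cls (exp_cycle y)"
proof -
  have "exp_cycle (x + y) - (exp_cycle x + exp_cycle y) =
      (\<Sum>b\<in>B. frag_of (b, e2pi (coord x b) * e2pi (coord y b))
        - frag_of (b, e2pi (coord x b)) - frag_of (b, e2pi (coord y b)))"
    by (simp add: exp_cycle_def representation_linear e2pi_add sum_subtractf sum.distrib)
  also have "\<dots> \<in> rels" by (intro sum_in_rels rels_mult_right lattice_basis) simp_all
  finally have "cls (exp_cycle x + exp_cycle y) = cls (exp_cycle (x + y))"
    by (simp only: cls_eq_iff[OF add_in_frags[OF exp_cycle_in_frags exp_cycle_in_frags] exp_cycle_in_frags])
  then show ?thesis by (simp only: cls_add[OF exp_cycle_in_frags exp_cycle_in_frags])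
qed

lemma cls_exp_cycle_in_torus: "cls (exp_cycle x) \<in> carrier \<T>"
  unfolding carrier_torus using exp_cycle_in_frags by blast

text \<open>Two homomorphisms agree on a subgroup. This supplies the closure properties demanded by
  the generation lemmas for the lattice and for the vector space.\<close>

lemma hom_eq_additive:
  assumes f: "f \<in> hom (additive_group S) \<T>" and g: "g \<in> hom (additive_group S) \<T>"
    and S: "0 \<in> S" "\<And>x y. x \<in> S \<Longrightarrow> y \<in> S \<Longrightarrow> x + y \<in> S" "\<And>x y. x \<in> S \<Longrightarrow> y \<in> S \<Longrightarrow> x - y \<in> S"
  defines "A \<equiv> {x \<in> S. f x = g x}"
  shows "0 \<in> A" "\<And>x y. x \<in> A \<Longrightarrow> y \<in> A \<Longrightarrow> x + y \<in> A" "\<And>x y. x \<in> A \<Longrightarrow> y \<in> A \<Longrightarrow> x - y \<in> A"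
proof -
  have cl: "f x \<in> carrier \<T>" "g x \<in> carrier \<T>" if "x \<in> S" for x
    using f g that by (auto simp: hom_def Pi_iff)
  have add: "f (x + y) = f x \<otimes>\<^bsub>\<T>\<^esub> f y" "g (x + y) = g x \<otimes>\<^bsub>\<T>\<^esub> g y" if "x \<in> S" "y \<in> S" for x y
    using f g that by (auto simp: hom_def additive_group_def)
  have "f 0 = \<one>\<^bsub>\<T>\<^esub>" "g 0 = \<one>\<^bsub>\<T>\<^esub>"
    using add[of 0 0] cl[of 0] S(1) by (simp_all add: idempotent_torus)
  then show "0 \<in> A" using S(1) by (simp add: A_def)
  show "x + y \<in> A" if "x \<in> A" "y \<in> A" for x y
    using that add[of x y] S(2) by (simp add: A_def)
  show "x - y \<in> A" if "x \<in> A" "y \<in> A" for x y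
  proof -
    have xy: "x \<in> S" "y \<in> S" "x - y \<in> S" using that S(3) by (auto simp: A_def)
    have "f (x - y) \<otimes>\<^bsub>\<T>\<^esub> f y = f x" "g (x - y) \<otimes>\<^bsub>\<T>\<^esub> g y = g x"
      using add[OF xy(3,2)] by simp_all
    then have "f (x - y) \<otimes>\<^bsub>\<T>\<^esub> f y = g (x - y) \<otimes>\<^bsub>\<T>\<^esub> f y"
      using that by (simp add: A_def)
    then have "f (x - y) = g (x - y)"
      using group.right_cancel[OF group_torus] cl xy by simp
    with xy show ?thesis by (simp add: A_def)
  qed
qed

lemma exp_cycle_scaleR_basis:
  assumes "b \<in> B"
  shows "cls (exp_cycle (r *\<^sub>R b)) = pure b (e2pi r)"
proof -
  have "exp_cycle (r *\<^sub>R b) = (\<Sum>b'\<in>B. if b' = b then frag_of (b, e2pi r) else frag_of (b', 1))"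
    unfolding exp_cycle_def
    by (intro sum.cong refl) (auto simp: representation_linear representation_basis[OF independent_B] assms)
  also have "\<dots> = frag_of (b, e2pi r) + (\<Sum>b'\<in>B - {b}. frag_of (b', 1))"
    using assms finite_B by (simp add: sum.remove)
  finally have eq: "exp_cycle (r *\<^sub>R b) - frag_of (b, e2pi r) = (\<Sum>b'\<in>B - {b}. frag_of (b', 1))" by simp
  \<comment> \<open>Bilinearity in the circle variable with both factors 1 puts
    \<open>- frag_of (b', 1)\<close> among the relations.\<close>
  have "frag_of (b', 1) \<in> rels" if "b' \<in> B" for b'
    using rels_mult_right[of b' 1 1] rels_closed(3)[of "- frag_of (b', 1)"] lattice_basis[OF that] by simp
  then have "exp_cycle (r *\<^sub>R b) - frag_of (b, e2pi r) \<in> rels"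
    unfolding eq by (intro sum_in_rels) auto
  then have "cls (frag_of (b, e2pi r)) = cls (exp_cycle (r *\<^sub>R b))"
    by (simp only: cls_eq_iff[OF frag_of_in_frags[OF lattice_basis[OF assms] norm_e2pi] exp_cycle_in_frags])
  then show ?thesis by (simp only: pure_eq_cls)
qed

lemma exp_cycle_hom: "(\<lambda>x. cls (exp_cycle x)) \<in> hom (additive_group UNIV) \<T>"
  using cls_exp_cycle_in_torus exp_cycle_add by (auto simp: hom_def additive_group_def)

text \<open>For fixed \<open>r\<close> both sides are additive in \<open>m\<close>, so it is enough
  to compare them on the basis.\<close>

lemma exp_cycle_scaleR:
  assumes "m \<in> \<Lambda>"
  shows "cls (exp_cycle (r *\<^sub>R m)) = pure m (e2pi r)"
proof -
  have f: "(\<lambda>m. cls (exp_cycle (r *\<^sub>R m))) \<in> hom (additive_group \<Lambda>) \<T>"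
    using cls_exp_cycle_in_torus exp_cycle_add by (auto simp: hom_def additive_group_def scaleR_right_distrib)
  have g: "(\<lambda>m. pure m (e2pi r)) \<in> hom (additive_group \<Lambda>) \<T>"
    using pure_in_torus pure_add by (auto simp: hom_def) (auto simp: additive_group_def)
  have "\<Lambda> \<subseteq> {m \<in> \<Lambda>. cls (exp_cycle (r *\<^sub>R m)) = pure m (e2pi r)}"
    using hom_eq_additive[OF f g lattice_0 lattice_add lattice_diff]
    by (rule additive_subset_contains_lattice) (auto simp: lattice_basis exp_cycle_scaleR_basis)
  with assms show ?thesis by blast
qed

text \<open>Existence for the definite description is the explicit formula. Uniqueness holds because
  the prescribed values already fix a homomorphism on all real multiples of basis vectors.\<close>

lemma torus_exp_eq: "Exp = (\<lambda>x. cls (exp_cycle x))"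
  unfolding torus_exp_def
proof (rule the_equality)
  show "(\<lambda>x. cls (exp_cycle x)) \<in> hom (additive_group UNIV) \<T> \<and>
      (\<forall>r. \<forall>m\<in>\<Lambda>. cls (exp_cycle (r *\<^sub>R m)) = pure m (e2pi r))"
    using exp_cycle_hom exp_cycle_scaleR by blast
next
  fix f assume f: "f \<in> hom (additive_group UNIV) \<T> \<and>
      (\<forall>r. \<forall>m\<in>\<Lambda>. f (r *\<^sub>R m) = pure m (e2pi r))"
  have "x \<in> {x \<in> UNIV. f x = cls (exp_cycle x)}" for x
    using hom_eq_additive(1,2)[OF conjunct1[OF f] exp_cycle_hom]
    by (rule additive_subset_eq_UNIV) (use f exp_cycle_scaleR lattice_basis in auto)
  then show "f = (\<lambda>x. cls (exp_cycle x))" by auto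
qed

lemma torus_exp_closed: "Exp x \<in> carrier \<T>"
  by (simp add: torus_exp_eq cls_exp_cycle_in_torus)

lemma torus_exp_add: "Exp (x + y) = Exp x \<otimes>\<^bsub>\<T>\<^esub> Exp y"
  by (simp add: torus_exp_eq exp_cycle_add)

lemma torus_exp_0: "Exp 0 = \<one>\<^bsub>\<T>\<^esub>"
  using torus_exp_add[of 0 0] by (intro idempotent_torus torus_exp_closed) simp

lemma torus_exp_lattice: "m \<in> \<Lambda> \<Longrightarrow> Exp m = \<one>\<^bsub>\<T>\<^esub>"
  using exp_cycle_scaleR[of m 1] pure_1 e2pi_eq_1_iff[of 1] by (simp add: torus_exp_eq)

text \<open>The pairing of \<open>m \<otimes> z\<close> with the \<open>b\<close>-th coordinate functional, \<open>m \<otimes> z \<mapsto> z\<^bsup>m\<^sub>b\<^esup>\<close>, is well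
  defined on the tensor product; it detects the coordinates modulo \<open>\<int>\<close>.\<close>

lemma coordinate_character:
  assumes b: "b \<in> B"
  obtains \<chi>' :: "('a \<times> complex \<Rightarrow>\<^sub>0 int) \<Rightarrow> complex" where
    "\<And>c d. c \<in> carrier frags \<Longrightarrow> d \<in> carrier frags \<Longrightarrow> \<chi>' (c + d) = \<chi>' c * \<chi>' d"
    "\<And>m z. m \<in> \<Lambda> \<Longrightarrow> cmod z = 1 \<Longrightarrow> \<chi>' (frag_of (m, z)) = z powi \<lfloor>coord m b\<rfloor>"
    "\<And>c. c \<in> rels \<Longrightarrow> \<chi>' c = 1"
proof -
  \<comment> \<open>The floor only converts the coordinate, an integer for lattice vectors, into an
    exponent of type \<open>int\<close>; for the same reason it is additive on \<Lambda>.\<close>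
  define f where "f = (\<lambda>(m, z :: complex). z powi \<lfloor>coord m b\<rfloor>)"
  have "f ` (\<Lambda> \<times> carrier circle_group) \<subseteq> carrier circle_group"
    by (auto simp: f_def norm_power_int)
  then obtain h where h: "h \<in> hom frags circle_group"
    and hf: "\<And>x. x \<in> \<Lambda> \<times> carrier circle_group \<Longrightarrow> h (frag_of x) = f x"
    using comm_group.free_Abelian_group_universal[OF comm_group_circle] by metis
  have add: "h (c + d) = h c * h d" if "c \<in> carrier frags" "d \<in> carrier frags" for c d
    using hom_mult[OF h that] by (simp add: circle_group_def)
  have nz: "h c \<noteq> 0" if "c \<in> carrier frags" for c
    using hom_in_carrier[OF h that] by auto
  have pair: "h (frag_of (m, z)) = z powi \<lfloor>coord m b\<rfloor>" if "m \<in> \<Lambda>" "cmod z = 1" for m z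
    using hf[of "(m, z)"] that by (simp add: f_def)
  have gen: "h (frag_of x - frag_of y - frag_of z) = 1"
    if "x \<in> \<Lambda> \<times> carrier circle_group" "y \<in> \<Lambda> \<times> carrier circle_group" "z \<in> \<Lambda> \<times> carrier circle_group"
      "h (frag_of x) = h (frag_of y) * h (frag_of z)" for x y z
  proof -
    have fr: "frag_of x \<in> carrier frags" "frag_of y \<in> carrier frags" "frag_of z \<in> carrier frags"
      using that(1-3) by simp_all
    have "frag_of x - frag_of y - frag_of z \<in> carrier frags"
      using keys_diff[of "frag_of x - frag_of y" "frag_of z"] keys_diff[of "frag_of x" "frag_of y"] that(1-3)
      by (auto simp: keys_frag_of)
    from add[OF this add_in_frags[OF fr(2,3)]]
    have "h (frag_of x) = h (frag_of x - frag_of y - frag_of z) * (h (frag_of y) * h (frag_of z))"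
      using add[OF fr(2,3)] by simp
    then show ?thesis using that(4) nz[OF fr(2)] nz[OF fr(3)] by simp
  qed
  have "group_hom frags circle_group h"
    using h comm_group_circle by (simp add: group_hom_def group_hom_axioms_def comm_group_def)
  then have sub: "subgroup (kernel frags circle_group h) frags"
    by (rule group_hom.subgroup_kernel)
  have floor_add: "\<lfloor>coord (m + m') b\<rfloor> = \<lfloor>coord m b\<rfloor> + \<lfloor>coord m' b\<rfloor>"
    if "m \<in> \<Lambda>" "m' \<in> \<Lambda>" for m m'
    using that b by (auto simp: lattice_iff representation_linear elim!: Ints_cases dest!: bspec[of _ _ b])
  have "rels \<subseteq> kernel frags circle_group h"
    unfolding tensor_rels_def carrier_additive_group
  proof (rule group.generate_subgroup_incl[OF group_free_Abelian_group _ sub], rule subsetI)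
    fix c assume c: "c \<in> {frag_of (g \<otimes>\<^bsub>additive_group \<Lambda>\<^esub> g', h) - frag_of (g, h) - frag_of (g', h) | g g' h.
          g \<in> \<Lambda> \<and> g' \<in> \<Lambda> \<and> h \<in> carrier circle_group} \<union>
        {frag_of (g, h \<otimes>\<^bsub>circle_group\<^esub> h') - frag_of (g, h) - frag_of (g, h') | g h h'.
          g \<in> \<Lambda> \<and> h \<in> carrier circle_group \<and> h' \<in> carrier circle_group}" (is "c \<in> ?L \<union> ?R")
    then have "h c = 1"
    proof
      assume "c \<in> ?L"
      then obtain m m' z where c: "c = frag_of (m + m', z) - frag_of (m, z) - frag_of (m', z)"
        "m \<in> \<Lambda>" "m' \<in> \<Lambda>" "cmod z = 1" by (auto simp: additive_group_def)
      moreover have "z \<noteq> 0" using c(4) by auto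
      ultimately show "h c = 1"
        unfolding c(1) by (intro gen) (simp_all add: pair power_int_add lattice_add floor_add)
    next
      assume "c \<in> ?R"
      then obtain m z z' where c: "c = frag_of (m, z * z') - frag_of (m, z) - frag_of (m, z')"
        "m \<in> \<Lambda>" "cmod z = 1" "cmod z' = 1" by (auto simp: circle_group_def)
      then show "h c = 1"
        unfolding c(1) by (intro gen) (simp_all add: pair norm_mult power_int_mult_distrib)
    qed
    moreover have "c \<in> carrier frags"
      using c generators_subset unfolding carrier_additive_group by blast
    ultimately show "c \<in> kernel frags circle_group h" by (simp add: kernel_def circle_group_def)
  qed
  then have rel: "h c = 1" if "c \<in> rels" for c
    using that by (auto simp: kernel_def circle_group_def)
  show ?thesis by (rule that[OF add pair rel])
qed

text \<open>The character attached to \<open>b\<close> sends \<open>exp_cycle x\<close> to e2pi of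
  the \<open>b\<close>-th coordinate, since every other summand contributes a zeroth power. If the
  class is trivial, this value is 1, so each coordinate is an integer.\<close>

lemma torus_exp_eq_one_iff: "Exp x = \<one>\<^bsub>\<T>\<^esub> \<longleftrightarrow> x \<in> \<Lambda>"
proof
  assume *: "Exp x = \<one>\<^bsub>\<T>\<^esub>"
  have "0 \<in> carrier frags" by simp
  from cls_eq_iff[OF this exp_cycle_in_frags, of x] * have rel: "exp_cycle x \<in> rels"
    by (simp add: torus_exp_eq one_torus)
  have "coord x b \<in> \<int>" if b: "b \<in> B" for b
  proof -
    obtain h where h: "\<And>c d. c \<in> carrier frags \<Longrightarrow> d \<in> carrier frags \<Longrightarrow> h (c + d) = h c * h d"
      "\<And>m z. m \<in> \<Lambda> \<Longrightarrow> cmod z = 1 \<Longrightarrow> h (frag_of (m, z)) = z powi \<lfloor>coord m b\<rfloor>"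
      "\<And>c. c \<in> rels \<Longrightarrow> h c = 1"
      using coordinate_character[OF b] by metis
    have "h (\<Sum>b'\<in>B'. frag_of (b', e2pi (coord x b'))) =
        (\<Prod>b'\<in>B'. if b' = b then e2pi (coord x b) else 1)" if "B' \<subseteq> B" for B'
      using finite_subset[OF that finite_B] that
    proof (induction B' rule: finite_induct)
      case empty
      show ?case using h(3)[OF rels_closed(1)] by simp
    next
      case (insert b' B')
      have fr: "frag_of (b', e2pi (coord x b')) \<in> carrier frags"
        "(\<Sum>b'\<in>B'. frag_of (b', e2pi (coord x b'))) \<in> carrier frags"
        using insert.prems by (intro frag_of_in_frags sum_in_frags lattice_basis norm_e2pi; blast)+
      have b': "b' \<in> B" using insert.prems by simp
      have "h (frag_of (b', e2pi (coord x b'))) =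
          (if b' = b then e2pi (coord x b) else 1)"
        using h(2)[OF lattice_basis[OF b'] norm_e2pi] representation_basis[OF independent_B b'] by simp
      with insert show ?case by (auto simp: h(1)[OF fr])
    qed
    from this[OF subset_refl] have "h (exp_cycle x) = e2pi (coord x b)"
      using b finite_B by (simp add: exp_cycle_def)
    with h(3)[OF rel] show ?thesis by (simp add: e2pi_eq_1_iff)
  qed
  then show "x \<in> \<Lambda>" by (simp add: lattice_iff)
qed (rule torus_exp_lattice)

lemma torus_exp_eq_iff: "Exp x = Exp y \<longleftrightarrow> y - x \<in> \<Lambda>"
proof -
  have "Exp y = Exp (y - x) \<otimes>\<^bsub>\<T>\<^esub> Exp x"
    using torus_exp_add[of "y - x" x] by simp
  then have "Exp x = Exp y \<longleftrightarrow> Exp (y - x) = \<one>\<^bsub>\<T>\<^esub>"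
    using group.r_cancel_one'[OF group_torus torus_exp_closed torus_exp_closed, of x "y - x"] by simp
  then show ?thesis by (simp add: torus_exp_eq_one_iff)
qed

text \<open>A generator m \<otimes> e2pi r is the exponential of r m, and the range of a
  homomorphism is closed under differences. The carrier condition is carried through the induction
  because adding classes requires it.\<close>

lemma range_torus_exp: "range (Exp) = carrier \<T>"
proof
  show "range (Exp) \<subseteq> carrier \<T>" using torus_exp_closed by blast
  have "c \<in> carrier frags \<and> cls c \<in> range (Exp)" if "Poly_Mapping.keys c \<subseteq> \<Lambda> \<times> carrier circle_group" for c
    using that
  proof (induction c rule: frag_induction)
    case zero
    then show ?case using torus_exp_0 by (metis one_torus rangeI keys_zero empty_subsetI carrier_free_Abelian_group_iff)
  next
    case (one x)
    then obtain m z where x: "x = (m, z)" "m \<in> \<Lambda>" "cmod z = 1" by auto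
    then obtain r where "z = e2pi r" using e2pi_surj by blast
    then have "cls (frag_of x) = Exp (r *\<^sub>R m)"
      using exp_cycle_scaleR[OF x(2)] x(1) by (simp add: torus_exp_eq pure_eq_cls)
    then show ?case using x frag_of_in_frags[OF x(2,3)] by blast
  next
    case (diff a b)
    then obtain x y where xy: "cls a = Exp x" "cls b = Exp y"
      and fr: "a \<in> carrier frags" "b \<in> carrier frags" by blast
    have ab: "a - b \<in> carrier frags"
      using fr keys_diff[of a b] by auto
    have "cls (a - b) \<otimes>\<^bsub>\<T>\<^esub> cls b = Exp (x - y) \<otimes>\<^bsub>\<T>\<^esub> cls b"
      using cls_add[OF ab fr(2)] torus_exp_add[of "x - y" y] xy by simp
    then have "cls (a - b) = Exp (x - y)"
      using group.right_cancel[OF group_torus cls_in_torus[OF fr(2)] cls_in_torus[OF ab] torus_exp_closed] by simp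
    with ab show ?case by blast
  qed
  then show "carrier \<T> \<subseteq> range (Exp)" by (auto simp: carrier_torus)
qed

end

section \<open>The inertia groupoid of the categorical torus\<close>

text \<open>The vanishing of \<open>H\<^sup>2(\<int>, U(1))\<close>.\<close>

lemma cocycle_on_int_trivial:
  fixes c :: "int \<Rightarrow> int \<Rightarrow> complex"
  assumes norm_c: "\<And>a b. cmod (c a b) = 1" and v: "cmod v = 1"
    and cocycle: "\<And>a b d. c (a + b) d * c a b = c a (b + d) * c b d"
  shows "\<exists>w. w 1 = v \<and> (\<forall>a. cmod (w a) = 1) \<and> (\<forall>a b. w (a + b) = w a * w b * c a b)"
proof -
  have nz: "c a b \<noteq> 0" "v \<noteq> 0" for a b using norm_c[of a b] v by auto
  \<comment> \<open>The initial value is forced: the rule at (0, 1) reads w 1 = w 0 * w 1 * c 0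
    1.\<close>
  define wp where "wp = rec_nat (1 / c 0 1) (\<lambda>n x. x * v * c (int n) 1)"
  \<comment> \<open>The same recursion run backwards: w (-n) = w (-n-1) * v * c (-n-1) 1 is solved
    for w (-n-1).\<close>
  define wn where "wn = rec_nat (1 / c 0 1) (\<lambda>n x. x / (v * c (- int n - 1) 1))"
  define w where "w k = (if k \<ge> 0 then wp (nat k) else wn (nat (- k)))" for k :: int
  have w_neg: "w (- int n) = wn n" for n
    by (cases n) (simp_all add: w_def wn_def wp_def del: of_nat_Suc)
  have step: "w (k + 1) = w k * v * c k 1" for k
  proof (cases "k \<ge> 0")
    case True
    then have "nat (k + 1) = Suc (nat k)" by simp
    then show ?thesis using True by (simp add: w_def wp_def)
  next
    case False
    define n where "n = nat (- k - 1)"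
    have n: "k = - int (Suc n)" using False by (simp add: n_def)
    have k: "k + 1 = - int n" "- int n - 1 = k" using n by simp_all
    have "w (k + 1) = wn n" unfolding k(1) by (rule w_neg)
    moreover have "w k = wn (Suc n)" using w_neg[of "Suc n"] n by simp
    then have "w k = wn n / (v * c k 1)" by (simp add: wn_def k(2))
    ultimately show ?thesis using nz by simp
  qed
  have "cmod (wp n) = 1" "cmod (wn n) = 1" for n
    by (induction n) (simp_all add: wp_def wn_def norm_mult norm_divide norm_c v)
  then have norm_w: "cmod (w k) = 1" for k by (simp add: w_def)
  have w1: "w 1 = v" using step[of 0] nz by (simp add: w_def wp_def)
  \<comment> \<open>By construction the rule holds for \<open>b = 1\<close> and all
    \<open>a\<close>. The cocycle identity with last argument 1 propagates it from \<open>b\<close>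
    to \<open>b + 1\<close> and to \<open>b - 1\<close>.\<close>
  have "\<forall>a. w (a + b) = w a * w b * c a b" for b
  proof (induction b rule: int_induct[of _ 1])
    case base
    show ?case using step w1 by simp
  next
    case (step1 b)
    have "w (a + (b + 1)) = w a * w (b + 1) * c a (b + 1)" for a
    proof -
      have "w (a + (b + 1)) = w (a + b) * v * c (a + b) 1" using step[of "a + b"] by (simp add: add.assoc)
      also have "\<dots> = w a * w b * v * (c (a + b) 1 * c a b)" using step1 by simp
      also have "\<dots> = w a * (w b * v * c b 1) * c a (b + 1)" by (simp add: cocycle)
      finally show ?thesis by (simp add: step)
    qed
    then show ?case by blast
  next
    case (step2 b)
    have "w (a + (b - 1)) = w a * w (b - 1) * c a (b - 1)" for a
    proof -
      have "w (a + (b - 1)) * v * c (a + (b - 1)) 1 = w a * w b * c a b"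
        using step[of "a + (b - 1)"] step2 by simp
      also have "w b = w (b - 1) * v * c (b - 1) 1" using step[of "b - 1"] by simp
      also have "w a * (w (b - 1) * v * c (b - 1) 1) * c a b
          = w a * w (b - 1) * v * (c (a + (b - 1)) 1 * c a (b - 1))"
        using cocycle[of a "b - 1" 1] by simp
      finally have "w (a + (b - 1)) * (v * c (a + (b - 1)) 1)
          = w a * w (b - 1) * c a (b - 1) * (v * c (a + (b - 1)) 1)" by (simp add: mult_ac)
      then show ?thesis using nz by simp
    qed
    then show ?case by blast
  qed
  with w1 norm_w show ?thesis by blast
qed

text \<open>Uniqueness to match the existence just shown: the rule with \<open>b = 1\<close> steps
  up and down by a nonzero factor, so the value at 1 determines everything.\<close>

lemma twisted_homs_on_int_eq:
  fixes c :: "int \<Rightarrow> int \<Rightarrow> complex"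
  assumes w: "\<And>a b. w (a + b) = w a * w b * c a b" and w': "\<And>a b. w' (a + b) = w' a * w' b * c a b"
    and nz: "\<And>a. w a \<noteq> 0" "\<And>a. w' a \<noteq> 0" and 1: "w 1 = w' 1"
  shows "w = w'"
proof
  fix k
  have c: "c a 1 \<noteq> 0" for a using w[of a 1] nz(1)[of "a + 1"] by auto
  show "w k = w' k"
  proof (induction k rule: int_induct[of _ 1])
    case (step1 i)
    then show ?case using w[of i 1] w'[of i 1] 1 by simp
  next
    case (step2 i)
    have "w (i - 1) * (w 1 * c (i - 1) 1) = w' (i - 1) * (w 1 * c (i - 1) 1)"
      using w[of "i - 1" 1] w'[of "i - 1" 1] 1 step2 by (simp add: mult_ac)
    then show ?case using nz(1)[of 1] c by simp
  qed (rule 1)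
qed

locale cat_torus = lattice_basis B \<Lambda> for B \<Lambda> :: "'a::real_normed_vector set" +
  fixes J :: "'a \<Rightarrow> 'a \<Rightarrow> real"
  assumes bilinear_J: "bilinear J" and J_int: "\<And>m n. m \<in> \<Lambda> \<Longrightarrow> n \<in> \<Lambda> \<Longrightarrow> J m n \<in> \<int>"
begin

lemmas J_simps = bilinear_ladd[OF bilinear_J] bilinear_radd[OF bilinear_J]
  bilinear_lsub[OF bilinear_J] bilinear_rsub[OF bilinear_J]
  bilinear_lzero[OF bilinear_J] bilinear_rzero[OF bilinear_J]
  bilinear_lneg[OF bilinear_J] bilinear_rneg[OF bilinear_J]

lemma e2pi_J [simp]: "m \<in> \<Lambda> \<Longrightarrow> n \<in> \<Lambda> \<Longrightarrow> e2pi (J m n) = 1"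
  by (simp add: e2pi_eq_1_iff J_int)

abbreviation "CT \<equiv> categorical_torus \<Lambda> J"
abbreviation "IG \<equiv> inertia CT"

lemma CT_simps [simp]:
  "Obj CT = UNIV"
  "(x, m, w) \<in> Arr CT \<longleftrightarrow> m \<in> \<Lambda> \<and> cmod w = 1"
  "src CT (x, m, w) = x" "tgt CT (x, m, w) = x + m"
  "iden CT x = (x, 0, 1)"
  "cmp CT (x', m', w') (x, m, w) = (x, m + m', w * w')"
  "tenO CT x y = x + y"
  "tenA CT (x, m, w) (y, n, z) = (x + y, m + n, w * z * e2pi (J m y))"
  "unitO CT = 0"
  by (simp_all add: categorical_torus_def)

definition lab :: "'a ct_fun \<Rightarrow> int \<Rightarrow> int \<Rightarrow> complex" where
  "lab F a b = snd (snd (fmult F a b))"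

text \<open>The arrow \<open>fmult F a b\<close> runs from F a + F b to F(a + b), so its lattice
  component is forced by the objects and only its label is free. The defect vanishes for strict
  functors.\<close>

definition defect :: "'a ct_fun \<Rightarrow> int \<Rightarrow> int \<Rightarrow> 'a" where
  "defect F a b = fob F (a + b) - fob F a - fob F b"

definition unit_lab :: "'a ct_fun \<Rightarrow> complex" where
  "unit_lab F = snd (snd (funit F))"

text \<open>In the cocycle rule the factor with \<open>J\<close> comes from whiskering
  \<open>fmult F a b\<close> on the right by F d. Whiskering on the left by an identity contributes
  J(0, -) = 0, which explains the asymmetry.\<close>

lemma monoidal_funD:
  assumes "F \<in> monoidal_funs CT"
  shows "fmult F a b = (fob F a + fob F b, defect F a b, lab F a b)"
    and "defect F a b \<in> \<Lambda>" and "cmod (lab F a b) = 1"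
    and "funit F = (0, fob F 0, unit_lab F)" and "fob F 0 \<in> \<Lambda>" and "cmod (unit_lab F) = 1"
    and "lab F (a + b) d * lab F a b * e2pi (J (defect F a b) (fob F d)) = lab F a (b + d) * lab F b d"
    and "lab F a 0 * unit_lab F = 1"
proof -
  note F = assms[unfolded monoidal_funs_def mem_Collect_eq]
  have mult: "fmult F a b = (fob F a + fob F b, defect F a b, lab F a b)
      \<and> defect F a b \<in> \<Lambda> \<and> cmod (lab F a b) = 1" for a b
  proof -
    have 1: "fmult F a b \<in> Arr CT" "src CT (fmult F a b) = fob F a + fob F b"
      "tgt CT (fmult F a b) = fob F (a + b)" using F by simp_all
    obtain x m w where f: "fmult F a b = (x, m, w)" by (cases "fmult F a b")
    then have "x = fob F a + fob F b" "m \<in> \<Lambda>" "cmod w = 1" "x + m = fob F (a + b)"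
      using 1 by simp_all
    moreover from this have "m = defect F a b" by (simp add: defect_def algebra_simps)
    ultimately show ?thesis using f by (simp add: lab_def)
  qed
  then show m1: "fmult F a b = (fob F a + fob F b, defect F a b, lab F a b)"
    and "defect F a b \<in> \<Lambda>" "cmod (lab F a b) = 1" for a b by blast+
  have unit: "funit F = (0, fob F 0, unit_lab F) \<and> fob F 0 \<in> \<Lambda> \<and> cmod (unit_lab F) = 1"
  proof -
    have 1: "funit F \<in> Arr CT" "src CT (funit F) = 0" "tgt CT (funit F) = fob F 0" using F by simp_all
    obtain x m w where f: "funit F = (x, m, w)" by (cases "funit F")
    then show ?thesis using 1 by (simp add: unit_lab_def)
  qed
  then show u1: "funit F = (0, fob F 0, unit_lab F)" and "fob F 0 \<in> \<Lambda>" "cmod (unit_lab F) = 1" by blast+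
  have "cmp CT (fmult F (a + b) d) (tenA CT (fmult F a b) (iden CT (fob F d))) =
      cmp CT (fmult F a (b + d)) (tenA CT (iden CT (fob F a)) (fmult F b d))" using F by blast
  then show "lab F (a + b) d * lab F a b * e2pi (J (defect F a b) (fob F d)) = lab F a (b + d) * lab F b d"
    by (simp add: m1 J_simps mult_ac)
  have "cmp CT (fmult F a 0) (tenA CT (iden CT (fob F a)) (funit F)) = iden CT (fob F a)" using F by blast
  then show "lab F a 0 * unit_lab F = 1" by (simp add: m1 u1 J_simps mult_ac)
qed

lemma lab_nonzero: "F \<in> monoidal_funs CT \<Longrightarrow> lab F a b \<noteq> 0"
  using monoidal_funD(3)[of F a b] by force

text \<open>Both functors are additive on objects modulo \<Lambda>, so their difference is a
  multiple of its value at 1 modulo \<Lambda>.\<close>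

lemma fob_diff_in_lattice:
  assumes F: "F \<in> monoidal_funs CT" and G: "G \<in> monoidal_funs CT" and 1: "fob F 1 - fob G 1 \<in> \<Lambda>"
  shows "fob F a - fob G a \<in> \<Lambda>"
proof (induction a rule: int_induct[of _ 1])
  case (step1 a)
  have "fob F (a + 1) - fob G (a + 1) =
      (fob F a - fob G a) + (fob F 1 - fob G 1) + (defect F a 1 - defect G a 1)"
    by (simp add: defect_def algebra_simps)
  then show ?case
    using step1 1 monoidal_funD(2)[OF F] monoidal_funD(2)[OF G] by (simp add: lattice_add lattice_diff)
next
  case (step2 a)
  have "fob F (a - 1) - fob G (a - 1) =
      (fob F a - fob G a) - (fob F 1 - fob G 1) - (defect F (a - 1) 1 - defect G (a - 1) 1)"
    by (simp add: defect_def algebra_simps)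
  then show ?case
    using step2 1 monoidal_funD(2)[OF F] monoidal_funD(2)[OF G] by (simp add: lattice_add lattice_diff)
qed (rule 1)

text \<open>The naturality condition on a transformation \<open>F \<Rightarrow> G\<close> with object \<open>y\<close> says that its labels
  \<open>w\<close> satisfy \<open>w (a + b) = w a * w b * twist F G y a b\<close>.\<close>

definition twist :: "'a ct_fun \<Rightarrow> 'a ct_fun \<Rightarrow> 'a \<Rightarrow> int \<Rightarrow> int \<Rightarrow> complex" where
  "twist F G y a b = lab F a b * e2pi (J (fob F a - fob G a) (fob F b)) /
     (lab G a b * e2pi (J (defect G a b) y))"

definition transf_of :: "'a ct_fun \<Rightarrow> 'a ct_fun \<Rightarrow> 'a \<Rightarrow> (int \<Rightarrow> complex) \<Rightarrow> ('a, 'a \<times> 'a \<times> complex) transf" where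
  "transf_of F G y w = (y, \<lambda>a. (fob G a + y, fob F a - fob G a, w a))"

lemma norm_twist: "F \<in> monoidal_funs CT \<Longrightarrow> G \<in> monoidal_funs CT \<Longrightarrow> cmod (twist F G y a b) = 1"
  by (simp add: twist_def norm_mult norm_divide monoidal_funD)

text \<open>The failures of the two label functions to be cocycles are measured by \<alpha> and
  \<beta>, and the pairings \<open>X\<close> and \<open>X'\<close> compensate for them.
  \<open>Y = Y'\<close> because the defect is a coboundary.\<close>

lemma twist_cocycle:
  assumes F: "F \<in> monoidal_funs CT" and G: "G \<in> monoidal_funs CT" and 1: "fob F 1 - fob G 1 \<in> \<Lambda>"
  shows "twist F G y (a + b) d * twist F G y a b = twist F G y a (b + d) * twist F G y b d"
proof -
  define X where "X = J (fob F (a + b) - fob G (a + b)) (fob F d) + J (fob F a - fob G a) (fob F b)"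
  define X' where "X' = J (fob F a - fob G a) (fob F (b + d)) + J (fob F b - fob G b) (fob F d)"
  define Y where "Y = J (defect G (a + b) d) y + J (defect G a b) y"
  define Y' where "Y' = J (defect G a (b + d)) y + J (defect G b d) y"
  define \<alpha> where "\<alpha> = J (defect F a b) (fob F d)"
  define \<beta> where "\<beta> = J (defect G a b) (fob G d)"
  have "Y = Y'" by (simp add: Y_def Y'_def defect_def J_simps add.assoc)
  \<comment> \<open>What remains pairs lattice vectors with lattice vectors: defects and differences
    F - G.\<close>
  have "\<alpha> + X' - \<beta> - X = J (defect G a b) (fob F d - fob G d) + J (fob F a - fob G a) (defect F b d)"
    by (simp add: X_def X'_def \<alpha>_def \<beta>_def defect_def J_simps)
  also have "\<dots> \<in> \<int>"
    by (intro Ints_add J_int fob_diff_in_lattice[OF F G 1] monoidal_funD(2)[OF F] monoidal_funD(2)[OF G])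
  finally have "e2pi X = e2pi (\<alpha> + X' - \<beta>)" by (simp add: e2pi_eq_iff)
  then have X: "e2pi X * e2pi \<beta> = e2pi \<alpha> * e2pi X'" by (simp add: e2pi_add e2pi_diff)
  have L: "twist F G y (a + b) d * twist F G y a b =
      lab F (a + b) d * lab F a b * e2pi X / (lab G (a + b) d * lab G a b * e2pi Y)"
    by (simp add: twist_def X_def Y_def e2pi_add mult_ac)
  have R: "twist F G y a (b + d) * twist F G y b d =
      lab F a (b + d) * lab F b d * e2pi X' / (lab G a (b + d) * lab G b d * e2pi Y)"
    by (simp add: twist_def X'_def \<open>Y = Y'\<close> Y'_def e2pi_add mult_ac)
  have "lab F a (b + d) * lab F b d = lab F (a + b) d * lab F a b * e2pi \<alpha>"
    "lab G a (b + d) * lab G b d = lab G (a + b) d * lab G a b * e2pi \<beta>"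
    using monoidal_funD(7)[OF F] monoidal_funD(7)[OF G] by (simp_all add: \<alpha>_def \<beta>_def)
  then have "twist F G y a (b + d) * twist F G y b d =
      lab F (a + b) d * lab F a b * (e2pi \<alpha> * e2pi X') / (lab G (a + b) d * lab G a b * e2pi \<beta> * e2pi Y)"
    by (simp add: R mult.assoc)
  also have "\<dots> = lab F (a + b) d * lab F a b * e2pi X / (lab G (a + b) d * lab G a b * e2pi Y)"
    by (simp add: X[symmetric] mult.assoc)
  finally show ?thesis by (simp add: L)
qed

text \<open>With the components' source and lattice vector fixed, the condition on products is
  exactly the twisted rule for the labels. The unit condition then follows, and the lattice
  condition at 1 implies it at every integer.\<close>

lemma transf_of_in_transfs_iff:
  assumes F: "F \<in> monoidal_funs CT" and G: "G \<in> monoidal_funs CT"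
  shows "transf_of F G y w \<in> transfs CT F G \<longleftrightarrow> fob F 1 - fob G 1 \<in> \<Lambda> \<and> (\<forall>a. cmod (w a) = 1) \<and>
    (\<forall>a b. w (a + b) = w a * w b * twist F G y a b)"
proof -
  define \<sigma> where "\<sigma> = (\<lambda>a. (fob G a + y, fob F a - fob G a, w a))"
  define nat_at where "nat_at a b \<longleftrightarrow>
      cmp CT (\<sigma> (a + b)) (tenA CT (fmult G a b) (iden CT y)) =
      cmp CT (tenA CT (iden CT y) (fmult F a b))
        (cmp CT (tenA CT (\<sigma> a) (iden CT (fob F b))) (tenA CT (iden CT (fob G a)) (\<sigma> b)))" for a b
  define unit_at where "unit_at \<longleftrightarrow>
      cmp CT (\<sigma> 0) (tenA CT (funit G) (iden CT y)) = tenA CT (iden CT y) (funit F)"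
  have iff: "transf_of F G y w \<in> transfs CT F G \<longleftrightarrow>
      (\<forall>a. \<sigma> a \<in> Arr CT \<and> src CT (\<sigma> a) = fob G a + y \<and> tgt CT (\<sigma> a) = y + fob F a) \<and>
      (\<forall>a b. nat_at a b) \<and> unit_at"
    unfolding transf_of_def \<sigma>_def[symmetric] transfs_def nat_at_def unit_at_def mem_Collect_eq
      case_prod_conv CT_simps(1,7) by simp
  have arr: "\<sigma> a \<in> Arr CT \<and> src CT (\<sigma> a) = fob G a + y \<and> tgt CT (\<sigma> a) = y + fob F a \<longleftrightarrow>
      fob F a - fob G a \<in> \<Lambda> \<and> cmod (w a) = 1" for a
    by (simp add: \<sigma>_def)
  have nat: "nat_at a b \<longleftrightarrow> w (a + b) = w a * w b * twist F G y a b" for a b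
    using lab_nonzero[OF G, of a b]
    by (auto simp: nat_at_def \<sigma>_def monoidal_funD(1)[OF F] monoidal_funD(1)[OF G] J_simps twist_def
        defect_def field_simps)
  \<comment> \<open>Cancelling \<open>w 0\<close> in the rule at (0, 0) leaves w 0 * twist = 1.
    Since F 0 and G 0 are lattice vectors, one pairing is trivial, and what is left is the unit
    condition.\<close>
  have unit: unit_at
    if w0: "w 0 = w 0 * w 0 * twist F G y 0 0" "cmod (w 0) = 1" and 1: "fob F 1 - fob G 1 \<in> \<Lambda>"
  proof -
    have "w 0 \<noteq> 0" using w0(2) by auto
    then have 1: "w 0 * twist F G y 0 0 = 1" using w0(1) by simp
    have "J (fob F 0 - fob G 0) (fob F 0) \<in> \<int>"
      using monoidal_funD(5)[OF F] monoidal_funD(5)[OF G] by (intro J_int lattice_diff)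
    then have F0: "e2pi (J (fob F 0 - fob G 0) (fob F 0)) = 1" by (simp add: e2pi_eq_1_iff)
    have defect0: "e2pi (J (defect G 0 0) y) = inverse (e2pi (J (fob G 0) y))"
      by (simp add: defect_def J_simps e2pi_minus)
    have "lab F 0 0 = inverse (unit_lab F)" "lab G 0 0 = inverse (unit_lab G)"
      "unit_lab F \<noteq> 0" "unit_lab G \<noteq> 0"
      using monoidal_funD(8)[OF F, of 0] monoidal_funD(8)[OF G, of 0]
        inverse_unique[of "unit_lab F" "lab F 0 0"] inverse_unique[of "unit_lab G" "lab G 0 0"]
      by (auto simp: mult.commute)
    note labels = this
    have "w 0 * (inverse (unit_lab F) * 1 / (inverse (unit_lab G) * inverse (e2pi (J (fob G 0) y)))) = 1"
      using 1 unfolding twist_def labels(1,2) F0 defect0 .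
    then have "w 0 * unit_lab G * e2pi (J (fob G 0) y) = unit_lab F"
      using labels(3,4) by (simp add: field_simps)
    then show ?thesis
      by (simp add: unit_at_def \<sigma>_def monoidal_funD(4)[OF F] monoidal_funD(4)[OF G] J_simps mult_ac)
  qed
  show ?thesis
    unfolding iff arr nat
  proof
    assume *: "fob F 1 - fob G 1 \<in> \<Lambda> \<and> (\<forall>a. cmod (w a) = 1) \<and>
        (\<forall>a b. w (a + b) = w a * w b * twist F G y a b)"
    then have R: "w (a + b) = w a * w b * twist F G y a b" for a b by blast
    have "w 0 = w 0 * w 0 * twist F G y 0 0" using R[of 0 0] by simp
    then have unit_at using * by (intro unit) blast+
    with * fob_diff_in_lattice[OF F G]
    show "(\<forall>a. fob F a - fob G a \<in> \<Lambda> \<and> cmod (w a) = 1) \<and>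
        (\<forall>a b. w (a + b) = w a * w b * twist F G y a b) \<and> unit_at" by blast
  qed blast
qed

lemma transfs_cases:
  assumes "s \<in> transfs CT F G"
  obtains y w where "s = transf_of F G y w"
proof -
  obtain y \<sigma> where s: "s = (y, \<sigma>)" by (cases s)
  have "\<sigma> a = (fob G a + y, fob F a - fob G a, snd (snd (\<sigma> a)))" for a
  proof -
    obtain x m w where \<sigma>: "\<sigma> a = (x, m, w)" by (cases "\<sigma> a")
    have "src CT (\<sigma> a) = fob G a + y" "tgt CT (\<sigma> a) = y + fob F a"
      using assms by (simp_all add: transfs_def s)
    with \<sigma> have "x = fob G a + y" "x + m = y + fob F a" by simp_all
    then show ?thesis using \<sigma> by (simp add: algebra_simps)
  qed
  then have "\<sigma> = (\<lambda>a. (fob G a + y, fob F a - fob G a, snd (snd (\<sigma> a))))" by blast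
  then have "s = transf_of F G y (\<lambda>a. snd (snd (\<sigma> a)))" by (simp add: s transf_of_def)
  then show ?thesis by (rule that)
qed

text \<open>The label of a modification occurs on both sides of its defining equation and cancels in
  the commutative group U(1). Only its lattice vector, the difference of the objects,
  matters.\<close>

lemma modification_iff:
  assumes s: "transf_of F G y w \<in> transfs CT F G" and t: "transf_of F G y' w' \<in> transfs CT F G"
  shows "modifications CT F G (transf_of F G y w) (transf_of F G y' w') \<noteq> {} \<longleftrightarrow>
    y' - y \<in> \<Lambda> \<and> (\<forall>a. w' a = w a * e2pi (J (y' - y) (fob F a)))" (is "?M \<noteq> {} \<longleftrightarrow> ?R")
proof -
  have mod: "(x, n, u) \<in> ?M \<longleftrightarrow> x = y \<and> n = y' - y \<and> n \<in> \<Lambda> \<and> cmod u = 1 \<and>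
      (\<forall>a. w' a = w a * e2pi (J (y' - y) (fob F a)))" for x n u
  proof -
    have "cmod u = 1 \<Longrightarrow> u \<noteq> 0" by auto
    then show ?thesis
      by (auto simp: modifications_def transf_of_def J_simps mult_ac add_ac eq_diff_eq)
  qed
  show ?thesis
  proof
    assume "?M \<noteq> {}"
    then obtain \<mu> where "\<mu> \<in> ?M" by blast
    then show ?R using mod by (cases \<mu>) simp
  next
    assume ?R
    then have "(y, y' - y, 1) \<in> ?M" by (simp add: mod)
    then show "?M \<noteq> {}" by blast
  qed
qed

section \<open>Transformations in normal form: the object and the label at 1\<close>

definition labels :: "'a ct_fun \<Rightarrow> 'a ct_fun \<Rightarrow> 'a \<Rightarrow> complex \<Rightarrow> int \<Rightarrow> complex" where
  "labels F G y v = (SOME w. w 1 = v \<and> (\<forall>a. cmod (w a) = 1) \<and>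
     (\<forall>a b. w (a + b) = w a * w b * twist F G y a b))"

text \<open>The choice in \<open>labels\<close> is harmless: for a label \<open>v\<close> of modulus
  1 and functors whose values at 1 differ by a lattice vector, the solution exists and is
  unique.\<close>

definition TR :: "'a ct_fun \<Rightarrow> 'a ct_fun \<Rightarrow> 'a \<Rightarrow> complex \<Rightarrow> ('a, 'a \<times> 'a \<times> complex) transf" where
  "TR F G y v = transf_of F G y (labels F G y v)"

context
  fixes F G
  assumes F: "F \<in> monoidal_funs CT" and G: "G \<in> monoidal_funs CT" and FG: "fob F 1 - fob G 1 \<in> \<Lambda>"
begin

lemma labels:
  assumes "cmod v = 1"
  shows "labels F G y v 1 = v" "cmod (labels F G y v a) = 1"
    "labels F G y v (a + b) = labels F G y v a * labels F G y v b * twist F G y a b"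
proof -
  have "\<exists>w. w 1 = v \<and> (\<forall>a. cmod (w a) = 1) \<and> (\<forall>a b. w (a + b) = w a * w b * twist F G y a b)"
    by (rule cocycle_on_int_trivial[OF norm_twist[OF F G] assms twist_cocycle[OF F G FG]])
  from someI_ex[OF this, folded labels_def]
  show "labels F G y v 1 = v" "cmod (labels F G y v a) = 1"
    "labels F G y v (a + b) = labels F G y v a * labels F G y v b * twist F G y a b" by simp_all
qed

lemma TR_in_transfs: "cmod v = 1 \<Longrightarrow> TR F G y v \<in> transfs CT F G"
  unfolding TR_def transf_of_in_transfs_iff[OF F G] using FG labels by blast

lemma transf_of_eq_TR:
  assumes "\<And>a. cmod (w a) = 1" "\<And>a b. w (a + b) = w a * w b * twist F G y a b"
  shows "transf_of F G y w = TR F G y (w 1)"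
proof -
  have "w = labels F G y (w 1)"
  proof (rule twisted_homs_on_int_eq[of w "twist F G y"])
    show "w a \<noteq> 0" "labels F G y (w 1) a \<noteq> 0" for a
      using assms(1)[of a] labels(2)[OF assms(1)[of 1], of y a] by force+
  qed (use assms labels in auto)
  then show ?thesis by (simp add: TR_def)
qed

lemma transfs_eq_TR:
  assumes "s \<in> transfs CT F G"
  obtains y v where "cmod v = 1" "s = TR F G y v"
proof -
  obtain y w where s: "s = transf_of F G y w" using transfs_cases[OF assms] .
  with assms have "s = TR F G y (w 1)" "cmod (w 1) = 1"
    using transf_of_eq_TR by (auto simp: transf_of_in_transfs_iff[OF F G])
  then show ?thesis using that by blast
qed

text \<open>This evaluates the set of transformations used in \<open>strict_arr\<close>: it contains
  a single element, so the class formed there is that of one transformation.\<close>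

lemma transfs_with_label:
  assumes "cmod v = 1"
  shows "{s \<in> transfs CT F G. fst s = y \<and> snd s 1 = (fob G 1 + y, fob F 1 - fob G 1, v)} = {TR F G y v}"
proof -
  have "s = TR F G y v" if s: "s \<in> transfs CT F G" "fst s = y" "snd s 1 = (fob G 1 + y, fob F 1 - fob G 1, v)" for s
  proof -
    obtain y' v' where "cmod v' = 1" "s = TR F G y' v'" using transfs_eq_TR[OF s(1)] .
    then show ?thesis using s(2,3) labels(1)[of v' y'] by (simp add: TR_def transf_of_def)
  qed
  moreover have "fst (TR F G y v) = y" "snd (TR F G y v) 1 = (fob G 1 + y, fob F 1 - fob G 1, v)"
    using labels(1)[OF assms, of y] by (simp_all add: TR_def transf_of_def)
  ultimately show ?thesis using TR_in_transfs[OF assms] by blast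
qed

text \<open>A modification must satisfy one equation for every integer, but the one at 1 implies the
  others: both sides are solutions of the same twisted rule, and such solutions are determined at
  1.\<close>

lemma transf_iso_TR_iff:
  assumes v: "cmod v = 1" "cmod v' = 1"
  shows "(TR F G y v, TR F G y' v') \<in> transf_iso CT F G \<longleftrightarrow>
    y' - y \<in> \<Lambda> \<and> v' = v * e2pi (J (y' - y) (fob F 1))"
proof -
  let ?w = "labels F G y v" and ?w' = "labels F G y' v'"
  have in_transfs: "transf_of F G y ?w \<in> transfs CT F G" "transf_of F G y' ?w' \<in> transfs CT F G"
    using TR_in_transfs v by (simp_all add: TR_def)
  have "?w' a = ?w a * e2pi (J (y' - y) (fob F a))"
    if n: "y' - y \<in> \<Lambda>" and 1: "v' = v * e2pi (J (y' - y) (fob F 1))" for a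
  proof -
    \<comment> \<open>The object \<open>y\<close> enters the twist only through its pairing with the
      defect of \<open>G\<close>, a lattice vector, hence only modulo \<Lambda>.\<close>
    have tw: "twist F G y' a b = twist F G y a b" for a b
    proof -
      have "J (defect G a b) y' = J (defect G a b) y + J (defect G a b) (y' - y)" by (simp add: J_simps)
      then have "e2pi (J (defect G a b) y') = e2pi (J (defect G a b) y)"
        using n monoidal_funD(2)[OF G, of a b] by (simp add: e2pi_add)
      then show ?thesis by (simp add: twist_def)
    qed
    have shift: "e2pi (J (y' - y) (fob F (a + b))) = e2pi (J (y' - y) (fob F a)) * e2pi (J (y' - y) (fob F b))" for a b
    proof -
      have "J (y' - y) (fob F (a + b)) = J (y' - y) (fob F a) + J (y' - y) (fob F b) + J (y' - y) (defect F a b)"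
        by (simp add: defect_def J_simps)
      then show ?thesis using n monoidal_funD(2)[OF F, of a b] by (simp add: e2pi_add)
    qed
    have "?w' = (\<lambda>a. ?w a * e2pi (J (y' - y) (fob F a)))"
    proof (rule twisted_homs_on_int_eq[of _ "twist F G y"])
      show "?w' (a + b) = ?w' a * ?w' b * twist F G y a b" for a b
        using labels(3)[OF v(2), of y' a b] by (simp add: tw)
      show "?w (a + b) * e2pi (J (y' - y) (fob F (a + b))) =
          ?w a * e2pi (J (y' - y) (fob F a)) * (?w b * e2pi (J (y' - y) (fob F b))) * twist F G y a b" for a b
        by (simp add: labels(3)[OF v(1)] shift mult_ac)
      show "?w' a \<noteq> 0" "?w a * e2pi (J (y' - y) (fob F a)) \<noteq> 0" for a
        using labels(2)[OF v(1), of y a] labels(2)[OF v(2), of y' a] by force+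
      show "?w' 1 = ?w 1 * e2pi (J (y' - y) (fob F 1))"
        unfolding labels(1)[OF v(1)] labels(1)[OF v(2)] by (rule 1)
    qed
    then show ?thesis by (rule fun_cong)
  qed
  then show ?thesis
    using in_transfs modification_iff[OF in_transfs] labels(1)[OF v(1), of y] labels(1)[OF v(2), of y']
    unfolding transf_iso_def TR_def by (auto dest: spec[of _ 1])
qed

lemma equiv_transf_iso: "equiv (transfs CT F G) (transf_iso CT F G)"
proof (rule equivI)
  have iff: "(s, t) \<in> transf_iso CT F G \<longleftrightarrow> (\<exists>y v y' v'. s = TR F G y v \<and> t = TR F G y' v' \<and>
      cmod v = 1 \<and> cmod v' = 1 \<and> y' - y \<in> \<Lambda> \<and> v' = v * e2pi (J (y' - y) (fob F 1)))" for s t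
  proof
    assume st: "(s, t) \<in> transf_iso CT F G"
    then have "s \<in> transfs CT F G" "t \<in> transfs CT F G" by (simp_all add: transf_iso_def)
    then obtain y v y' v' where "cmod v = 1" "s = TR F G y v" "cmod v' = 1" "t = TR F G y' v'"
      using transfs_eq_TR by metis
    with st show "\<exists>y v y' v'. s = TR F G y v \<and> t = TR F G y' v' \<and>
      cmod v = 1 \<and> cmod v' = 1 \<and> y' - y \<in> \<Lambda> \<and> v' = v * e2pi (J (y' - y) (fob F 1))"
      using transf_iso_TR_iff by blast
  qed (use transf_iso_TR_iff in blast)
  show "transf_iso CT F G \<subseteq> transfs CT F G \<times> transfs CT F G" by (auto simp: transf_iso_def)
  show "refl_on (transfs CT F G) (transf_iso CT F G)"
  proof (rule refl_onI)
    fix s assume "s \<in> transfs CT F G"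
    then obtain y v where "cmod v = 1" "s = TR F G y v" using transfs_eq_TR by metis
    then show "(s, s) \<in> transf_iso CT F G" by (simp add: transf_iso_TR_iff lattice_0 J_simps)
  qed
  show "sym (transf_iso CT F G)"
  proof (rule symI)
    fix s t assume "(s, t) \<in> transf_iso CT F G"
    then obtain y v y' v' where *: "s = TR F G y v" "t = TR F G y' v'" "cmod v = 1" "cmod v' = 1"
      "y' - y \<in> \<Lambda>" "v' = v * e2pi (J (y' - y) (fob F 1))" using iff by blast
    have "y - y' \<in> \<Lambda>" using *(5) lattice_minus[of "y' - y"] by simp
    moreover have "v = v' * e2pi (J (y - y') (fob F 1))"
      using *(6) by (simp add: mult.assoc e2pi_add[symmetric] J_simps)
    ultimately show "(t, s) \<in> transf_iso CT F G" using iff * by blast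
  qed
  show "trans (transf_iso CT F G)"
  proof (rule transI)
    fix s t r assume "(s, t) \<in> transf_iso CT F G" "(t, r) \<in> transf_iso CT F G"
    then obtain y v y' v' where *: "s = TR F G y v" "t = TR F G y' v'" "cmod v = 1" "cmod v' = 1"
      "y' - y \<in> \<Lambda>" "v' = v * e2pi (J (y' - y) (fob F 1))" and "r \<in> transfs CT F G"
      using iff unfolding transf_iso_def by blast
    then obtain y'' v'' where r: "cmod v'' = 1" "r = TR F G y'' v''" using transfs_eq_TR by metis
    then have "y'' - y' \<in> \<Lambda>" "v'' = v' * e2pi (J (y'' - y') (fob F 1))"
      using \<open>(t, r) \<in> transf_iso CT F G\<close> * by (simp_all add: transf_iso_TR_iff)
    moreover from this(1) have "y'' - y \<in> \<Lambda>" using *(5) lattice_add[of "y'' - y'" "y' - y"] by simp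
    ultimately show "(s, r) \<in> transf_iso CT F G"
      using * r by (simp add: transf_iso_TR_iff mult.assoc e2pi_add[symmetric] J_simps)
  qed
qed

end

text \<open>Whiskering the second transformation by \<open>y\<close> produces the extra factor with
  J(G a - H a, y). Once the composite labels are seen to satisfy the twisted rule for
  \<open>F\<close> and \<open>H\<close>, evaluation at 1 suffices. In that check the labels of
  \<open>G\<close> and the pairing of its defect with \<open>y\<close> cancel.\<close>

lemma transf_comp_TR:
  assumes F: "F \<in> monoidal_funs CT" and G: "G \<in> monoidal_funs CT" and H: "H \<in> monoidal_funs CT"
    and FG: "fob F 1 - fob G 1 \<in> \<Lambda>" and GH: "fob G 1 - fob H 1 \<in> \<Lambda>" and v: "cmod v = 1" "cmod v' = 1"
  shows "transf_comp CT (TR G H y' v') (TR F G y v) =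
    TR F H (y' + y) (v * v' * e2pi (J (fob G 1 - fob H 1) y))"
proof -
  let ?w = "labels F G y v" and ?w' = "labels G H y' v'"
  define w where "w a = ?w a * ?w' a * e2pi (J (fob G a - fob H a) y)" for a
  have FH: "fob F 1 - fob H 1 \<in> \<Lambda>" using lattice_add[OF FG GH] by simp
  have "transf_comp CT (TR G H y' v') (TR F G y v) = transf_of F H (y' + y) w"
    by (simp add: transf_comp_def TR_def transf_of_def fun_eq_iff w_def J_simps add_ac mult_ac)
  also have "\<dots> = TR F H (y' + y) (w 1)"
  proof (rule transf_of_eq_TR[OF F H FH])
    show "cmod (w a) = 1" for a
      by (simp add: w_def norm_mult labels(2)[OF F G FG v(1)] labels(2)[OF G H GH v(2)])
    fix a b
    define X where "X = J (fob F a - fob G a) (fob F b)"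
    define X' where "X' = J (fob G a - fob H a) (fob G b)"
    define Y where "Y = J (defect G a b) y"
    define Y' where "Y' = J (defect H a b) y'"
    \<comment> \<open>The twists for F, G and for G, H pair with F b and with G b; replacing one by
      the other costs J(G a - H a, F b - G b), an integer.\<close>
    have "e2pi (J (fob F a - fob H a) (fob F b)) = e2pi (X + X')"
    proof -
      have "X + X' - J (fob F a - fob H a) (fob F b) = - J (fob G a - fob H a) (fob F b - fob G b)"
        by (simp add: X_def X'_def J_simps)
      also have "\<dots> \<in> \<int>"
        by (intro Ints_minus J_int fob_diff_in_lattice[OF F G FG] fob_diff_in_lattice[OF G H GH])
      finally show ?thesis by (simp add: e2pi_eq_iff)
    qed
    then have tw: "twist F H (y' + y) a b =
        lab F a b * (e2pi X * e2pi X') / (lab H a b * e2pi (Y' + J (defect H a b) y))"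
      by (simp add: twist_def e2pi_add Y'_def J_simps)
    have Z: "J (fob G (a + b) - fob H (a + b)) y =
        J (fob G a - fob H a) y + J (fob G b - fob H b) y + (Y - J (defect H a b) y)"
      by (simp add: Y_def defect_def J_simps)
    have "w (a + b) = (?w a * ?w b * (lab F a b * e2pi X / (lab G a b * e2pi Y))) *
        (?w' a * ?w' b * (lab G a b * e2pi X' / (lab H a b * e2pi Y'))) *
        (e2pi (J (fob G a - fob H a) y) * e2pi (J (fob G b - fob H b) y) * (e2pi Y / e2pi (J (defect H a b) y)))"
      unfolding w_def Z labels(3)[OF F G FG v(1)] labels(3)[OF G H GH v(2)] twist_def
      by (simp add: X_def X'_def Y_def Y'_def e2pi_add e2pi_diff)
    also have "\<dots> = w a * w b * twist F H (y' + y) a b"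
      unfolding tw using lab_nonzero[OF G, of a b] by (simp add: w_def e2pi_add field_simps)
    finally show "w (a + b) = w a * w b * twist F H (y' + y) a b" .
  qed
  also have "w 1 = v * v' * e2pi (J (fob G 1 - fob H 1) y)"
    by (simp add: w_def labels(1)[OF F G FG v(1)] labels(1)[OF G H GH v(2)])
  finally show ?thesis .
qed

lemma transf_id_TR:
  assumes F: "F \<in> monoidal_funs CT"
  shows "transf_id CT F = TR F F 0 1"
proof -
  have 0: "fob F 1 - fob F 1 \<in> \<Lambda>" by (simp add: lattice_0)
  have "transf_id CT F = transf_of F F 0 (\<lambda>_. 1)" by (simp add: transf_id_def transf_of_def)
  also have "\<dots> = TR F F 0 1"
    using lab_nonzero[OF F] by (intro transf_of_eq_TR[OF F F 0]) (simp_all add: twist_def J_simps)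
  finally show ?thesis .
qed

end

text \<open>Composition in the inertia groupoid and in both models is the saturation of the set of
  all composites of representatives. It is a single class as soon as this set is nonempty and lies
  within one class.\<close>

lemma equiv_Image_subset_class:
  assumes r: "equiv A r" and X: "X \<subseteq> r `` {a}" and x: "x \<in> X"
  shows "r `` X = r `` {a}"
proof -
  have "r `` {z} = r `` {a}" if "z \<in> X" for z
  proof -
    have "(a, z) \<in> r" using that X by blast
    then show ?thesis using equiv_class_eq[OF r] by blast
  qed
  moreover have "r `` X = (\<Union>z\<in>X. r `` {z})" by blast
  ultimately show ?thesis using x by auto
qed

section \<open>Arrows of the inertia groupoid and their composition\<close>

context cat_torus
begin

definition ar :: "'a ct_fun \<Rightarrow> 'a ct_fun \<Rightarrow> 'a \<Rightarrow> complex \<Rightarrow> 'a ct_inertia_arr" where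
  "ar F G y v = (F, G, transf_iso CT F G `` {TR F G y v})"

text \<open>This is the condition for some arrow from \<open>F\<close> to \<open>G\<close> to exist;
  the relation is an equivalence on monoidal functors.\<close>

definition composable :: "'a ct_fun \<Rightarrow> 'a ct_fun \<Rightarrow> bool" where
  "composable F G \<longleftrightarrow> F \<in> monoidal_funs CT \<and> G \<in> monoidal_funs CT \<and> fob F 1 - fob G 1 \<in> \<Lambda>"

lemma composable_refl: "F \<in> monoidal_funs CT \<Longrightarrow> composable F F"
  by (simp add: composable_def lattice_0)

lemma composable_sym: "composable F G \<Longrightarrow> composable G F"
  using lattice_minus[of "fob F 1 - fob G 1"] by (simp add: composable_def)

lemma composable_trans: "composable F G \<Longrightarrow> composable G H \<Longrightarrow> composable F H"
  using lattice_add[of "fob F 1 - fob G 1" "fob G 1 - fob H 1"] by (simp add: composable_def)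

lemma Arr_inertia_iff:
  "f \<in> Arr IG \<longleftrightarrow> (\<exists>F G y v. composable F G \<and> cmod v = 1 \<and> f = ar F G y v)"
proof
  assume "f \<in> Arr IG"
  then obtain F G K where f: "f = (F, G, K)" "F \<in> monoidal_funs CT" "G \<in> monoidal_funs CT"
    "K \<in> transfs CT F G // transf_iso CT F G" by (auto simp: inertia_def)
  then obtain s where s: "s \<in> transfs CT F G" "K = transf_iso CT F G `` {s}" by (auto elim: quotientE)
  then obtain y w where sw: "s = transf_of F G y w" using transfs_cases by metis
  have FG: "fob F 1 - fob G 1 \<in> \<Lambda>" using s(1) f(2,3) unfolding sw by (simp add: transf_of_in_transfs_iff)
  then obtain y v where "cmod v = 1" "s = TR F G y v" using transfs_eq_TR[OF f(2,3) FG s(1)] by metis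
  then show "\<exists>F G y v. composable F G \<and> cmod v = 1 \<and> f = ar F G y v"
    using f s FG by (auto simp: composable_def ar_def)
next
  assume "\<exists>F G y v. composable F G \<and> cmod v = 1 \<and> f = ar F G y v"
  then show "f \<in> Arr IG"
    using TR_in_transfs by (auto simp: composable_def ar_def inertia_def intro!: quotientI)
qed

lemma ar_eq_iff:
  assumes "composable F G" "cmod v = 1" "cmod v' = 1"
  shows "ar F G y v = ar F' G' y' v' \<longleftrightarrow>
    F = F' \<and> G = G' \<and> y' - y \<in> \<Lambda> \<and> v' = v * e2pi (J (y' - y) (fob F 1))"
proof -
  have *: "F \<in> monoidal_funs CT" "G \<in> monoidal_funs CT" "fob F 1 - fob G 1 \<in> \<Lambda>"
    using assms by (simp_all add: composable_def)
  have "ar F G y v = ar F G y' v' \<longleftrightarrow> y' - y \<in> \<Lambda> \<and> v' = v * e2pi (J (y' - y) (fob F 1))"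
    unfolding ar_def
    using eq_equiv_class_iff[OF equiv_transf_iso[OF *] TR_in_transfs[OF *] TR_in_transfs[OF *]]
      transf_iso_TR_iff[OF *] assms by simp
  moreover have "ar F G y v = ar F' G' y' v' \<Longrightarrow> F = F' \<and> G = G'" by (simp add: ar_def)
  ultimately show ?thesis by blast
qed

lemma inertia_simps:
  "Obj IG = monoidal_funs CT"
  "src IG (ar F G y v) = F" "tgt IG (ar F G y v) = G"
  by (simp_all add: inertia_def ar_def)

lemma inertia_iden: "F \<in> monoidal_funs CT \<Longrightarrow> iden IG F = ar F F 0 1"
  by (simp add: inertia_def ar_def transf_id_TR)

lemma inertia_cmp:
  assumes FG: "composable F G" and GH: "composable G H" and v: "cmod v = 1" "cmod v' = 1"
  shows "cmp IG (ar G H y' v') (ar F G y v) =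
    ar F H (y' + y) (v * v' * e2pi (J (fob G 1 - fob H 1) y))"
proof -
  note FG' = FG[unfolded composable_def] and GH' = GH[unfolded composable_def]
    and FH' = composable_trans[OF FG GH, unfolded composable_def]
  let ?u = "v * v' * e2pi (J (fob G 1 - fob H 1) y)"
  let ?X = "{transf_comp CT t s | s t. s \<in> transf_iso CT F G `` {TR F G y v} \<and> t \<in> transf_iso CT G H `` {TR G H y' v'}}"
  have eq: "equiv (transfs CT F H) (transf_iso CT F H)" using equiv_transf_iso FH' by blast
  have u: "cmod ?u = 1" by (simp add: norm_mult v)
  have "transf_comp CT t s \<in> transf_iso CT F H `` {TR F H (y' + y) ?u}"
    if s: "s \<in> transf_iso CT F G `` {TR F G y v}" and t: "t \<in> transf_iso CT G H `` {TR G H y' v'}" for s t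
  proof -
    have "s \<in> transfs CT F G" using s by (simp add: transf_iso_def)
    then obtain y1 v1 where s1: "cmod v1 = 1" "s = TR F G y1 v1" using transfs_eq_TR FG' by metis
    have "t \<in> transfs CT G H" using t by (simp add: transf_iso_def)
    then obtain y2 v2 where t1: "cmod v2 = 1" "t = TR G H y2 v2" using transfs_eq_TR GH' by metis
    have 1: "y1 - y \<in> \<Lambda>" "v1 = v * e2pi (J (y1 - y) (fob F 1))"
      using s s1 v FG' by (simp_all add: transf_iso_TR_iff)
    have 2: "y2 - y' \<in> \<Lambda>" "v2 = v' * e2pi (J (y2 - y') (fob G 1))"
      using t t1 v GH' by (simp_all add: transf_iso_TR_iff)
    have 3: "y2 + y1 - (y' + y) \<in> \<Lambda>" using lattice_add[OF 2(1) 1(1)] by (simp add: algebra_simps)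
    \<comment> \<open>Changing both representatives alters the label of the composite as a
      modification would, up to the two pairings of lattice vectors in the last bracket.\<close>
    have "J (y1 - y) (fob F 1) + J (y2 - y') (fob G 1) + J (fob G 1 - fob H 1) y1 =
        J (fob G 1 - fob H 1) y + J (y2 + y1 - (y' + y)) (fob F 1) +
        (J (fob G 1 - fob H 1) (y1 - y) - J (y2 - y') (fob F 1 - fob G 1))"
      by (simp add: J_simps)
    moreover have "J (fob G 1 - fob H 1) (y1 - y) - J (y2 - y') (fob F 1 - fob G 1) \<in> \<int>"
      using FG' GH' 1 2 by (intro Ints_diff J_int) auto
    ultimately have "e2pi (J (y1 - y) (fob F 1) + J (y2 - y') (fob G 1) + J (fob G 1 - fob H 1) y1) =
        e2pi (J (fob G 1 - fob H 1) y + J (y2 + y1 - (y' + y)) (fob F 1))"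
      by (simp add: e2pi_add e2pi_eq_1_iff[THEN iffD2])
    then have "v1 * v2 * e2pi (J (fob G 1 - fob H 1) y1) = ?u * e2pi (J (y2 + y1 - (y' + y)) (fob F 1))"
      unfolding 1(2) 2(2) by (simp add: e2pi_add mult_ac)
    moreover have "transf_comp CT t s = TR F H (y2 + y1) (v1 * v2 * e2pi (J (fob G 1 - fob H 1) y1))"
      unfolding s1(2) t1(2) using FG' GH' s1(1) t1(1) by (intro transf_comp_TR) auto
    moreover have "cmod (v1 * v2 * e2pi (J (fob G 1 - fob H 1) y1)) = 1" by (simp add: norm_mult s1 t1)
    ultimately show ?thesis
      using FH' 3 u transf_iso_TR_iff[of F H ?u "v1 * v2 * e2pi (J (fob G 1 - fob H 1) y1)" "y' + y" "y2 + y1"] by simp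
  qed
  then have sub: "?X \<subseteq> transf_iso CT F H `` {TR F H (y' + y) ?u}" by blast
  have "TR F G y v \<in> transf_iso CT F G `` {TR F G y v}" "TR G H y' v' \<in> transf_iso CT G H `` {TR G H y' v'}"
    using FG' GH' v by (simp_all add: transf_iso_TR_iff lattice_0 J_simps)
  then obtain r where r: "r \<in> ?X" by blast
  have "transf_iso CT F H `` ?X = transf_iso CT F H `` {TR F H (y' + y) ?u}"
    by (rule equiv_Image_subset_class[OF eq sub r])
  then show ?thesis by (simp add: inertia_def ar_def)
qed

end

section \<open>Groupoid laws for the inertia groupoid\<close>

context cat_torus
begin

lemma bounded_bilinear_J: "bounded_bilinear J"
  by (rule bounded_bilinear_of_bilinear[OF bilinear_J])

lemmas smooth_J = smooth_bounded_bilinear[OF bounded_bilinear_J]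
lemmas continuous_on_J = bounded_bilinear.continuous_on[OF bounded_bilinear_J]

lemma closed_discrete_lattice: "closed_discrete \<Lambda>"
  using closed_lattice discrete_lattice by (simp add: closed_discrete_def)

lemma finite_spanning: "\<exists>B::'a set. finite B \<and> span B = UNIV"
  using finite_B span_B by blast

lemma finite_spanning_triple: "\<exists>B::('a \<times> 'a \<times> real) set. finite B \<and> span B = UNIV"
proof -
  have "(x::real) \<in> span {1}" for x using span_scale[OF span_base[of 1 "{1::real}"], of x] by simp
  then have "\<exists>B::real set. finite B \<and> span B = UNIV" by (intro exI[of _ "{1}"]) auto
  then show ?thesis by (intro finite_spanning_prod finite_spanning)
qed

lemma countable_basis_triple: "\<exists>D::('a \<times> 'a \<times> real) set set. countable D \<and> topological_basis D"
  by (intro countable_basis_prod countable_topological_basis) (rule ex_countable_basis)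

lemma is_groupoid_inertia: "is_groupoid IG"
proof (rule is_groupoidI)
  fix x assume "x \<in> Obj IG"
  then have x: "x \<in> monoidal_funs CT" by (simp add: inertia_simps)
  then have "ar x x 0 1 \<in> Arr IG"
    unfolding Arr_inertia_iff using composable_refl by (metis norm_one)
  then show "iden IG x \<in> Arr IG \<and> src IG (iden IG x) = x \<and>
      tgt IG (iden IG x) = x"
    by (simp add: inertia_iden[OF x] inertia_simps)
next
  fix f assume "f \<in> Arr IG"
  then obtain F G y v where f: "composable F G" "cmod v = 1" "f = ar F G y v"
    unfolding Arr_inertia_iff by blast
  then have F: "F \<in> monoidal_funs CT" and G: "G \<in> monoidal_funs CT" by (auto simp: composable_def)
  show "src IG f \<in> Obj IG" "tgt IG f \<in> Obj IG"
    using F G by (simp_all add: f(3) inertia_simps)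
  show "cmp IG f (iden IG (src IG f)) = f \<and>
      cmp IG (iden IG (tgt IG f)) f = f"
    using inertia_cmp[OF composable_refl[OF F] f(1) _ f(2), of 1 y 0]
      inertia_cmp[OF f(1) composable_refl[OF G] f(2), of 1 0 y]
    by (simp add: f(3) inertia_simps inertia_iden F G J_simps)
  have v: "v \<noteq> 0" using f(2) by auto
  \<comment> \<open>Obtained by solving v * u * e2pi (J (G 1 - F 1) y) = 1, the label of the
    composite with object - y + y = 0.\<close>
  let ?u = "inverse v * e2pi (J (fob F 1 - fob G 1) y)"
  let ?g = "ar G F (- y) ?u"
  have u: "cmod ?u = 1" by (simp add: norm_mult norm_inverse f(2))
  note GF = composable_sym[OF f(1)]
  have "cmp IG ?g f = ar F F 0 1"
    using inertia_cmp[OF f(1) GF f(2) u, of "- y" y] v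
    by (simp add: f(3) e2pi_add[symmetric] J_simps mult.assoc)
  moreover have "?u * v * e2pi (J (fob F 1 - fob G 1) (- y)) = 1"
    using v by (simp add: bilinear_rneg[OF bilinear_J] e2pi_minus field_simps)
  then have "cmp IG f ?g = ar G G 0 1"
    using inertia_cmp[OF GF f(1) u f(2), of y "- y"] by (simp add: f(3))
  moreover have "?g \<in> Arr IG" unfolding Arr_inertia_iff using GF u by blast
  ultimately show "\<exists>g\<in>Arr IG. src IG g = tgt IG f \<and>
      tgt IG g = src IG f \<and>
      cmp IG g f = iden IG (src IG f) \<and>
      cmp IG f g = iden IG (tgt IG f)"
    by (intro bexI[of _ ?g]) (simp_all add: f(3) inertia_simps inertia_iden F G)
next
  fix f g assume fA: "f \<in> Arr IG" and gA: "g \<in> Arr IG"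
    and gf: "src IG g = tgt IG f"
  obtain F G y v where f: "composable F G" "cmod v = 1" "f = ar F G y v"
    using fA unfolding Arr_inertia_iff by blast
  obtain G' H y' v' where g': "composable G' H" "cmod v' = 1" "g = ar G' H y' v'"
    using gA unfolding Arr_inertia_iff by blast
  then have "G' = G" using gf by (simp add: f(3) inertia_simps)
  with g' have g: "composable G H" "cmod v' = 1" "g = ar G H y' v'" by simp_all
  have gf: "cmp IG g f = ar F H (y' + y) (v * v' * e2pi (J (fob G 1 - fob H 1) y))"
    unfolding f(3) g(3) by (rule inertia_cmp[OF f(1) g(1) f(2) g(2)])
  have v'': "cmod (v * v' * e2pi (J (fob G 1 - fob H 1) y)) = 1" by (simp add: norm_mult f g)
  then show "cmp IG g f \<in> Arr IG \<and>
      src IG (cmp IG g f) = src IG f \<and>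
      tgt IG (cmp IG g f) = tgt IG g"
    unfolding gf Arr_inertia_iff using composable_trans[OF f(1) g(1)] by (auto simp: f(3) g(3) inertia_simps)
  fix h assume hA: "h \<in> Arr IG" and hg: "src IG h = tgt IG g"
  obtain H' K z u where h': "composable H' K" "cmod u = 1" "h = ar H' K z u"
    using hA unfolding Arr_inertia_iff by blast
  then have "H' = H" using hg by (simp add: g(3) inertia_simps)
  with h' have h: "composable H K" "cmod u = 1" "h = ar H K z u" by simp_all
  have hg: "cmp IG h g = ar G K (z + y') (v' * u * e2pi (J (fob H 1 - fob K 1) y'))"
    unfolding h(3) g(3) by (rule inertia_cmp[OF g(1) h(1) g(2) h(2)])
  have u'': "cmod (v' * u * e2pi (J (fob H 1 - fob K 1) y')) = 1" by (simp add: norm_mult h g)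
  have "cmp IG (cmp IG h g) f =
      ar F K (z + y' + y) (v * (v' * u * e2pi (J (fob H 1 - fob K 1) y')) * e2pi (J (fob G 1 - fob K 1) y))"
    unfolding hg unfolding f(3)
    by (rule inertia_cmp[OF f(1) composable_trans[OF g(1) h(1)] f(2) u''])
  also have "\<dots> = ar F K (z + (y' + y))
      (v * v' * e2pi (J (fob G 1 - fob H 1) y) * u * e2pi (J (fob H 1 - fob K 1) (y' + y)))"
  proof -
    have "J (fob H 1 - fob K 1) y' + J (fob G 1 - fob K 1) y =
        J (fob G 1 - fob H 1) y + J (fob H 1 - fob K 1) (y' + y)" by (simp add: J_simps)
    then have "e2pi (J (fob H 1 - fob K 1) y') * e2pi (J (fob G 1 - fob K 1) y) =
        e2pi (J (fob G 1 - fob H 1) y) * e2pi (J (fob H 1 - fob K 1) (y' + y))"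
      by (simp only: e2pi_add[symmetric])
    from arg_cong[OF this, of "\<lambda>z. v * v' * u * z"] show ?thesis by (simp only: mult_ac add.assoc)
  qed
  also have "\<dots> = cmp IG h (cmp IG g f)"
    unfolding gf unfolding h(3)
    by (rule inertia_cmp[OF composable_trans[OF f(1) g(1)] h(1) v'' h(2), symmetric])
  finally show "cmp IG (cmp IG h g) f = cmp IG h (cmp IG g f)" .
qed

subsection \<open>Strict monoidal functors\<close>

lemma fob_strict_fun [simp]: "fob (strict_fun x) a = of_int a *\<^sub>R x"
  by (simp add: strict_fun_def)

lemma strict_fun_eq_iff [simp]: "strict_fun x = strict_fun y \<longleftrightarrow> x = y"
proof
  assume "strict_fun x = strict_fun y"
  then have "fob (strict_fun x) 1 = fob (strict_fun y) 1" by simp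
  then show "x = y" by simp
qed simp

lemma strict_fun_monoidal: "strict_fun x \<in> monoidal_funs CT"
  by (auto simp: monoidal_funs_def strict_fun_def scaleR_left_distrib J_simps lattice_0)

lemma strict_monoidal_funs_eq: "strict_monoidal_funs CT = range strict_fun"
proof
  show "range strict_fun \<subseteq> strict_monoidal_funs CT"
    using strict_fun_monoidal by (auto simp: strict_monoidal_funs_def strict_fun_def scaleR_left_distrib)
  show "strict_monoidal_funs CT \<subseteq> range strict_fun"
  proof
    fix F assume "F \<in> strict_monoidal_funs CT"
    then have F: "\<And>a b. fob F (a + b) = fob F a + fob F b" "fob F 0 = 0"
      "\<And>a b. fmult F a b = (fob F (a + b), 0, 1)" "funit F = (0, 0, 1)"
      by (auto simp: strict_monoidal_funs_def)
    have "fob F a = of_int a *\<^sub>R fob F 1" for a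
    proof (induction a rule: int_induct[of _ 0])
      case (step1 a)
      then show ?case using F(1)[of a 1] by (simp add: scaleR_left_distrib)
    next
      case (step2 a)
      then show ?case using F(1)[of "a - 1" 1] by (simp add: scaleR_left_diff_distrib eq_diff_eq)
    qed (simp add: F(2))
    then have "fob F = (\<lambda>a. of_int a *\<^sub>R fob F 1)" by blast
    moreover from this F(3) have "fmult F = (\<lambda>a b. (of_int (a + b) *\<^sub>R fob F 1, 0, 1))"
      by (metis ext)
    ultimately have "F = strict_fun (fob F 1)"
      using F(4) by (intro zfun.equality) (simp_all add: strict_fun_def)
    then show "F \<in> range strict_fun" by blast
  qed
qed

lemma composable_strict: "composable (strict_fun x) (strict_fun y) \<longleftrightarrow> x - y \<in> \<Lambda>"
  by (simp add: composable_def strict_fun_monoidal)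

abbreviation "sarr \<equiv> strict_arr \<Lambda> J"

lemma strict_arr_eq_ar:
  assumes "m \<in> \<Lambda>"
  shows "sarr m (x, y, c) = ar (strict_fun x) (strict_fun (x - m)) y (e2pi c)"
proof -
  have "fob (strict_fun x) 1 - fob (strict_fun (x - m)) 1 \<in> \<Lambda>" using assms by simp
  from transfs_with_label[OF strict_fun_monoidal strict_fun_monoidal this norm_e2pi, of y c]
  show ?thesis by (simp add: strict_arr_def ar_def Let_def)
qed

abbreviation "SI \<equiv> strict_inertia \<Lambda> J"

lemma SI_simps:
  "Obj SI = range strict_fun" "src SI = src IG" "tgt SI = tgt IG"
  "iden SI = iden IG" "cmp SI = cmp IG"
  "atlas_Obj SI = local_inverse_atlas {strict_fun}"
  "atlas_Arr SI = local_inverse_atlas (sarr ` \<Lambda>)"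
  by (simp_all add: strict_inertia_def Let_def strict_monoidal_funs_eq)

lemma Arr_SI_iff:
  "f \<in> Arr SI \<longleftrightarrow> f \<in> Arr IG \<and> src IG f \<in> Obj SI \<and> tgt IG f \<in> Obj SI"
  by (simp add: strict_inertia_def Let_def)

lemma Arr_SI: "Arr SI = (\<Union>m\<in>\<Lambda>. range (sarr m))"
proof
  show "Arr SI \<subseteq> (\<Union>m\<in>\<Lambda>. range (sarr m))"
  proof
    fix f assume f: "f \<in> Arr SI"
    then obtain F G y v where *: "composable F G" "cmod v = 1" "f = ar F G y v"
      unfolding Arr_SI_iff Arr_inertia_iff by blast
    then obtain x z where FG: "F = strict_fun x" "G = strict_fun z"
      using f unfolding Arr_SI_iff by (auto simp: inertia_simps SI_simps)
    obtain c where "v = e2pi c" using e2pi_surj[OF *(2)] by blast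
    moreover have "x - z \<in> \<Lambda>" using *(1) unfolding FG composable_strict .
    ultimately have "f = sarr (x - z) (x, y, c)" by (simp add: strict_arr_eq_ar * FG)
    with \<open>x - z \<in> \<Lambda>\<close> show "f \<in> (\<Union>m\<in>\<Lambda>. range (sarr m))" by blast
  qed
  have "sarr m (x, y, c) \<in> Arr SI" if "m \<in> \<Lambda>" for m x y c
  proof -
    have "composable (strict_fun x) (strict_fun (x - m))" using that by (simp add: composable_strict)
    then have "ar (strict_fun x) (strict_fun (x - m)) y (e2pi c) \<in> Arr IG"
      unfolding Arr_inertia_iff using norm_e2pi by blast
    then show ?thesis unfolding Arr_SI_iff strict_arr_eq_ar[OF that] by (simp add: inertia_simps SI_simps)
  qed
  then show "(\<Union>m\<in>\<Lambda>. range (sarr m)) \<subseteq> Arr SI" by auto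
qed

lemma is_groupoid_SI: "is_groupoid SI"
proof (rule is_groupoidI)
  note X = is_groupoid_inertia[unfolded is_groupoid_def]
  have Obj: "x \<in> Obj IG" if "x \<in> Obj SI" for x
    using that strict_fun_monoidal by (auto simp: SI_simps inertia_simps)
  show "iden SI x \<in> Arr SI \<and> src SI (iden SI x) = x \<and> tgt SI (iden SI x) = x" if "x \<in> Obj SI" for x
    using X Obj[OF that] that unfolding Arr_SI_iff SI_simps(2-5) by simp
  show "src SI f \<in> Obj SI" "tgt SI f \<in> Obj SI" if "f \<in> Arr SI" for f
    using that unfolding Arr_SI_iff SI_simps(2-5) by blast+
  show "cmp SI g f \<in> Arr SI \<and> src SI (cmp SI g f) = src SI f \<and> tgt SI (cmp SI g f) = tgt SI g"
    if "f \<in> Arr SI" "g \<in> Arr SI" "src SI g = tgt SI f" for f g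
  proof -
    have "cmp IG g f \<in> Arr IG \<and> src IG (cmp IG g f) = src IG f \<and>
        tgt IG (cmp IG g f) = tgt IG g"
      using X that unfolding Arr_SI_iff SI_simps(2-5) by blast
    then show ?thesis using that unfolding Arr_SI_iff SI_simps(2-5) by simp
  qed
  show "cmp SI f (iden SI (src SI f)) = f \<and> cmp SI (iden SI (tgt SI f)) f = f" if "f \<in> Arr SI" for f
    using X that unfolding Arr_SI_iff SI_simps(2-5) by blast
  show "cmp SI (cmp SI h g) f = cmp SI h (cmp SI g f)"
    if "f \<in> Arr SI" "g \<in> Arr SI" "h \<in> Arr SI" "src SI g = tgt SI f" "src SI h = tgt SI g" for f g h
    using X that unfolding Arr_SI_iff SI_simps(2-5) by blast
  show "\<exists>g\<in>Arr SI. src SI g = tgt SI f \<and> tgt SI g = src SI f \<and>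
      cmp SI g f = iden SI (src SI f) \<and> cmp SI f g = iden SI (tgt SI f)" if "f \<in> Arr SI" for f
  proof -
    have f: "f \<in> Arr IG" using that unfolding Arr_SI_iff by blast
    obtain g where "g \<in> Arr IG" "src IG g = tgt IG f"
      "tgt IG g = src IG f"
      "cmp IG g f = iden IG (src IG f)"
      "cmp IG f g = iden IG (tgt IG f)"
      using groupoid_inverse[OF is_groupoid_inertia f] by blast
    then show ?thesis using that unfolding SI_simps(2-5) by (intro bexI[of _ g]) (simp_all add: Arr_SI_iff)
  qed
qed


section \<open>The Lie groupoid of strict monoidal functors\<close>

lemma smooth_quotient_strict_fun: "smooth_quotient strict_fun"
  by (rule smooth_quotientI[where D = "\<lambda>(x, y). y - x" and L = "{0}"])
    (auto intro!: closed_discrete_zero continuous_intros exI[of _ "\<lambda>x. x"] smooth_ident simp: case_prod_unfold)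

text \<open>The source and target recover \<open>x\<close> and \<open>m\<close>. Hence different
  lattice vectors index disjoint components, and within a component only the relation by
  modifications is left.\<close>

lemma strict_arr_eq_iff:
  assumes "m \<in> \<Lambda>" "m' \<in> \<Lambda>"
  shows "sarr m (x, y, c) = sarr m' (x', y', c') \<longleftrightarrow>
    m = m' \<and> x = x' \<and> y' - y \<in> \<Lambda> \<and> c' - c - J (y' - y) x \<in> \<int>"
proof -
  have "e2pi c' = e2pi c * e2pi (J (y' - y) x) \<longleftrightarrow> c' - c - J (y' - y) x \<in> \<int>"
    using e2pi_eq_iff[of "c + J (y' - y) x" c'] by (simp add: e2pi_add diff_diff_eq eq_commute)
  moreover have "composable (strict_fun x) (strict_fun (x - m))" using assms by (simp add: composable_strict)
  ultimately show ?thesis by (auto simp: strict_arr_eq_ar assms ar_eq_iff)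
qed

lemma smooth_quotient_strict_arr:
  assumes m: "m \<in> \<Lambda>"
  shows "smooth_quotient (sarr m)"
proof (rule smooth_quotientI)
  let ?D = "\<lambda>p :: ('a \<times> 'a \<times> real) \<times> ('a \<times> 'a \<times> real).
    (fst (snd p) - fst (fst p), fst (snd (snd p)) - fst (snd (fst p)),
      snd (snd (snd p)) - snd (snd (fst p)) - J (fst (snd (snd p)) - fst (snd (fst p))) (fst (fst p)))"
  show "continuous_on UNIV ?D" by (intro continuous_intros continuous_on_J)
  show "closed_discrete ({0} \<times> \<Lambda> \<times> (\<int> :: real set))"
    by (intro closed_discrete_Times closed_discrete_zero closed_discrete_lattice closed_discrete_Ints)
  fix e e' :: "'a \<times> 'a \<times> real"
  obtain x y c where e: "e = (x, y, c)" by (cases e)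
  obtain x' y' c' where e': "e' = (x', y', c')" by (cases e')
  show "sarr m e = sarr m e' \<longleftrightarrow> ?D (e, e') \<in> {0} \<times> \<Lambda> \<times> \<int>"
    by (auto simp: e e' strict_arr_eq_iff m)
  show "?D (e, e') = 0 \<longleftrightarrow> e = e'" by (auto simp: e e' zero_prod_def J_simps)
  assume "sarr m e = sarr m e'"
  then have "x = x' \<and> y' - y \<in> \<Lambda> \<and> c' - c - J (y' - y) x \<in> \<int>"
    unfolding e e' strict_arr_eq_iff[OF m m] by blast
  then have *: "x = x'" "y' - y \<in> \<Lambda>" "c' - c - J (y' - y) x \<in> \<int>" by blast+
  \<comment> \<open>Translation by the lattice vector y' - y, with the label adjusted by its pairing
    with the varying source; the constant integer at the end is what sends \<open>e\<close> exactly
    to \<open>e'\<close>.\<close>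
  let ?\<gamma> = "\<lambda>p :: 'a \<times> 'a \<times> real. (fst p, fst (snd p) + (y' - y),
    snd (snd p) + J (y' - y) (fst p) + (c' - c - J (y' - y) x))"
  have "smooth_on UNIV ?\<gamma>" by (intro smooth_intros smooth_J)
  moreover have "?\<gamma> e = e'" using *(1) by (simp add: e e')
  moreover have "sarr m (?\<gamma> p) = sarr m p" for p
  proof -
    obtain a b d where p: "p = (a, b, d)" by (cases p)
    have "sarr m (a, b, d) = sarr m (?\<gamma> (a, b, d))"
      using *(2,3) by (simp add: strict_arr_eq_iff m algebra_simps)
    then show ?thesis by (simp add: p)
  qed
  ultimately show "\<exists>\<gamma>. smooth_on UNIV \<gamma> \<and> \<gamma> e = e' \<and> (\<forall>p. sarr m (\<gamma> p) = sarr m p)"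
    by blast
qed

lemma presents_Obj_SI: "presents (atlas_Obj SI) {strict_fun}"
  unfolding SI_simps by (rule presents_local_inverse_atlas) (simp add: smooth_quotient_strict_fun)

lemma presents_Arr_SI: "presents (atlas_Arr SI) (sarr ` \<Lambda>)"
  unfolding SI_simps by (rule presents_local_inverse_atlas) (auto simp: smooth_quotient_strict_arr)

lemma src_strict_arr: "m \<in> \<Lambda> \<Longrightarrow> src SI (sarr m e) = strict_fun (fst e)"
  by (cases e) (simp add: strict_arr_eq_ar SI_simps inertia_simps)

lemma tgt_strict_arr: "m \<in> \<Lambda> \<Longrightarrow> tgt SI (sarr m e) = strict_fun (fst e - m)"
  by (cases e) (simp add: strict_arr_eq_ar SI_simps inertia_simps)

lemma cmp_strict_arr:
  assumes "m \<in> \<Lambda>" "m' \<in> \<Lambda>"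
  shows "cmp SI (sarr m' (x - m, y', c')) (sarr m (x, y, c)) =
    sarr (m + m') (x, y' + y, c + c' + J m' y)"
proof -
  have "composable (strict_fun x) (strict_fun (x - m))" "composable (strict_fun (x - m)) (strict_fun (x - m - m'))"
    using assms by (simp_all add: composable_strict)
  from inertia_cmp[OF this norm_e2pi norm_e2pi, of y' c' y c]
  show ?thesis using assms by (simp add: strict_arr_eq_ar SI_simps lattice_add e2pi_add diff_diff_eq)
qed

lemma iden_SI: "iden SI (strict_fun x) = sarr 0 (x, 0, 0)"
  by (simp add: strict_arr_eq_ar lattice_0 SI_simps inertia_iden strict_fun_monoidal)

lemma arr_inv_SI:
  assumes m: "m \<in> \<Lambda>"
  shows "arr_inv SI (sarr m (x, y, c)) = sarr (- m) (x - m, - y, J m y - c)"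
proof (rule arr_inv_eqI[OF is_groupoid_SI])
  have m': "- m \<in> \<Lambda>" using m by (simp add: lattice_minus)
  show "sarr m (x, y, c) \<in> Arr SI" "sarr (- m) (x - m, - y, J m y - c) \<in> Arr SI"
    unfolding Arr_SI using m m' by blast+
  show "src SI (sarr (- m) (x - m, - y, J m y - c)) = tgt SI (sarr m (x, y, c))"
    "tgt SI (sarr (- m) (x - m, - y, J m y - c)) = src SI (sarr m (x, y, c))"
    using m m' by (simp_all add: src_strict_arr tgt_strict_arr)
  show "cmp SI (sarr (- m) (x - m, - y, J m y - c)) (sarr m (x, y, c)) =
      iden SI (src SI (sarr m (x, y, c)))"
    using cmp_strict_arr[OF m m', of x "- y" "J m y - c" y c]
    by (simp add: src_strict_arr m iden_SI J_simps)
  show "cmp SI (sarr m (x, y, c)) (sarr (- m) (x - m, - y, J m y - c)) =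
      iden SI (tgt SI (sarr m (x, y, c)))"
    using cmp_strict_arr[OF m' m, of "x - m" y c "- y" "J m y - c"]
    by (simp add: tgt_strict_arr m iden_SI J_simps)
qed

text \<open>Covers source (\<open>d m = 0\<close>) and target (\<open>d m = m\<close>) together:
  moving the first coordinate along a line, with all else fixed, moves the source or target along
  the same line.\<close>

lemma submersion_strict_arr:
  assumes f: "\<And>m e. m \<in> \<Lambda> \<Longrightarrow> f (sarr m e) = strict_fun (fst e - d m)"
  shows "submersion_on (atlas_Arr SI) (atlas_Obj SI) (Arr SI) f"
proof -
  have "smooth_map_on (atlas_Arr SI) (atlas_Obj SI) (Arr SI) f"
  proof (rule smooth_map_onI[OF presents_Arr_SI presents_Obj_SI])
    fix p assume "p \<in> Arr SI"
    then obtain m e where m: "m \<in> \<Lambda>" "p = sarr m e" by (auto simp: Arr_SI)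
    have "smooth_on UNIV (\<lambda>e :: 'a \<times> 'a \<times> real. fst e - d m)" by (intro smooth_intros)
    with m show "lifts_at (sarr ` \<Lambda>) {strict_fun} (Arr SI) f p"
      by (intro lifts_at_globalI[where q = "sarr m" and r = strict_fun])
        (auto simp: f)
  qed
  then show ?thesis
    unfolding SI_simps(6)
  proof (rule submersion_onI[OF presents_Arr_SI])
    fix p r e v assume p: "p \<in> Arr SI" and r: "r \<in> {strict_fun}" "r e = f p"
    obtain m x y c where m: "m \<in> \<Lambda>" "p = sarr m (x, y, c)" using p by (auto simp: Arr_SI)
    then have "e = x - d m" using r by (simp add: f)
    have "smooth_on UNIV (\<lambda>t::real. (x + t *\<^sub>R v, y, c))" by (intro smooth_intros)
    moreover have "sarr m (x + t *\<^sub>R v, y, c) \<in> Arr SI" for t using m(1) by (auto simp: Arr_SI)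
    ultimately show "\<exists>q\<in>sarr ` \<Lambda>. \<exists>\<delta>. smooth_on UNIV \<delta> \<and> q (\<delta> 0) = p \<and>
        (\<forall>t::real. q (\<delta> t) \<in> Arr SI \<and> f (q (\<delta> t)) = r (e + t *\<^sub>R v))"
      using m r(1) \<open>e = x - d m\<close>
      by (intro bexI[of _ "sarr m"] exI[of _ "\<lambda>t. (x + t *\<^sub>R v, y, c)"]) (auto simp: f)
  qed
qed

lemma is_lie_groupoid_SI: "is_lie_groupoid SI"
  unfolding is_lie_groupoid_def
proof (intro conjI)
  show "is_groupoid SI" by (rule is_groupoid_SI)
  show "smooth_manifold (Obj SI) (atlas_Obj SI)"
    unfolding SI_simps(1,6)
    by (rule smooth_manifold_local_inverse_atlas)
      (use smooth_quotient_strict_fun finite_spanning countable_topological_basis in auto)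
  show "smooth_manifold (Arr SI) (atlas_Arr SI)"
    unfolding SI_simps(7)
  proof (rule smooth_manifold_local_inverse_atlas)
    show "smooth_quotient q" if "q \<in> sarr ` \<Lambda>" for q
      using that smooth_quotient_strict_arr by blast
    show "q = q'" if "q \<in> sarr ` \<Lambda>" "q' \<in> sarr ` \<Lambda>" "q e = q' e'" for q q' e e'
      using that by (cases e; cases e') (auto simp: strict_arr_eq_iff)
    show "countable (sarr ` \<Lambda>)" using countable_lattice by blast
    show "Arr SI = (\<Union>q\<in>sarr ` \<Lambda>. range q)" by (simp add: Arr_SI)
  qed (rule finite_spanning_triple countable_basis_triple)+
  show "submersion_on (atlas_Arr SI) (atlas_Obj SI) (Arr SI) (src SI)"
    by (rule submersion_strict_arr[where d = "\<lambda>_. 0"]) (simp add: src_strict_arr)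
  show "submersion_on (atlas_Arr SI) (atlas_Obj SI) (Arr SI) (tgt SI)"
    by (rule submersion_strict_arr[where d = "\<lambda>m. m"]) (rule tgt_strict_arr)
  show "smooth_map_on (atlas_Obj SI) (atlas_Arr SI) (Obj SI) (iden SI)"
  proof (rule smooth_map_onI[OF presents_Obj_SI presents_Arr_SI])
    fix p assume "p \<in> Obj SI"
    then obtain x where p: "p = strict_fun x" by (auto simp: SI_simps)
    have "smooth_on UNIV (\<lambda>x :: 'a. (x, 0 :: 'a, 0 :: real))" by (intro smooth_intros)
    then show "lifts_at {strict_fun} (sarr ` \<Lambda>) (Obj SI) (iden SI) p"
      by (intro lifts_at_globalI[where q = strict_fun and r = "sarr 0" and e = x])
        (auto simp: p iden_SI lattice_0)
  qed
  show "smooth_map_on (prod_atlas (atlas_Arr SI) (atlas_Arr SI)) (atlas_Arr SI)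
       {(g, f). g \<in> Arr SI \<and> f \<in> Arr SI \<and> src SI g = tgt SI f} (\<lambda>(g, f). cmp SI g f)" (is "smooth_map_on _ _ ?S _")
  proof (rule smooth_map_onI[OF presents_prod_atlas[OF presents_Arr_SI presents_Arr_SI] presents_Arr_SI])
    fix p assume "p \<in> ?S"
    then obtain m m' e e' where m: "m \<in> \<Lambda>" "m' \<in> \<Lambda>"
      and p: "p = map_prod (sarr m') (sarr m) (e', e)" by (auto simp: Arr_SI)
    let ?q = "map_prod (sarr m') (sarr m)"
    let ?g = "\<lambda>z :: ('a \<times> 'a \<times> real) \<times> ('a \<times> 'a \<times> real). (fst (snd z), fst (snd (fst z)) + fst (snd (snd z)),
      snd (snd (snd z)) + snd (snd (fst z)) + J m' (fst (snd (snd z))))"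
    have "smooth_on UNIV ?g" by (intro smooth_intros smooth_J)
    moreover have "(\<lambda>(g, f). cmp SI g f) (?q z) = sarr (m + m') (?g z)" if "?q z \<in> ?S" for z
    proof -
      obtain x y c x' y' c' where z: "z = ((x', y', c'), (x, y, c))" by (cases z) auto
      \<comment> \<open>Composability enters here: the lift ignores the first coordinate of the left
        factor, which is correct only on the fibre product.\<close>
      have "x' = x - m" using that m by (simp add: z src_strict_arr tgt_strict_arr)
      then show ?thesis using cmp_strict_arr[OF m] by (simp add: z)
    qed
    moreover have "?q \<in> {map_prod q r |q r. q \<in> sarr ` \<Lambda> \<and> r \<in> sarr ` \<Lambda>}"
      using m by blast
    moreover have "sarr (m + m') \<in> sarr ` \<Lambda>" using lattice_add[OF m] by blast
    ultimately show "lifts_at ({map_prod q r |q r. q \<in> sarr ` \<Lambda> \<and> r \<in> sarr ` \<Lambda>}) (sarr ` \<Lambda>) ?S (\<lambda>(g, f). cmp SI g f) p"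
      using p[symmetric] by (intro lifts_at_globalI)
  qed
  show "smooth_map_on (atlas_Arr SI) (atlas_Arr SI) (Arr SI) (arr_inv SI)"
  proof (rule smooth_map_onI[OF presents_Arr_SI presents_Arr_SI])
    fix p assume "p \<in> Arr SI"
    then obtain m e where m: "m \<in> \<Lambda>" "p = sarr m e" by (auto simp: Arr_SI)
    let ?g = "\<lambda>e :: 'a \<times> 'a \<times> real. (fst e - m, - fst (snd e), J m (fst (snd e)) - snd (snd e))"
    have "smooth_on UNIV ?g" by (intro smooth_intros smooth_J)
    moreover have "arr_inv SI (sarr m e) = sarr (- m) (?g e)" for e
      by (cases e) (simp add: arr_inv_SI m(1))
    ultimately show "lifts_at (sarr ` \<Lambda>) (sarr ` \<Lambda>) (Arr SI) (arr_inv SI) p"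
      using m lattice_minus[of m]
      by (intro lifts_at_globalI[where q = "sarr m" and r = "sarr (- m)" and e = e and g = ?g])
        auto
  qed
qed

end

section \<open>Lie groupoids equivalent to the inertia groupoid\<close>

text \<open>\<open>q (x, y, c)\<close> stands for \<open>[exp x, y, e2pi c]\<close> in model (i), where \<open>S = 0\<close>, and for
  \<open>[x, exp y, e2pi c]\<close> in model (ii), where \<open>S = I\<close>.\<close>

locale inertia_model = cat_torus B \<Lambda> J
  for B \<Lambda> :: "'a::real_normed_vector set" and J :: "'a \<Rightarrow> 'a \<Rightarrow> real" +
  fixes I S :: "'a \<Rightarrow> 'a \<Rightarrow> real"
    and H :: "('a torus_elt, 'g, 'a, 'a \<times> 'a \<times> real) lie_gpd"
    and q :: "'a \<times> 'a \<times> real \<Rightarrow> 'g"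
  assumes I_eq: "I x y = J x y + J y x"
    and bilinear_S: "bilinear S"
    and Obj_H: "Obj H = range (Exp)" and atlas_Obj_H: "atlas_Obj H = local_inverse_atlas {Exp}"
    and Arr_H: "Arr H = range q" and atlas_Arr_H: "atlas_Arr H = local_inverse_atlas {q}"
    and src_q: "src H (q (x, y, c)) = Exp x" and tgt_q: "tgt H (q (x, y, c)) = Exp x"
    and iden_H: "iden H (Exp x) = q (x, 0, 0)"
    and cmp_q: "cmp H (q (x, y, c)) (q (x, y', c')) = q (x, y + y', c + c')"
    and q_eq_iff: "q (x, y, c) = q (x', y', c') \<longleftrightarrow>
      x' - x \<in> \<Lambda> \<and> y' - y \<in> \<Lambda> \<and> (c' + S x' y') - (c + S x y) - I x (y' - y) \<in> \<int>"
begin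

lemmas S_simps = bilinear_ladd[OF bilinear_S] bilinear_radd[OF bilinear_S]
  bilinear_lsub[OF bilinear_S] bilinear_rsub[OF bilinear_S]
  bilinear_lzero[OF bilinear_S] bilinear_rzero[OF bilinear_S]
  bilinear_lneg[OF bilinear_S] bilinear_rneg[OF bilinear_S]

lemma bounded_bilinear_S: "bounded_bilinear S"
  by (rule bounded_bilinear_of_bilinear[OF bilinear_S])

lemmas smooth_S = smooth_bounded_bilinear[OF bounded_bilinear_S]
lemmas continuous_on_S = bounded_bilinear.continuous_on[OF bounded_bilinear_S]

text \<open>Changing the lift of the base point: the label absorbs the difference of the
  \<open>S\<close>-terms. For model (i) it stays fixed; for model (ii) this is the defining
  relation.\<close>

lemma q_shift: "x' - x \<in> \<Lambda> \<Longrightarrow> q (x, y, c) = q (x', y, c + S x y - S x' y)"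
  by (simp add: q_eq_iff I_eq J_simps lattice_0)

lemma Exp_eqD: "Exp x = Exp x' \<Longrightarrow> x' - x \<in> \<Lambda>"
  by (simp add: torus_exp_eq_iff)

text \<open>Composable arrows need not be given over the same lift \<open>x\<close>; smoothness of
  composition and functoriality require a formula for this case as well.\<close>

lemma cmp_q_shift:
  assumes "Exp x' = Exp x"
  shows "cmp H (q (x', y', c')) (q (x, y, c)) = q (x, y' + y, c' + c + S x' y' - S x y')"
proof -
  have "q (x', y', c') = q (x, y', c' + S x' y' - S x y')" by (rule q_shift[OF Exp_eqD[OF assms]])
  then show ?thesis by (simp add: cmp_q algebra_simps)
qed

lemma Arr_H_at:
  assumes "g \<in> Arr H" "src H g = Exp x"
  obtains y c where "g = q (x, y, c)"
proof -
  obtain x' y c where g: "g = q (x', y, c)" using assms(1) by (auto simp: Arr_H)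
  then have "Exp x' = Exp x" using assms(2) by (simp add: src_q)
  then have "g = q (x, y, c + S x' y - S x y)" unfolding g by (intro q_shift Exp_eqD)
  then show ?thesis by (rule that)
qed

lemma is_groupoid_H: "is_groupoid H"
proof (rule is_groupoidI)
  show "iden H x \<in> Arr H \<and> src H (iden H x) = x \<and> tgt H (iden H x) = x" if "x \<in> Obj H" for x
    using that by (auto simp: Obj_H iden_H src_q tgt_q Arr_H)
  fix f assume "f \<in> Arr H"
  then obtain x y c where f: "f = q (x, y, c)" by (auto simp: Arr_H)
  show "src H f \<in> Obj H" "tgt H f \<in> Obj H" by (simp_all add: f src_q tgt_q Obj_H)
  show "cmp H f (iden H (src H f)) = f \<and> cmp H (iden H (tgt H f)) f = f"
    by (simp add: f src_q tgt_q iden_H cmp_q)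
  show "\<exists>g\<in>Arr H. src H g = tgt H f \<and> tgt H g = src H f \<and>
      cmp H g f = iden H (src H f) \<and> cmp H f g = iden H (tgt H f)"
    by (intro bexI[of _ "q (x, - y, - c)"]) (simp_all add: f src_q tgt_q iden_H cmp_q Arr_H)
  fix g assume "g \<in> Arr H" and gf: "src H g = tgt H f"
  then obtain y' c' where g: "g = q (x, y', c')" using Arr_H_at unfolding f tgt_q by metis
  show "cmp H g f \<in> Arr H \<and> src H (cmp H g f) = src H f \<and> tgt H (cmp H g f) = tgt H g"
    by (simp add: f g cmp_q src_q tgt_q Arr_H)
  fix h assume "h \<in> Arr H" and "src H h = tgt H g"
  then obtain y'' c'' where h: "h = q (x, y'', c'')" using Arr_H_at unfolding g tgt_q by metis
  show "cmp H (cmp H h g) f = cmp H h (cmp H g f)"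
    by (simp add: f g h cmp_q add.assoc)
qed

lemma arr_inv_q: "arr_inv H (q (x, y, c)) = q (x, - y, - c)"
  by (rule arr_inv_eqI[OF is_groupoid_H]) (simp_all add: src_q tgt_q iden_H cmp_q Arr_H)

lemma smooth_quotient_Exp: "smooth_quotient Exp"
proof (rule smooth_quotientI[where D = "\<lambda>(x, y). y - x"])
  show "continuous_on UNIV (\<lambda>(x :: 'a, y). y - x)" by (auto simp: case_prod_unfold intro!: continuous_intros)
  show "closed_discrete \<Lambda>" by (rule closed_discrete_lattice)
  fix x y :: 'a
  show "Exp x = Exp y \<longleftrightarrow> (case (x, y) of (x, y) \<Rightarrow> y - x) \<in> \<Lambda>" by (simp add: torus_exp_eq_iff)
  show "(case (x, y) of (x, y) \<Rightarrow> y - x) = 0 \<longleftrightarrow> x = y" by auto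
  assume "Exp x = Exp y"
  then have "y - x \<in> \<Lambda>" by (rule Exp_eqD)
  then have "Exp (z + (y - x)) = Exp z" for z
    using lattice_minus[of "y - x"] by (simp add: torus_exp_eq_iff)
  moreover have "smooth_on UNIV (\<lambda>z. z + (y - x))" by (intro smooth_intros)
  moreover have "x + (y - x) = y" by simp
  ultimately show "\<exists>\<gamma>. smooth_on UNIV \<gamma> \<and> \<gamma> x = y \<and> (\<forall>z. Exp (\<gamma> z) = Exp z)" by blast
qed

lemma smooth_quotient_q: "smooth_quotient q"
proof (rule smooth_quotientI)
  \<comment> \<open>The last coordinate is the expression in \<open>q_eq_iff\<close> with I written
    out through J, so that its continuity follows from that of J and S.\<close>
  let ?D = "\<lambda>p :: ('a \<times> 'a \<times> real) \<times> ('a \<times> 'a \<times> real).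
    (fst (snd p) - fst (fst p), fst (snd (snd p)) - fst (snd (fst p)),
      (snd (snd (snd p)) + S (fst (snd p)) (fst (snd (snd p)))) - (snd (snd (fst p)) + S (fst (fst p)) (fst (snd (fst p))))
      - (J (fst (fst p)) (fst (snd (snd p)) - fst (snd (fst p))) + J (fst (snd (snd p)) - fst (snd (fst p))) (fst (fst p))))"
  show "continuous_on UNIV ?D" by (intro continuous_intros continuous_on_J continuous_on_S)
  show "closed_discrete (\<Lambda> \<times> \<Lambda> \<times> (\<int> :: real set))"
    by (intro closed_discrete_Times closed_discrete_lattice closed_discrete_Ints)
  fix e e' :: "'a \<times> 'a \<times> real"
  obtain x y c where e: "e = (x, y, c)" by (cases e)
  obtain x' y' c' where e': "e' = (x', y', c')" by (cases e')
  show "q e = q e' \<longleftrightarrow> ?D (e, e') \<in> \<Lambda> \<times> \<Lambda> \<times> \<int>"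
    by (simp only: e e' q_eq_iff I_eq fst_conv snd_conv mem_Times_iff)
  show "?D (e, e') = 0 \<longleftrightarrow> e = e'" by (auto simp: e e' zero_prod_def J_simps)
  assume "q e = q e'"
  then have *: "x' - x \<in> \<Lambda> \<and> y' - y \<in> \<Lambda> \<and> (c' + S x' y') - (c + S x y) - I x (y' - y) \<in> \<int>"
    unfolding e e' q_eq_iff .
  define k where "k = (c' + S x' y') - (c + S x y) - I x (y' - y)"
  \<comment> \<open>The last coordinate solves the relation for the new label: the old
    \<open>S\<close>-term is added, the new one subtracted, and the integer \<open>k\<close> is kept
    constant so that \<open>e\<close> goes to \<open>e'\<close>.\<close>
  let ?\<gamma> = "\<lambda>p :: 'a \<times> 'a \<times> real. (fst p + (x' - x), fst (snd p) + (y' - y),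
    snd (snd p) + S (fst p) (fst (snd p)) + (J (fst p) (y' - y) + J (y' - y) (fst p)) + k
      - S (fst p + (x' - x)) (fst (snd p) + (y' - y)))"
  have "k \<in> \<int>" using * by (simp add: k_def)
  have "smooth_on UNIV ?\<gamma>" by (intro smooth_intros smooth_J smooth_S)
  moreover have "?\<gamma> e = e'" by (simp add: e e' k_def I_eq)
  moreover have "q (?\<gamma> p) = q p" for p
  proof -
    obtain a b d where p: "p = (a, b, d)" by (cases p)
    have "q (a, b, d) = q (?\<gamma> (a, b, d))"
      using * \<open>k \<in> \<int>\<close> by (simp add: q_eq_iff I_eq)
    then show ?thesis by (simp add: p)
  qed
  ultimately show "\<exists>\<gamma>. smooth_on UNIV \<gamma> \<and> \<gamma> e = e' \<and> (\<forall>p. q (\<gamma> p) = q p)" by blast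
qed

lemma presents_Obj_H: "presents (atlas_Obj H) {Exp}"
  unfolding atlas_Obj_H by (rule presents_local_inverse_atlas) (simp add: smooth_quotient_Exp)

lemma presents_Arr_H: "presents (atlas_Arr H) {q}"
  unfolding atlas_Arr_H by (rule presents_local_inverse_atlas) (simp add: smooth_quotient_q)

lemma Exp_translate: "Exp x = Exp y \<Longrightarrow> Exp (x + z) = Exp (y + z)"
  by (simp add: torus_exp_eq_iff)

lemma smooth_lift_q_Exp:
  assumes f: "\<And>x y c. f (q (x, y, c)) = Exp x"
  shows "submersion_on (atlas_Arr H) (atlas_Obj H) (Arr H) f"
proof -
  have "smooth_map_on (atlas_Arr H) (atlas_Obj H) (Arr H) f"
  proof (rule smooth_map_onI[OF presents_Arr_H presents_Obj_H])
    fix p assume "p \<in> Arr H"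
    then obtain e where "q e = p" by (auto simp: Arr_H)
    moreover have "f (q e) = Exp (fst e)" for e by (cases e) (simp add: f)
    ultimately show "lifts_at {q} {Exp} (Arr H) f p"
      by (intro lifts_at_globalI[where q = q and r = Exp, OF _ _ _ smooth_fst[OF smooth_ident]]) simp_all
  qed
  then show ?thesis unfolding atlas_Obj_H
  proof (rule submersion_onI[OF presents_Arr_H])
    fix p r e v assume p: "p \<in> Arr H" and r: "r \<in> {Exp}" "r e = f p"
    obtain x y c where q: "p = q (x, y, c)" using p by (auto simp: Arr_H)
    have "smooth_on UNIV (\<lambda>t::real. (x + t *\<^sub>R v, y, c))" by (intro smooth_intros)
    moreover have "Exp (x + t *\<^sub>R v) = Exp (e + t *\<^sub>R v)" for t
      using r by (intro Exp_translate) (simp add: q f)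
    ultimately show "\<exists>q\<in>{q}. \<exists>\<delta>. smooth_on UNIV \<delta> \<and> q (\<delta> 0) = p \<and>
        (\<forall>t::real. q (\<delta> t) \<in> Arr H \<and> f (q (\<delta> t)) = r (e + t *\<^sub>R v))"
      using r(1) by (intro bexI[of _ q] exI[of _ "\<lambda>t. (x + t *\<^sub>R v, y, c)"]) (auto simp: f q Arr_H)
  qed
qed

lemma is_lie_groupoid_H: "is_lie_groupoid H"
  unfolding is_lie_groupoid_def
proof (intro conjI)
  show "is_groupoid H" by (rule is_groupoid_H)
  show "smooth_manifold (Obj H) (atlas_Obj H)"
    unfolding Obj_H atlas_Obj_H
    by (rule smooth_manifold_local_inverse_atlas)
      (use smooth_quotient_Exp finite_spanning countable_topological_basis in auto)
  show "smooth_manifold (Arr H) (atlas_Arr H)"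
    unfolding Arr_H atlas_Arr_H
    by (rule smooth_manifold_local_inverse_atlas)
      (use smooth_quotient_q finite_spanning_triple countable_basis_triple in auto)
  show "submersion_on (atlas_Arr H) (atlas_Obj H) (Arr H) (src H)"
    by (rule smooth_lift_q_Exp) (rule src_q)
  show "submersion_on (atlas_Arr H) (atlas_Obj H) (Arr H) (tgt H)"
    by (rule smooth_lift_q_Exp) (rule tgt_q)
  show "smooth_map_on (atlas_Obj H) (atlas_Arr H) (Obj H) (iden H)"
  proof (rule smooth_map_onI[OF presents_Obj_H presents_Arr_H])
    fix p assume "p \<in> Obj H"
    then obtain x where "Exp x = p" by (auto simp: Obj_H)
    moreover have "smooth_on UNIV (\<lambda>x :: 'a. (x, 0 :: 'a, 0 :: real))" by (intro smooth_intros)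
    ultimately show "lifts_at {Exp} {q} (Obj H) (iden H) p"
      by (intro lifts_at_globalI[where q = Exp and r = q]) (simp_all add: iden_H)
  qed
  show "smooth_map_on (prod_atlas (atlas_Arr H) (atlas_Arr H)) (atlas_Arr H)
       {(g, f). g \<in> Arr H \<and> f \<in> Arr H \<and> src H g = tgt H f} (\<lambda>(g, f). cmp H g f)" (is "smooth_map_on _ _ ?S _")
  proof (rule smooth_map_onI[OF presents_prod_atlas[OF presents_Arr_H presents_Arr_H] presents_Arr_H])
    fix p assume "p \<in> ?S"
    then obtain e e' where p: "map_prod q q (e', e) = p" by (auto simp: Arr_H)
    let ?g = "\<lambda>z :: ('a \<times> 'a \<times> real) \<times> ('a \<times> 'a \<times> real). (fst (snd z), fst (snd (fst z)) + fst (snd (snd z)),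
      snd (snd (fst z)) + snd (snd (snd z)) + S (fst (fst z)) (fst (snd (fst z))) - S (fst (snd z)) (fst (snd (fst z))))"
    have "smooth_on UNIV ?g" by (intro smooth_intros smooth_S)
    moreover have "(\<lambda>(g, f). cmp H g f) (map_prod q q z) = q (?g z)" if "map_prod q q z \<in> ?S" for z
    proof -
      obtain x y c x' y' c' where z: "z = ((x', y', c'), (x, y, c))" by (cases z) auto
      have "Exp x' = Exp x" using that by (simp add: z src_q tgt_q)
      then show ?thesis by (simp add: z cmp_q_shift)
    qed
    moreover have "map_prod q q \<in> {map_prod q' r |q' r. q' \<in> {q} \<and> r \<in> {q}}" "q \<in> {q}" by blast+
    ultimately show "lifts_at ({map_prod q' r |q' r. q' \<in> {q} \<and> r \<in> {q}}) {q} ?S (\<lambda>(g, f). cmp H g f) p"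
      using p by (intro lifts_at_globalI[where q = "map_prod q q" and r = q and g = ?g])
  qed
  show "smooth_map_on (atlas_Arr H) (atlas_Arr H) (Arr H) (arr_inv H)"
  proof (rule smooth_map_onI[OF presents_Arr_H presents_Arr_H])
    fix p assume "p \<in> Arr H"
    then obtain e where "q e = p" by (auto simp: Arr_H)
    moreover have "smooth_on UNIV (\<lambda>e :: 'a \<times> 'a \<times> real. (fst e, - fst (snd e), - snd (snd e)))"
      by (intro smooth_intros)
    moreover have "arr_inv H (q e) = q (fst e, - fst (snd e), - snd (snd e))" for e
      by (cases e) (simp add: arr_inv_q)
    ultimately show "lifts_at {q} {q} (Arr H) (arr_inv H) p"
      by (intro lifts_at_globalI[where q = q and r = q]) simp_all
  qed
qed

section \<open>The functor from the inertia groupoid to a model\<close>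

definition obj_map :: "'a ct_fun \<Rightarrow> 'a torus_elt" where
  "obj_map F = Exp (fob F 1)"

text \<open>An arrow is a class of transformations, so the value is selected through a
  representative. The term with \<open>J\<close> makes the label multiplicative; the term with
  \<open>S\<close> converts to the coordinates of the model.\<close>

definition arr_map :: "'a ct_inertia_arr \<Rightarrow> 'g" where
  "arr_map f = (SOME k. \<exists>F G y c. composable F G \<and> f = ar F G y (e2pi c) \<and>
     k = q (fob F 1, y, c + J (fob G 1) y - S (fob F 1) y))"

text \<open>One equivalence gives both that the functor is well defined and that it is faithful. The
  two integrality conditions differ by J(F 1 - G 1, y' - y), an integer because both arguments lie
  in the lattice.\<close>

lemma ar_eq_iff_q:
  assumes "composable F G"
  shows "ar F G y (e2pi c) = ar F G y' (e2pi c') \<longleftrightarrow>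
    q (fob F 1, y, c + J (fob G 1) y - S (fob F 1) y) = q (fob F 1, y', c' + J (fob G 1) y' - S (fob F 1) y')"
proof -
  let ?x = "fob F 1" and ?z = "fob G 1"
  have "e2pi c' = e2pi c * e2pi (J (y' - y) ?x) \<longleftrightarrow> c' - (c + J (y' - y) ?x) \<in> \<int>"
    using e2pi_eq_iff[of "c + J (y' - y) ?x" c'] by (auto simp: e2pi_add)
  moreover have "c' - (c + J (y' - y) ?x) \<in> \<int> \<longleftrightarrow>
      (c' + J ?z y' - S ?x y' + S ?x y') - (c + J ?z y - S ?x y + S ?x y) - I ?x (y' - y) \<in> \<int>"
    if "y' - y \<in> \<Lambda>"
  proof -
    have "(c' + J ?z y' - S ?x y' + S ?x y') - (c + J ?z y - S ?x y + S ?x y) - I ?x (y' - y) =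
        (c' - (c + J (y' - y) ?x)) - J (?x - ?z) (y' - y)"
      by (simp add: I_eq J_simps)
    moreover have "J (?x - ?z) (y' - y) \<in> \<int>" using assms that by (intro J_int) (auto simp: composable_def)
    ultimately show ?thesis by (metis Ints_diff Ints_add diff_add_cancel)
  qed
  ultimately show ?thesis
    using assms by (auto simp: ar_eq_iff q_eq_iff lattice_0)
qed

lemma arr_map_ar:
  assumes "composable F G"
  shows "arr_map (ar F G y (e2pi c)) = q (fob F 1, y, c + J (fob G 1) y - S (fob F 1) y)"
  unfolding arr_map_def
proof (rule some_equality)
  fix k assume "\<exists>F' G' y' c'. composable F' G' \<and> ar F G y (e2pi c) = ar F' G' y' (e2pi c') \<and>
     k = q (fob F' 1, y', c' + J (fob G' 1) y' - S (fob F' 1) y')"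
  then obtain F' G' y' c' where *: "composable F' G'" "ar F G y (e2pi c) = ar F' G' y' (e2pi c')"
    "k = q (fob F' 1, y', c' + J (fob G' 1) y' - S (fob F' 1) y')" by blast
  then have "F' = F" "G' = G" using ar_eq_iff[OF assms norm_e2pi norm_e2pi, THEN iffD1, OF *(2)] by simp_all
  with * show "k = q (fob F 1, y, c + J (fob G 1) y - S (fob F 1) y)"
    using ar_eq_iff_q[OF assms] by simp
qed (use assms in blast)

lemma Arr_inertia_e2pi:
  assumes "f \<in> Arr IG"
  obtains F G y c where "composable F G" "f = ar F G y (e2pi c)"
  using assms e2pi_surj unfolding Arr_inertia_iff by metis

lemma Exp_composable: "composable F G \<Longrightarrow> Exp (fob G 1) = Exp (fob F 1)"
  by (simp add: composable_def torus_exp_eq_iff)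

lemma is_functor_inertia_H: "is_functor IG H obj_map arr_map"
  unfolding is_functor_def
proof (intro conjI ballI impI)
  fix F assume "F \<in> Obj IG"
  then have F: "F \<in> monoidal_funs CT" by (simp add: inertia_simps)
  show "obj_map F \<in> Obj H" by (simp add: obj_map_def Obj_H)
  show "arr_map (iden IG F) = iden H (obj_map F)"
    using arr_map_ar[OF composable_refl[OF F], of 0 0]
    by (simp add: inertia_iden F obj_map_def iden_H J_simps S_simps)
next
  fix f assume "f \<in> Arr IG"
  then obtain F G y c where f: "composable F G" "f = ar F G y (e2pi c)" by (rule Arr_inertia_e2pi)
  show "arr_map f \<in> Arr H" "src H (arr_map f) = obj_map (src IG f)"
    "tgt H (arr_map f) = obj_map (tgt IG f)"
    by (simp_all add: f(2) arr_map_ar[OF f(1)] inertia_simps src_q tgt_q Arr_H obj_map_def Exp_composable[OF f(1)])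
  fix g assume "g \<in> Arr IG" and gf: "src IG g = tgt IG f"
  then obtain G' K y' c' where g': "composable G' K" "g = ar G' K y' (e2pi c')" by (auto elim: Arr_inertia_e2pi)
  then have "G' = G" using gf by (simp add: f(2) inertia_simps)
  with g' have g: "composable G K" "g = ar G K y' (e2pi c')" by simp_all
  let ?x = "fob F 1" and ?z = "fob G 1" and ?u = "fob K 1"
  have "cmp IG g f = ar F K (y' + y) (e2pi (c + c' + J (?z - ?u) y))"
    using inertia_cmp[OF f(1) g(1) norm_e2pi norm_e2pi] by (simp add: f(2) g(2) e2pi_add)
  then have "arr_map (cmp IG g f) =
      q (?x, y' + y, c + c' + J (?z - ?u) y + J ?u (y' + y) - S ?x (y' + y))"
    by (simp add: arr_map_ar[OF composable_trans[OF f(1) g(1)]])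
  \<comment> \<open>The \<open>J\<close>-terms telescope, and shifting the left factor from the lift
    G 1 to F 1 turns its \<open>S\<close>-term into the one with F 1.\<close>
  also have "\<dots> = cmp H (q (?z, y', c' + J ?u y' - S ?z y')) (q (?x, y, c + J ?z y - S ?x y))"
    by (simp add: cmp_q_shift[OF Exp_composable[OF f(1)]] J_simps S_simps algebra_simps)
  also have "\<dots> = cmp H (arr_map g) (arr_map f)"
    by (simp add: f(2) g(2) arr_map_ar[OF f(1)] arr_map_ar[OF g(1)])
  finally show "arr_map (cmp IG g f) = cmp H (arr_map g) (arr_map f)" .
qed

text \<open>For fullness, an arrow of the model between the two images forces F 1 and G 1 to have
  the same exponential, so an arrow exists upstairs; its label is then found by undoing the
  corrections.\<close>

lemma arr_map_bij:
  assumes F: "F \<in> monoidal_funs CT" and G: "G \<in> monoidal_funs CT"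
  shows "bij_betw arr_map {f \<in> Arr IG. src IG f = F \<and> tgt IG f = G}
    {g \<in> Arr H. src H g = obj_map F \<and> tgt H g = obj_map G}" (is "bij_betw _ ?A ?B")
proof -
  have A: "composable F G \<and> (\<exists>y c. f = ar F G y (e2pi c))" if f: "f \<in> ?A" for f
  proof -
    have "f \<in> Arr IG" using f by simp
    then obtain F' G' y c where "composable F' G'" "f = ar F' G' y (e2pi c)" by (rule Arr_inertia_e2pi)
    then show ?thesis using f by (auto simp: inertia_simps)
  qed
  have "inj_on arr_map ?A"
  proof (rule inj_onI)
    fix f g assume f: "f \<in> ?A" and g: "g \<in> ?A" and eq: "arr_map f = arr_map g"
    obtain y c where FG: "composable F G" and y: "f = ar F G y (e2pi c)" using A[OF f] by blast
    obtain y' c' where y': "g = ar F G y' (e2pi c')" using A[OF g] by blast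
    show "f = g" using eq unfolding y y' arr_map_ar[OF FG] ar_eq_iff_q[OF FG] .
  qed
  moreover have "arr_map ` ?A \<subseteq> ?B"
    using is_functor_inertia_H unfolding is_functor_def by auto
  moreover have "?B \<subseteq> arr_map ` ?A"
  proof
    fix g assume g: "g \<in> ?B"
    then obtain y c where gq: "g = q (fob F 1, y, c)" using Arr_H_at[of g "fob F 1"] by (auto simp: obj_map_def)
    then have "Exp (fob G 1) = Exp (fob F 1)" using g by (simp add: tgt_q obj_map_def)
    then have FG: "composable F G" using F G by (simp add: composable_def torus_exp_eq_iff)
    have "arr_map (ar F G y (e2pi (c - J (fob G 1) y + S (fob F 1) y))) = g"
      by (simp add: arr_map_ar[OF FG] gq)
    moreover have "ar F G y (e2pi (c - J (fob G 1) y + S (fob F 1) y)) \<in> ?A"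
      using FG norm_e2pi unfolding Arr_inertia_iff mem_Collect_eq inertia_simps by blast
    ultimately show "g \<in> arr_map ` ?A" by blast
  qed
  ultimately show ?thesis by (simp add: bij_betw_def subset_antisym)
qed


lemma groupoid_equivalence_inertia_H: "groupoid_equivalence IG H obj_map arr_map"
  unfolding groupoid_equivalence_def
proof (intro conjI ballI)
  fix z assume "z \<in> Obj H"
  then obtain x where z: "z = Exp x" by (auto simp: Obj_H)
  show "\<exists>x\<in>Obj IG. \<exists>g\<in>Arr H. src H g = obj_map x \<and> tgt H g = z"
    by (intro bexI[of _ "strict_fun x"] bexI[of _ "q (x, 0, 0)"])
      (simp_all add: z obj_map_def src_q tgt_q Arr_H inertia_simps strict_fun_monoidal)
next
  fix F G assume "F \<in> Obj IG" "G \<in> Obj IG"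
  then show "bij_betw arr_map {f \<in> Arr IG. src IG f = F \<and> tgt IG f = G}
    {g \<in> Arr H. src H g = obj_map F \<and> tgt H g = obj_map G}"
    by (intro arr_map_bij) (simp_all add: inertia_simps)
qed (rule is_groupoid_inertia is_groupoid_H is_functor_inertia_H)+

lemma obj_map_strict: "obj_map (strict_fun x) = Exp x"
  by (simp add: obj_map_def)

lemma arr_map_strict:
  "m \<in> \<Lambda> \<Longrightarrow> arr_map (sarr m (x, y, c)) = q (x, y, c + J (x - m) y - S x y)"
  using arr_map_ar[of "strict_fun x" "strict_fun (x - m)" y c] by (simp add: strict_arr_eq_ar composable_strict)

lemma is_functor_SI_H: "is_functor SI H obj_map arr_map"
proof -
  have "Arr SI \<subseteq> Arr IG" "Obj SI \<subseteq> Obj IG"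
    using Arr_SI_iff strict_fun_monoidal by (auto simp: SI_simps(1) inertia_simps)
  then show ?thesis
    using is_functor_inertia_H unfolding is_functor_def SI_simps(2-5) by blast
qed

definition hom_data :: "'a ct_inertia_arr \<Rightarrow> 'a ct_fun \<times> 'a ct_fun \<times> 'g" where
  "hom_data f = (src SI f, tgt SI f, arr_map f)"

text \<open>Names the set occurring inside \<open>lie_equivalence\<close>, so that the smoothness of
  the inverse of \<open>hom_data\<close> can be stated and folded back.\<close>

definition fibre_product :: "('a ct_fun \<times> 'a ct_fun \<times> 'g) set" where
  "fibre_product = {(x, y, g). x \<in> Obj SI \<and> y \<in> Obj SI \<and> g \<in> Arr H \<and> src H g = obj_map x \<and> tgt H g = obj_map y}"

lemma hom_data_bij: "bij_betw hom_data (Arr SI) fibre_product"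
proof -
  have Obj: "x \<in> monoidal_funs CT" if "x \<in> Obj SI" for x
    using that strict_fun_monoidal by (auto simp: SI_simps)
  have "inj_on hom_data (Arr SI)"
  proof (rule inj_onI)
    fix f g assume *: "f \<in> Arr SI" "g \<in> Arr SI" "hom_data f = hom_data g"
    let ?F = "src SI f" and ?G = "tgt SI f"
    have inj: "inj_on arr_map {f \<in> Arr IG. src IG f = ?F \<and> tgt IG f = ?G}"
      using arr_map_bij[OF Obj Obj] *(1) unfolding bij_betw_def Arr_SI_iff SI_simps(2,3) by blast
    show "f = g"
      by (rule inj_onD[OF inj]) (use * in \<open>auto simp: hom_data_def Arr_SI_iff SI_simps(2,3)\<close>)
  qed
  moreover have "hom_data ` Arr SI \<subseteq> fibre_product"
    using is_functor_SI_H is_groupoid_SI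
    unfolding is_functor_def is_groupoid_def hom_data_def fibre_product_def by auto
  moreover have "fibre_product \<subseteq> hom_data ` Arr SI"
  proof
    fix p assume "p \<in> fibre_product"
    then obtain F G g where p: "p = (F, G, g)" "F \<in> Obj SI" "G \<in> Obj SI"
      "g \<in> {g \<in> Arr H. src H g = obj_map F \<and> tgt H g = obj_map G}" by (auto simp: fibre_product_def)
    have "g \<in> arr_map ` {f \<in> Arr IG. src IG f = F \<and> tgt IG f = G}"
      using p(4) unfolding bij_betw_imp_surj_on[OF arr_map_bij[OF Obj[OF p(2)] Obj[OF p(3)]]] .
    then obtain f where "f \<in> Arr IG" "src IG f = F" "tgt IG f = G" "arr_map f = g"
      by auto
    then show "p \<in> hom_data ` Arr SI"
      using p(1-3) by (intro image_eqI[of _ _ f]) (simp_all add: hom_data_def Arr_SI_iff SI_simps(2,3))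
  qed
  ultimately show ?thesis by (simp add: bij_betw_def subset_antisym)
qed

lemma inv_hom_data:
  assumes m: "m \<in> \<Lambda>" and x': "Exp x' = Exp x"
  shows "inv_into (Arr SI) hom_data (strict_fun x, strict_fun (x - m), q (x', y, c)) =
    sarr m (x, y, c + S x' y - J (x - m) y)"
proof (rule inv_into_f_eq)
  show "inj_on hom_data (Arr SI)" using hom_data_bij by (simp add: bij_betw_def)
  show "sarr m (x, y, c + S x' y - J (x - m) y) \<in> Arr SI" using m by (auto simp: Arr_SI)
  show "hom_data (sarr m (x, y, c + S x' y - J (x - m) y)) =
      (strict_fun x, strict_fun (x - m), q (x', y, c))"
    using q_shift[OF Exp_eqD[OF x'], of y c]
    by (simp add: hom_data_def src_strict_arr tgt_strict_arr arr_map_strict m)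
qed

lemma lie_equivalence_SI_H: "lie_equivalence SI H obj_map arr_map"
proof -
  have sm0: "smooth_map_on (atlas_Obj SI) (atlas_Obj H) (Obj SI) obj_map"
  proof (rule smooth_map_onI[OF presents_Obj_SI presents_Obj_H])
    fix p assume "p \<in> Obj SI"
    then obtain x where "strict_fun x = p" by (auto simp: SI_simps)
    then show "lifts_at {strict_fun} {Exp} (Obj SI) obj_map p"
      by (intro lifts_at_globalI[where q = strict_fun and r = Exp, OF _ _ _ smooth_ident])
        (simp_all add: obj_map_strict)
  qed
  have sm1: "smooth_map_on (atlas_Arr SI) (atlas_Arr H) (Arr SI) arr_map"
  proof (rule smooth_map_onI[OF presents_Arr_SI presents_Arr_H])
    fix p assume "p \<in> Arr SI"
    then obtain m e where m: "m \<in> \<Lambda>" "sarr m e = p" by (auto simp: Arr_SI)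
    let ?g = "\<lambda>e :: 'a \<times> 'a \<times> real. (fst e, fst (snd e),
      snd (snd e) + J (fst e - m) (fst (snd e)) - S (fst e) (fst (snd e)))"
    have "smooth_on UNIV ?g" by (intro smooth_intros smooth_J smooth_S)
    moreover have "arr_map (sarr m e) = q (?g e)" for e
      by (cases e) (simp add: arr_map_strict m(1))
    ultimately show "lifts_at (sarr ` \<Lambda>) {q} (Arr SI) arr_map p"
      using m by (intro lifts_at_globalI[where q = "sarr m" and r = q and g = ?g]) auto
  qed
  let ?S = "{(x, g). x \<in> Obj SI \<and> g \<in> Arr H \<and> src H g = obj_map x}"
  let ?\<tau> = "\<lambda>(x :: 'a ct_fun, g). tgt H g"
  have \<tau>: "?\<tau> ` ?S = Obj H"
  proof
    show "?\<tau> ` ?S \<subseteq> Obj H" by (auto simp: Obj_H Arr_H tgt_q)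
    show "Obj H \<subseteq> ?\<tau> ` ?S"
    proof
      fix z assume "z \<in> Obj H"
      then obtain x where "z = Exp x" by (auto simp: Obj_H)
      then show "z \<in> ?\<tau> ` ?S"
        by (intro image_eqI[of _ _ "(strict_fun x, q (x, 0, 0))"]) (auto simp: tgt_q src_q Arr_H SI_simps obj_map_strict)
    qed
  qed
  let ?Q = "{map_prod q' r |q' r. q' \<in> {strict_fun :: 'a \<Rightarrow> 'a ct_fun} \<and> r \<in> {q}}"
  have Q: "map_prod strict_fun q \<in> ?Q" by blast
  have pres: "presents (prod_atlas (atlas_Obj SI) (atlas_Arr H)) ?Q"
    by (rule presents_prod_atlas[OF presents_Obj_SI presents_Arr_H])
  have S_cases: "\<exists>x e. p = map_prod strict_fun q (x, e)" if "p \<in> ?S" for p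
    using that by (auto simp: SI_simps Arr_H)
  have \<tau>_q: "?\<tau> (map_prod strict_fun q z) = Exp (fst (snd z))" for z
    by (cases z) (auto simp: tgt_q)
  have "smooth_map_on (prod_atlas (atlas_Obj SI) (atlas_Arr H)) (atlas_Obj H) ?S ?\<tau>"
  proof (rule smooth_map_onI[OF pres presents_Obj_H])
    fix p assume p: "p \<in> ?S"
    then obtain x e where "p = map_prod strict_fun q (x, e)" using S_cases[OF p] by (elim exE)
    then have "map_prod strict_fun q (x, e) = p" by (rule sym)
    moreover have "smooth_on UNIV (\<lambda>z :: 'a \<times> 'a \<times> 'a \<times> real. fst (snd z))" by (intro smooth_intros)
    ultimately show "lifts_at ?Q {Exp} ?S ?\<tau> p"
      using \<tau>_q by (intro lifts_atI[where r = Exp, OF Q singletonI _ open_UNIV UNIV_I])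
  qed
  then have sub: "submersion_on (prod_atlas (atlas_Obj SI) (atlas_Arr H)) (atlas_Obj H) ?S ?\<tau>"
    unfolding atlas_Obj_H
  proof (rule submersion_onI[OF pres])
    fix p r e v assume p: "p \<in> ?S" and r: "r \<in> {Exp}" "r e = ?\<tau> p"
    obtain x x' y c where px: "p = (strict_fun x, q (x', y, c))" using S_cases[OF p] by auto
    have x': "Exp x' = Exp x" using p by (simp add: px src_q obj_map_strict)
    have e: "Exp x' = Exp e" using r by (simp add: px tgt_q)
    \<comment> \<open>The object and the lift of the source of the arrow move by the same vector;
      this keeps their exponentials equal, so the curve remains in the fibre product.\<close>
    have "smooth_on UNIV (\<lambda>t::real. (x + t *\<^sub>R v, x' + t *\<^sub>R v, y, c))" by (intro smooth_intros)
    moreover have "map_prod strict_fun q (x + 0 *\<^sub>R v, x' + 0 *\<^sub>R v, y, c) = p" by (simp add: px)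
    moreover have "map_prod strict_fun q (x + t *\<^sub>R v, x' + t *\<^sub>R v, y, c) \<in> ?S" for t
      using Exp_translate[OF x'] by (simp add: SI_simps Arr_H src_q obj_map_strict)
    moreover have "?\<tau> (map_prod strict_fun q (x + t *\<^sub>R v, x' + t *\<^sub>R v, y, c)) = r (e + t *\<^sub>R v)" for t
      using Exp_translate[OF e] r(1) by (simp add: tgt_q)
    ultimately show "\<exists>q\<in>?Q. \<exists>\<delta>. smooth_on UNIV \<delta> \<and> q (\<delta> 0) = p \<and>
        (\<forall>t::real. q (\<delta> t) \<in> ?S \<and> ?\<tau> (q (\<delta> t)) = r (e + t *\<^sub>R v))"
      by (intro bexI[OF _ Q] exI[of _ "\<lambda>t. (x + t *\<^sub>R v, x' + t *\<^sub>R v, y, c)"] conjI allI)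
  qed
  let ?Q3 = "{map_prod q' r |q' r. q' \<in> {strict_fun :: 'a \<Rightarrow> 'a ct_fun} \<and> r \<in> ?Q}"
  have Q3: "map_prod strict_fun (map_prod strict_fun q) \<in> ?Q3" using Q by blast
  have pres3: "presents (prod_atlas (atlas_Obj SI) (prod_atlas (atlas_Obj SI) (atlas_Arr H))) ?Q3"
    by (rule presents_prod_atlas[OF presents_Obj_SI pres])
  have inv: "smooth_map_on (prod_atlas (atlas_Obj SI) (prod_atlas (atlas_Obj SI) (atlas_Arr H)))
      (atlas_Arr SI) fibre_product (inv_into (Arr SI) hom_data)"
  proof (rule smooth_map_onI[OF pres3 presents_Arr_SI])
    fix p assume p: "p \<in> fibre_product"
    then obtain x z e where px: "map_prod strict_fun (map_prod strict_fun q) (x, z, e) = p"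
      by (auto simp: fibre_product_def SI_simps Arr_H)
    have diff: "a - b \<in> \<Lambda> \<and> Exp a' = Exp a"
      if "map_prod strict_fun (map_prod strict_fun q) (a, b, a', b', d) \<in> fibre_product" for a b a' b' d
    proof -
      have *: "Exp a' = Exp a" "Exp a' = Exp b"
        using that unfolding fibre_product_def map_prod_simp mem_Collect_eq case_prod_conv
          src_q tgt_q obj_map_strict by blast+
      have "Exp b = Exp a" using *(1) unfolding *(2) .
      then show ?thesis using *(1) by (simp add: torus_exp_eq_iff)
    qed
    define m where "m = x - z"
    have m: "m \<in> \<Lambda>" using diff[of x z "fst e" "fst (snd e)" "snd (snd e)"] p px by (simp add: m_def)
    \<comment> \<open>The inverse lands in the component indexed by the difference of the two
      objects. On the fibre product this difference is a lattice vector, so by discreteness it is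
      constant near the given point and a single lift serves.\<close>
    obtain O' where O': "open O'" "0 \<in> O'" "O' \<inter> \<Lambda> \<subseteq> {0}" using discrete_lattice by blast
    let ?N = "(\<lambda>w :: 'a \<times> 'a \<times> 'a \<times> 'a \<times> real. fst w - fst (snd w) - m) -` O'"
    let ?g = "\<lambda>w :: 'a \<times> 'a \<times> 'a \<times> 'a \<times> real. (fst w, fst (snd (snd (snd w))),
      snd (snd (snd (snd w))) + S (fst (snd (snd w))) (fst (snd (snd (snd w)))) - J (fst w - m) (fst (snd (snd (snd w)))))"
    have "open ?N" by (intro open_vimage O'(1) continuous_intros)
    moreover have "(x, z, e) \<in> ?N" using O'(2) by (simp add: m_def)
    moreover have "smooth_on UNIV ?g" by (intro smooth_intros smooth_J smooth_S)
    moreover have "inv_into (Arr SI) hom_data (map_prod strict_fun (map_prod strict_fun q) w) = sarr m (?g w)"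
      if w: "w \<in> ?N" "map_prod strict_fun (map_prod strict_fun q) w \<in> fibre_product" for w
    proof -
      obtain a b a' b' d where wa: "w = (a, b, a', b', d)" by (cases w) auto
      have ab: "a - b \<in> \<Lambda>" "Exp a' = Exp a" using diff w(2) unfolding wa by blast+
      have "a - b - m \<in> O' \<inter> \<Lambda>" using w(1) ab(1) m by (simp add: wa lattice_diff)
      then have "a - b - m = 0" using O'(3) by blast
      then have "b = a - m" by (simp add: algebra_simps)
      then show ?thesis using inv_hom_data[OF m ab(2)] by (simp add: wa)
    qed
    moreover have "sarr m \<in> sarr ` \<Lambda>" using m by blast
    ultimately show "lifts_at ?Q3 (sarr ` \<Lambda>) fibre_product (inv_into (Arr SI) hom_data) p"
      using px by (intro lifts_atI[OF Q3])
  qed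
  have hom_data_eq: "(\<lambda>f. (src SI f, tgt SI f, arr_map f)) = hom_data"
    by (simp add: hom_data_def fun_eq_iff)
  show ?thesis
    unfolding lie_equivalence_def Let_def fibre_product_def[symmetric] hom_data_eq
    using is_lie_groupoid_SI is_lie_groupoid_H is_functor_SI_H sm0 sm1 \<tau> sub hom_data_bij inv
    by (intro conjI)
qed

lemma inertia_equivalent_to_H: "inertia_equivalent_to \<Lambda> J H"
  unfolding inertia_equivalent_to_def
  using groupoid_equivalence_inertia_H lie_equivalence_SI_H by blast

end

section \<open>The two models\<close>

lemma equiv_inv_image: "equiv A r \<Longrightarrow> equiv (f -` A) (inv_image r f)"
  unfolding equiv_def by (auto simp: refl_on_def inv_image_def intro: symI transI dest: symD transD)

context lattice_basis
begin

lemma carrier_torus_cases: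
  assumes "t \<in> carrier \<T>"
  obtains x where "t = Exp x"
  using assms range_torus_exp by blast

lemma carrier_circle_cases:
  assumes "w \<in> carrier circle_group"
  obtains c where "w = e2pi c"
  using assms e2pi_surj by auto

text \<open>The form \<open>K\<close> will be I for model (i) and -I for model (ii), which becomes
  an instance of the first relation after exchanging the first two factors.\<close>

context
  fixes K :: "'a \<Rightarrow> 'a \<Rightarrow> real"
  assumes K: "integral_form \<Lambda> K"
begin

lemma bilinear_K: "bilinear K" and K_int: "m \<in> \<Lambda> \<Longrightarrow> n \<in> \<Lambda> \<Longrightarrow> K m n \<in> \<int>"
  using K by (simp_all add: integral_form_def)

lemmas K_simps = bilinear_radd[OF bilinear_K] bilinear_rsub[OF bilinear_K]
  bilinear_rzero[OF bilinear_K] bilinear_rneg[OF bilinear_K]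

text \<open>The relation allows any lift of \<open>t\<close>. Two lifts differ by a lattice vector,
  whose pairing with \<open>n\<close> is an integer, so one lift may be fixed.\<close>

lemma rel_i_iff:
  "((Exp x, y, e2pi c), (t', y', w')) \<in> rel_i \<Lambda> K \<longleftrightarrow>
    t' = Exp x \<and> y' - y \<in> \<Lambda> \<and> w' = e2pi (c + K x (y' - y))"
proof
  assume "((Exp x, y, e2pi c), (t', y', w')) \<in> rel_i \<Lambda> K"
  then obtain n x' where *: "t' = Exp x" "y = y' + n" "n \<in> \<Lambda>" "w' = e2pi c * e2pi (- K x' n)"
    "Exp x' = Exp x"
    unfolding rel_i_def by blast
  have "- K x n - - K x' n = - K (x - x') n" by (simp add: bilinear_lsub[OF bilinear_K])
  also have "\<dots> \<in> \<int>" using *(3,5) by (intro Ints_minus K_int) (simp_all add: torus_exp_eq_iff)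
  finally have "e2pi (- K x' n) = e2pi (- K x n)" by (simp only: e2pi_eq_iff)
  then have "w' = e2pi (c + - K x n)" by (simp only: *(4) e2pi_add)
  moreover have "K x (y' - y) = - K x n" by (simp add: *(2) K_simps)
  ultimately have "w' = e2pi (c + K x (y' - y))" by simp
  then show "t' = Exp x \<and> y' - y \<in> \<Lambda> \<and> w' = e2pi (c + K x (y' - y))"
    using * by (simp add: lattice_minus)
next
  assume *: "t' = Exp x \<and> y' - y \<in> \<Lambda> \<and> w' = e2pi (c + K x (y' - y))"
  then have "y - y' \<in> \<Lambda>" using lattice_minus[of "y' - y"] by simp
  moreover have "w' = e2pi c * e2pi (- K x (y - y'))" using * by (simp add: e2pi_add[symmetric] K_simps)
  ultimately show "((Exp x, y, e2pi c), (t', y', w')) \<in> rel_i \<Lambda> K"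
    unfolding rel_i_def using *
    by (intro CollectI exI[of _ "Exp x"] exI[of _ y'] exI[of _ "y - y'"] exI[of _ "e2pi c"] exI[of _ x]) simp
qed

lemma equiv_rel_i: "equiv (carrier \<T> \<times> UNIV \<times> carrier circle_group) (rel_i \<Lambda> K)"
proof (rule equivI)
  let ?X = "carrier \<T> \<times> (UNIV :: 'a set) \<times> carrier circle_group"
  have X: "\<exists>x y c. p = (Exp x, y, e2pi c)" if "p \<in> ?X" for p
    using that by (cases p) (auto elim!: carrier_torus_cases dest!: e2pi_surj)
  show sub: "rel_i \<Lambda> K \<subseteq> ?X \<times> ?X"
    by (auto simp: rel_i_def torus_exp_closed norm_mult)
  show "refl_on ?X (rel_i \<Lambda> K)"
  proof (rule refl_onI)
    fix p assume "p \<in> ?X"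
    then obtain x y c where "p = (Exp x, y, e2pi c)" using X by blast
    then show "(p, p) \<in> rel_i \<Lambda> K" by (simp add: rel_i_iff lattice_0 K_simps)
  qed
  show "sym (rel_i \<Lambda> K)"
  proof (rule symI)
    fix p p' assume pp': "(p, p') \<in> rel_i \<Lambda> K"
    then obtain x y c where p: "p = (Exp x, y, e2pi c)" using X sub by blast
    obtain t' y' w' where p': "p' = (t', y', w')" by (cases p')
    have *: "t' = Exp x \<and> y' - y \<in> \<Lambda> \<and> w' = e2pi (c + K x (y' - y))" using pp' unfolding p p' rel_i_iff .
    then show "(p', p) \<in> rel_i \<Lambda> K"
      using lattice_minus[of "y' - y"] by (simp add: p p' rel_i_iff K_simps)
  qed
  show "trans (rel_i \<Lambda> K)"
  proof (rule transI)
    fix p p' p'' assume pp': "(p, p') \<in> rel_i \<Lambda> K" and pp'': "(p', p'') \<in> rel_i \<Lambda> K"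
    then obtain x y c where p: "p = (Exp x, y, e2pi c)" using X sub by blast
    obtain t' y' w' where p': "p' = (t', y', w')" by (cases p')
    have *: "t' = Exp x \<and> y' - y \<in> \<Lambda> \<and> w' = e2pi (c + K x (y' - y))" using pp' unfolding p p' rel_i_iff .
    obtain t'' y'' w'' where p'': "p'' = (t'', y'', w'')" by (cases p'')
    have **: "t'' = Exp x \<and> y'' - y' \<in> \<Lambda> \<and> w'' = e2pi (c + K x (y' - y) + K x (y'' - y'))"
      using pp'' unfolding p' p'' conjunct1[OF *] conjunct2[OF conjunct2[OF *]] rel_i_iff .
    have "y'' - y \<in> \<Lambda>" using * ** lattice_add[of "y'' - y'" "y' - y"] by simp
    with ** show "(p, p'') \<in> rel_i \<Lambda> K" by (simp add: p p'' rel_i_iff K_simps)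
  qed
qed

end

lemma rel_ii_iff_rel_i:
  assumes "\<And>x y. I x y = I y x"
  shows "((x, s, z), (x', s', z')) \<in> rel_ii \<Lambda> I \<longleftrightarrow> ((s, x, z), (s', x', z')) \<in> rel_i \<Lambda> (\<lambda>x y. - I x y)"
  unfolding rel_i_def rel_ii_def using assms by auto

end

locale cat_torus_form = cat_torus B \<Lambda> J for B \<Lambda> :: "'a::real_normed_vector set" and J +
  fixes I :: "'a \<Rightarrow> 'a \<Rightarrow> real"
  assumes bilinear_I: "bilinear I" and I_eq_J: "I x y = J x y + J y x"
begin

lemmas I_simps = bilinear_ladd[OF bilinear_I] bilinear_radd[OF bilinear_I]
  bilinear_lsub[OF bilinear_I] bilinear_rsub[OF bilinear_I]
  bilinear_lzero[OF bilinear_I] bilinear_rzero[OF bilinear_I]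
  bilinear_lneg[OF bilinear_I] bilinear_rneg[OF bilinear_I]

lemma I_int: "m \<in> \<Lambda> \<Longrightarrow> n \<in> \<Lambda> \<Longrightarrow> I m n \<in> \<int>"
  by (simp add: I_eq_J J_int)

lemma I_commute: "I x y = I y x"
  by (simp add: I_eq_J)

lemma integral_form_I: "integral_form \<Lambda> I"
  using bilinear_I I_int by (simp add: integral_form_def)

lemmas rel_i_I_iff = rel_i_iff[OF integral_form_I]
lemmas equiv_rel_i_I = equiv_rel_i[OF integral_form_I]

definition q_i :: "'a \<times> 'a \<times> real \<Rightarrow> ('a torus_elt \<times> 'a \<times> complex) set" where
  "q_i = (\<lambda>(x, y, c). rel_i \<Lambda> I `` {(Exp x, y, e2pi c)})"

lemma q_i_mem_iff: "(t', y', w') \<in> q_i (x, y, c) \<longleftrightarrow>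
    t' = Exp x \<and> y' - y \<in> \<Lambda> \<and> w' = e2pi (c + I x (y' - y))"
  by (simp add: q_i_def rel_i_I_iff)

lemma q_i_eq_iff: "q_i (x, y, c) = q_i (x', y', c') \<longleftrightarrow>
    x' - x \<in> \<Lambda> \<and> y' - y \<in> \<Lambda> \<and> c' - c - I x (y' - y) \<in> \<int>"
proof -
  have "q_i (x, y, c) = q_i (x', y', c') \<longleftrightarrow> ((Exp x, y, e2pi c), (Exp x', y', e2pi c')) \<in> rel_i \<Lambda> I"
    unfolding q_i_def case_prod_conv
    by (rule eq_equiv_class_iff[OF equiv_rel_i_I]) (simp_all add: torus_exp_closed)
  also have "\<dots> \<longleftrightarrow> Exp x = Exp x' \<and> y' - y \<in> \<Lambda> \<and> e2pi (c + I x (y' - y)) = e2pi c'"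
    unfolding rel_i_I_iff by (auto simp only:)
  finally show ?thesis by (simp only: torus_exp_eq_iff e2pi_eq_iff diff_diff_eq)
qed

lemma model_i: "inertia_model B \<Lambda> J I (\<lambda>_ _. 0) (groupoid_i \<Lambda> I) q_i"
proof unfold_locales
  let ?H = "groupoid_i \<Lambda> I"
  show "I x y = J x y + J y x" for x y by (rule I_eq_J)
  show "bilinear (\<lambda>(_ :: 'a) (_ :: 'a). 0 :: real)" by (simp add: bilinear_def linear_iff)
  show "Obj ?H = range Exp" by (simp add: groupoid_i_def range_torus_exp)
  show "atlas_Obj ?H = local_inverse_atlas {Exp}" "atlas_Arr ?H = local_inverse_atlas {q_i}"
    by (simp_all add: groupoid_i_def q_i_def)
  show "Arr ?H = range q_i"
  proof
    show "Arr ?H \<subseteq> range q_i"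
    proof
      fix K assume "K \<in> Arr ?H"
      then obtain t y w where "t \<in> carrier \<T>" "w \<in> carrier circle_group" "K = rel_i \<Lambda> I `` {(t, y, w)}"
        by (auto simp: groupoid_i_def elim!: quotientE)
      moreover from this obtain x c where "t = Exp x" "w = e2pi c"
        by (elim carrier_torus_cases carrier_circle_cases) blast
      ultimately have "K = q_i (x, y, c)" by (simp add: q_i_def)
      then show "K \<in> range q_i" by blast
    qed
    show "range q_i \<subseteq> Arr ?H"
      by (auto simp: groupoid_i_def q_i_def torus_exp_closed intro!: quotientI)
  qed
  fix x y :: 'a and c :: real
  have mem: "(Exp x, y, e2pi c) \<in> q_i (x, y, c)" for y c by (simp add: q_i_mem_iff lattice_0 I_simps)
  have "(\<lambda>(t, y, w). t) ` q_i (x, y, c) = {Exp x}"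
  proof
    show "(\<lambda>(t, y, w). t) ` q_i (x, y, c) \<subseteq> {Exp x}" by (auto simp: q_i_mem_iff)
    show "{Exp x} \<subseteq> (\<lambda>(t, y, w). t) ` q_i (x, y, c)" using mem by force
  qed
  then show "src ?H (q_i (x, y, c)) = Exp x" "tgt ?H (q_i (x, y, c)) = Exp x"
    by (simp_all add: groupoid_i_def)
  show "iden ?H (Exp x) = q_i (x, 0, 0)" by (simp add: groupoid_i_def q_i_def)
  fix y' :: 'a and c' :: real
  let ?X = "{(t, y1 + y2, w1 * w2) | t y1 w1 y2 w2. (t, y1, w1) \<in> q_i (x, y, c) \<and> (t, y2, w2) \<in> q_i (x, y', c')}"
  have "?X \<subseteq> rel_i \<Lambda> I `` {(Exp x, y + y', e2pi (c + c'))}"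
  proof
    fix p assume "p \<in> ?X"
    then obtain t y1 w1 y2 w2 where p: "p = (t, y1 + y2, w1 * w2)" and
      *: "(t, y1, w1) \<in> q_i (x, y, c)" "(t, y2, w2) \<in> q_i (x, y', c')"
      by (elim CollectE exE conjE) (rule that)
    have "y1 + y2 - (y + y') \<in> \<Lambda>"
      using * lattice_add[of "y1 - y" "y2 - y'"] by (simp add: q_i_mem_iff algebra_simps)
    moreover have "w1 * w2 = e2pi (c + c' + I x (y1 + y2 - (y + y')))"
      using * by (simp add: q_i_mem_iff e2pi_add[symmetric] I_simps algebra_simps)
    ultimately show "p \<in> rel_i \<Lambda> I `` {(Exp x, y + y', e2pi (c + c'))}"
      using * by (simp add: p rel_i_I_iff q_i_mem_iff)
  qed
  moreover have "(Exp x, y + y', e2pi c * e2pi c') \<in> ?X"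
    by (intro CollectI exI[of _ "Exp x"] exI[of _ y] exI[of _ "e2pi c"] exI[of _ y'] exI[of _ "e2pi c'"]
        conjI refl mem)
  ultimately have "rel_i \<Lambda> I `` ?X = rel_i \<Lambda> I `` {(Exp x, y + y', e2pi (c + c'))}"
    by (rule equiv_Image_subset_class[OF equiv_rel_i_I])
  then show "cmp ?H (q_i (x, y, c)) (q_i (x, y', c')) = q_i (x, y + y', c + c')"
    by (simp add: groupoid_i_def q_i_def)
  fix x' :: 'a
  show "q_i (x, y, c) = q_i (x', y', c') \<longleftrightarrow>
      x' - x \<in> \<Lambda> \<and> y' - y \<in> \<Lambda> \<and> c' + 0 - (c + 0) - I x (y' - y) \<in> \<int>"
    by (simp add: q_i_eq_iff)
qed

lemma integral_form_minus_I: "integral_form \<Lambda> (\<lambda>x y. - I x y)"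
  unfolding integral_form_def bilinear_def
  by (intro conjI allI ballI linearI Ints_minus I_int)
    (simp_all add: I_simps bilinear_lmul[OF bilinear_I] bilinear_rmul[OF bilinear_I])

lemmas rel_i_minus_I_iff = rel_i_iff[OF integral_form_minus_I]
lemmas equiv_rel_i_minus_I = equiv_rel_i[OF integral_form_minus_I]

lemma rel_ii_iff:
  "((x, Exp y, e2pi c), (x', s', z')) \<in> rel_ii \<Lambda> I \<longleftrightarrow>
    s' = Exp y \<and> x' - x \<in> \<Lambda> \<and> z' = e2pi (c - I (x' - x) y)"
  unfolding rel_ii_iff_rel_i[OF I_commute] rel_i_minus_I_iff by (simp add: I_commute[of y])

definition q_ii :: "'a \<times> 'a \<times> real \<Rightarrow> ('a \<times> 'a torus_elt \<times> complex) set" where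
  "q_ii = (\<lambda>(x, y, c). rel_ii \<Lambda> I `` {(x, Exp y, e2pi c)})"

lemma equiv_rel_ii: "equiv (UNIV \<times> carrier \<T> \<times> carrier circle_group) (rel_ii \<Lambda> I)"
proof -
  let ?f = "\<lambda>(x, s, z). (s, x, z)"
  have rel: "rel_ii \<Lambda> I = inv_image (rel_i \<Lambda> (\<lambda>x y. - I x y)) ?f"
    using rel_ii_iff_rel_i[OF I_commute] by (auto simp: inv_image_def)
  have dom: "UNIV \<times> carrier \<T> \<times> carrier circle_group =
      ?f -` (carrier \<T> \<times> UNIV \<times> carrier circle_group)" by auto
  show ?thesis unfolding rel dom by (rule equiv_inv_image[OF equiv_rel_i_minus_I])
qed

lemma q_ii_mem_iff: "(x', s', z') \<in> q_ii (x, y, c) \<longleftrightarrow>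
    s' = Exp y \<and> x' - x \<in> \<Lambda> \<and> z' = e2pi (c - I (x' - x) y)"
  by (simp add: q_ii_def rel_ii_iff)

text \<open>The relation of model (ii) changes the label by the pairing of x' - x with y. Adding
  I(x, y) to the label moves the dependence to y' - y, up to the integer I(x' - x, y' - y); this is
  why the abstract model takes \<open>S = I\<close> here.\<close>

lemma q_ii_eq_iff: "q_ii (x, y, c) = q_ii (x', y', c') \<longleftrightarrow>
    x' - x \<in> \<Lambda> \<and> y' - y \<in> \<Lambda> \<and> (c' + I x' y') - (c + I x y) - I x (y' - y) \<in> \<int>"
proof -
  have "q_ii (x, y, c) = q_ii (x', y', c') \<longleftrightarrow> ((x, Exp y, e2pi c), (x', Exp y', e2pi c')) \<in> rel_ii \<Lambda> I"
    unfolding q_ii_def case_prod_conv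
    by (rule eq_equiv_class_iff[OF equiv_rel_ii]) (simp_all add: torus_exp_closed)
  also have "\<dots> \<longleftrightarrow> Exp y = Exp y' \<and> x' - x \<in> \<Lambda> \<and> e2pi (c - I (x' - x) y) = e2pi c'"
    unfolding rel_ii_iff by (auto simp only:)
  finally have 1: "q_ii (x, y, c) = q_ii (x', y', c') \<longleftrightarrow>
      y' - y \<in> \<Lambda> \<and> x' - x \<in> \<Lambda> \<and> c' - (c - I (x' - x) y) \<in> \<int>"
    by (simp only: torus_exp_eq_iff e2pi_eq_iff)
  have "c' - (c - I (x' - x) y) \<in> \<int> \<longleftrightarrow> (c' + I x' y') - (c + I x y) - I x (y' - y) \<in> \<int>"
    if "x' - x \<in> \<Lambda>" "y' - y \<in> \<Lambda>"
  proof -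
    have "(c' + I x' y') - (c + I x y) - I x (y' - y) = (c' - (c - I (x' - x) y)) + I (x' - x) (y' - y)"
      by (simp add: I_simps)
    then show ?thesis using I_int[OF that] by (metis Ints_add Ints_diff add_diff_cancel_right')
  qed
  with 1 show ?thesis by blast
qed

lemma model_ii: "inertia_model B \<Lambda> J I I (groupoid_ii \<Lambda> I) q_ii"
proof unfold_locales
  let ?H = "groupoid_ii \<Lambda> I"
  show "I x y = J x y + J y x" for x y by (rule I_eq_J)
  show "bilinear I" by (rule bilinear_I)
  show "Obj ?H = range Exp" by (simp add: groupoid_ii_def range_torus_exp)
  show "atlas_Obj ?H = local_inverse_atlas {Exp}" "atlas_Arr ?H = local_inverse_atlas {q_ii}"
    by (simp_all add: groupoid_ii_def q_ii_def)
  show "Arr ?H = range q_ii"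
  proof
    show "Arr ?H \<subseteq> range q_ii"
    proof
      fix K assume "K \<in> Arr ?H"
      then obtain x s z where "s \<in> carrier \<T>" "z \<in> carrier circle_group" "K = rel_ii \<Lambda> I `` {(x, s, z)}"
        by (auto simp: groupoid_ii_def elim!: quotientE)
      moreover from this obtain y c where "s = Exp y" "z = e2pi c"
        by (elim carrier_torus_cases carrier_circle_cases) blast
      ultimately have "K = q_ii (x, y, c)" by (simp add: q_ii_def)
      then show "K \<in> range q_ii" by blast
    qed
    show "range q_ii \<subseteq> Arr ?H"
      by (auto simp: groupoid_ii_def q_ii_def torus_exp_closed intro!: quotientI)
  qed
  fix x y :: 'a and c :: real
  have mem: "(x, Exp y, e2pi c) \<in> q_ii (x, y, c)" for y c by (simp add: q_ii_mem_iff lattice_0 I_simps)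
  have "(\<lambda>(x, s, z). Exp x) ` q_ii (x, y, c) = {Exp x}"
  proof
    have "Exp x' = Exp x" if "(x', s', z') \<in> q_ii (x, y, c)" for x' s' z'
    proof -
      have "Exp x = Exp x'" using that by (simp add: q_ii_mem_iff torus_exp_eq_iff)
      then show ?thesis by (rule sym)
    qed
    then show "(\<lambda>(x, s, z). Exp x) ` q_ii (x, y, c) \<subseteq> {Exp x}" by auto
    show "{Exp x} \<subseteq> (\<lambda>(x, s, z). Exp x) ` q_ii (x, y, c)" using mem by force
  qed
  then show "src ?H (q_ii (x, y, c)) = Exp x" "tgt ?H (q_ii (x, y, c)) = Exp x"
    by (simp_all add: groupoid_ii_def)
  \<comment> \<open>All lifts of the object give the same class, since the unit of the torus lifts
    to 0 and I(m, 0) = 0.\<close>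
  have "{(x', \<one>\<^bsub>\<T>\<^esub>, 1) | x'. Exp x' = Exp x} \<subseteq> rel_ii \<Lambda> I `` {(x, Exp 0, e2pi 0)}"
  proof
    fix p assume "p \<in> {(x', \<one>\<^bsub>\<T>\<^esub>, 1 :: complex) | x'. Exp x' = Exp x}"
    then obtain x' where p: "p = (x', Exp 0, 1)" and x': "Exp x' = Exp x" by (auto simp: torus_exp_0)
    have "x' - x \<in> \<Lambda>" using x' lattice_minus[of "x - x'"] by (simp add: torus_exp_eq_iff)
    then have "((x, Exp 0, e2pi 0), p) \<in> rel_ii \<Lambda> I" unfolding p rel_ii_iff by (simp add: I_simps)
    then show "p \<in> rel_ii \<Lambda> I `` {(x, Exp 0, e2pi 0)}" by blast
  qed
  moreover have "(x, \<one>\<^bsub>\<T>\<^esub>, 1) \<in> {(x', \<one>\<^bsub>\<T>\<^esub>, 1 :: complex) | x'. Exp x' = Exp x}" by blast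
  ultimately have "rel_ii \<Lambda> I `` {(x', \<one>\<^bsub>\<T>\<^esub>, 1) | x'. Exp x' = Exp x} = rel_ii \<Lambda> I `` {(x, Exp 0, e2pi 0)}"
    by (rule equiv_Image_subset_class[OF equiv_rel_ii])
  then show "iden ?H (Exp x) = q_ii (x, 0, 0)" by (simp add: groupoid_ii_def q_ii_def)
  fix y' :: 'a and c' :: real
  let ?X = "{(x1, s \<otimes>\<^bsub>\<T>\<^esub> s', z * z') | x1 s z s' z'.
      (x1, s, z) \<in> q_ii (x, y, c) \<and> (x1, s', z') \<in> q_ii (x, y', c')}"
  have "?X \<subseteq> rel_ii \<Lambda> I `` {(x, Exp (y + y'), e2pi (c + c'))}"
  proof
    fix p assume "p \<in> ?X"
    then obtain x1 s z s' z' where p: "p = (x1, s \<otimes>\<^bsub>\<T>\<^esub> s', z * z')" and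
      *: "(x1, s, z) \<in> q_ii (x, y, c)" "(x1, s', z') \<in> q_ii (x, y', c')"
      by (elim CollectE exE conjE) (rule that)
    have "s \<otimes>\<^bsub>\<T>\<^esub> s' = Exp (y + y')" using * by (simp add: q_ii_mem_iff torus_exp_add)
    moreover have "z * z' = e2pi (c + c' - I (x1 - x) (y + y'))"
      using * by (simp add: q_ii_mem_iff e2pi_add[symmetric] I_simps algebra_simps)
    moreover have "x1 - x \<in> \<Lambda>" using * by (simp add: q_ii_mem_iff)
    ultimately have "((x, Exp (y + y'), e2pi (c + c')), p) \<in> rel_ii \<Lambda> I"
      unfolding p rel_ii_iff by blast
    then show "p \<in> rel_ii \<Lambda> I `` {(x, Exp (y + y'), e2pi (c + c'))}" by blast
  qed
  moreover have "(x, Exp y \<otimes>\<^bsub>\<T>\<^esub> Exp y', e2pi c * e2pi c') \<in> ?X"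
    by (intro CollectI exI[of _ x] exI[of _ "Exp y"] exI[of _ "e2pi c"] exI[of _ "Exp y'"] exI[of _ "e2pi c'"]
        conjI refl mem)
  ultimately have "rel_ii \<Lambda> I `` ?X = rel_ii \<Lambda> I `` {(x, Exp (y + y'), e2pi (c + c'))}"
    by (rule equiv_Image_subset_class[OF equiv_rel_ii])
  then show "cmp ?H (q_ii (x, y, c)) (q_ii (x, y', c')) = q_ii (x, y + y', c + c')"
    by (simp add: groupoid_ii_def q_ii_def)
  fix x' :: 'a
  show "q_ii (x, y, c) = q_ii (x', y', c') \<longleftrightarrow>
      x' - x \<in> \<Lambda> \<and> y' - y \<in> \<Lambda> \<and> c' + I x' y' - (c + I x y) - I x (y' - y) \<in> \<int>"
    by (rule q_ii_eq_iff)
qed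

end

theorem theorem5p5:
  fixes \<Lambda> :: "'a::real_normed_vector set"
    and I J :: "'a \<Rightarrow> 'a \<Rightarrow> real"
  assumes "full_lattice \<Lambda>"
    and "even_symmetric_form \<Lambda> I"
    and "integral_form \<Lambda> J"
    and "\<And>m n. m \<in> \<Lambda> \<Longrightarrow> n \<in> \<Lambda> \<Longrightarrow> I m n = J m n + J n m"
  shows "inertia_equivalent_to \<Lambda> J (groupoid_i \<Lambda> I)
       \<and> inertia_equivalent_to \<Lambda> J (groupoid_ii \<Lambda> I)"
proof -
  obtain B where B: "finite B" "independent B" "span B = UNIV"
    "\<Lambda> = {\<Sum>b\<in>B. of_int (c b) *\<^sub>R b | c :: 'a \<Rightarrow> int. True}"
    using assms(1) unfolding full_lattice_def by blast
  have I: "bilinear I" and J: "bilinear J" "\<And>m n. m \<in> \<Lambda> \<Longrightarrow> n \<in> \<Lambda> \<Longrightarrow> J m n \<in> \<int>"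
    using assms(2,3) by (auto simp: even_symmetric_form_def integral_form_def)
  interpret cat_torus B \<Lambda> J
    by unfold_locales (rule B J | assumption)+
  \<comment> \<open>Both sides of the hypothesis relating I and J are bilinear on the vector space,
    so their equality on the lattice extends to all vectors, as the locale for the models
    requires.\<close>
  have "bilinear (\<lambda>x y. J x y + J y x)"
    unfolding bilinear_def
    by (intro conjI allI linearI)
      (simp_all add: J_simps bilinear_lmul[OF J(1)] bilinear_rmul[OF J(1)] distrib_left)
  then have "I x y = J x y + J y x" for x y
    using bilinear_eq_on_lattice[OF I] assms(4) by blast
  then interpret cat_torus_form B \<Lambda> J I
    by unfold_locales (rule I)
  show ?thesis
    using inertia_model.inertia_equivalent_to_H[OF model_i]
      inertia_model.inertia_equivalent_to_H[OF model_ii] by blast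
qed

end
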